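(* Let $\rho$ be a state of two qubits and let $F^*(\rho)=\sup_\Lambda F(\Lambda(\rho))$, the supremum being over all trace-preserving LOCC operations $\Lambda$ from two qubits to two qubits. Then $$F^*(\rho)=\min_{p,\rho_Z}\ \frac{1}{2(1-p)},$$ where the minimum is over all $0\le p<1$ and all two-qubit states $\rho_Z$ such that the mixture $\rho'=(1-p)\rho+p\rho_Z$ is separable.
   Context: A state of two qubits is a positive semidefinite operator of trace one on $\mathbb{C}^2\otimes\mathbb{C}^2$; it is separable if it is a convex combination of product states. The fidelity (maximal singlet fraction) is $F(\rho)=\max_{|\psi\rangle}\langle\psi|\rho|\psi\rangle$, the maximum being over all maximally entangled unit vectors, i.e. $|\psi\rangle=(U\otimes V)(|00\rangle+|11\rangle)/\sqrt2$ with $U,V$ unitary. A trace-preserving LOCC operation is a completely positive trace-preserving map realized by finitely many rounds of local quantum operations (local instruments) by the two parties, each of which may depend on classical communication of earlier outcomes. *)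

theory Defs
  imports Complex_Main "Jordan_Normal_Form.Schur_Decomposition"
begin

section \<open>Operators, tensor products and states\<close>

text \<open>Operators on \<open>\<complex>\<^sup>n\<close> are complex \<open>n \<times> n\<close> matrices. The space \<open>\<complex>\<^sup>a \<otimes> \<complex>\<^sup>b\<close> is identified with
  \<open>\<complex>\<close> to the power \<open>a * b\<close> by giving the basis vector \<open>|i\<rangle> \<otimes> |j\<rangle>\<close> the index \<open>i * b + j\<close>.\<close>

definition mat_trace :: "complex mat \<Rightarrow> complex" where
  "mat_trace A = (\<Sum>i<dim_row A. A $$ (i, i))"

definition mat_sum :: "nat \<Rightarrow> (nat \<Rightarrow> complex mat) \<Rightarrow> nat \<Rightarrow> complex mat" where
  "mat_sum n A r = mat n n (\<lambda>ij. \<Sum>k<r. A k $$ ij)"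

definition tensor_mat :: "complex mat \<Rightarrow> complex mat \<Rightarrow> complex mat" where
  "tensor_mat A B = mat (dim_row A * dim_row B) (dim_col A * dim_col B)
     (\<lambda>(i, j). A $$ (i div dim_row B, j div dim_col B) * B $$ (i mod dim_row B, j mod dim_col B))"

definition tensor_vec :: "complex vec \<Rightarrow> complex vec \<Rightarrow> complex vec" where
  "tensor_vec v w = vec (dim_vec v * dim_vec w)
     (\<lambda>i. v $ (i div dim_vec w) * w $ (i mod dim_vec w))"

text \<open>In the order on \<^typ>\<open>complex\<close>, \<open>0 \<le> z\<close> says that \<open>z\<close> is real and nonnegative.\<close>

definition psd :: "nat \<Rightarrow> complex mat \<Rightarrow> bool" where
  "psd n A \<longleftrightarrow> A \<in> carrier_mat n n \<and> (\<forall>v \<in> carrier_vec n. 0 \<le> (A *\<^sub>v v) \<bullet>c v)"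

definition is_state :: "nat \<Rightarrow> complex mat \<Rightarrow> bool" where
  "is_state n \<rho> \<longleftrightarrow> psd n \<rho> \<and> mat_trace \<rho> = 1"

definition separable :: "nat \<Rightarrow> nat \<Rightarrow> complex mat \<Rightarrow> bool" where
  "separable a b \<rho> \<longleftrightarrow> (\<exists>r (q :: nat \<Rightarrow> real) \<sigma> \<tau>.
     (\<forall>k<r. 0 \<le> q k \<and> is_state a (\<sigma> k) \<and> is_state b (\<tau> k)) \<and> (\<Sum>k<r. q k) = 1 \<and>
     \<rho> = mat_sum (a * b) (\<lambda>k. complex_of_real (q k) \<cdot>\<^sub>m tensor_mat (\<sigma> k) (\<tau> k)) r)"

section \<open>Singlet fraction\<close>

definition is_unitary :: "nat \<Rightarrow> complex mat \<Rightarrow> bool" where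
  "is_unitary n U \<longleftrightarrow> U \<in> carrier_mat n n \<and> mat_adjoint U * U = 1\<^sub>m n"

definition bell_vec :: "complex vec" where
  "bell_vec = complex_of_real (1 / sqrt 2) \<cdot>\<^sub>v
     (tensor_vec (unit_vec 2 0) (unit_vec 2 0) + tensor_vec (unit_vec 2 1) (unit_vec 2 1))"

definition maximally_entangled :: "complex vec \<Rightarrow> bool" where
  "maximally_entangled \<psi> \<longleftrightarrow>
     (\<exists>U V. is_unitary 2 U \<and> is_unitary 2 V \<and> \<psi> = tensor_mat U V *\<^sub>v bell_vec)"

text \<open>The supremum is a maximum, by compactness of the unitary group.\<close>

definition singlet_fraction :: "complex mat \<Rightarrow> real" where
  "singlet_fraction \<rho> = (SUP \<psi> \<in> {\<psi>. maximally_entangled \<psi>}. Re ((\<rho> *\<^sub>v \<psi>) \<bullet>c \<psi>))"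

section \<open>Local instruments and LOCC\<close>

text \<open>For a linear map \<open>\<Phi>\<close> from \<open>m \<times> m\<close> to \<open>n \<times> n\<close> matrices, \<open>act_left m n b \<Phi>\<close> is \<open>\<Phi> \<otimes> id\<close> on
  operators on \<open>\<complex>\<^sup>m \<otimes> \<complex>\<^sup>b\<close>, and \<open>act_right a m n \<Phi>\<close> is \<open>id \<otimes> \<Phi>\<close> on operators on \<open>\<complex>\<^sup>a \<otimes> \<complex>\<^sup>m\<close>.\<close>

definition act_left ::
  "nat \<Rightarrow> nat \<Rightarrow> nat \<Rightarrow> (complex mat \<Rightarrow> complex mat) \<Rightarrow> complex mat \<Rightarrow> complex mat" where
  "act_left m n b \<Phi> X = mat (n * b) (n * b) (\<lambda>(r, s).
     \<Phi> (mat m m (\<lambda>(i, k). X $$ (i * b + r mod b, k * b + s mod b))) $$ (r div b, s div b))"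

definition act_right ::
  "nat \<Rightarrow> nat \<Rightarrow> nat \<Rightarrow> (complex mat \<Rightarrow> complex mat) \<Rightarrow> complex mat \<Rightarrow> complex mat" where
  "act_right a m n \<Phi> X = mat (a * n) (a * n) (\<lambda>(r, s).
     \<Phi> (mat m m (\<lambda>(i, k). X $$ ((r div n) * m + i, (s div n) * m + k))) $$ (r mod n, s mod n))"

definition linear_op :: "nat \<Rightarrow> nat \<Rightarrow> (complex mat \<Rightarrow> complex mat) \<Rightarrow> bool" where
  "linear_op m n \<Phi> \<longleftrightarrow>
     (\<forall>X \<in> carrier_mat m m. \<Phi> X \<in> carrier_mat n n) \<and>
     (\<forall>X \<in> carrier_mat m m. \<forall>Y \<in> carrier_mat m m. \<Phi> (X + Y) = \<Phi> X + \<Phi> Y) \<and>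
     (\<forall>c. \<forall>X \<in> carrier_mat m m. \<Phi> (c \<cdot>\<^sub>m X) = c \<cdot>\<^sub>m \<Phi> X)"

definition completely_positive :: "nat \<Rightarrow> nat \<Rightarrow> (complex mat \<Rightarrow> complex mat) \<Rightarrow> bool" where
  "completely_positive m n \<Phi> \<longleftrightarrow> linear_op m n \<Phi> \<and>
     (\<forall>k X. psd (m * k) X \<longrightarrow> psd (n * k) (act_left m n k \<Phi> X))"

definition instrument :: "nat \<Rightarrow> nat \<Rightarrow> nat \<Rightarrow> (nat \<Rightarrow> complex mat \<Rightarrow> complex mat) \<Rightarrow> bool" where
  "instrument m n r \<Phi> \<longleftrightarrow> (\<forall>k<r. completely_positive m n (\<Phi> k)) \<and>
     (\<forall>X \<in> carrier_mat m m. (\<Sum>k<r. mat_trace (\<Phi> k X)) = mat_trace X)"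

text \<open>\<open>locc a b c d \<Lambda>\<close>: the map \<open>\<Lambda>\<close> from operators on \<open>\<complex>\<^sup>a \<otimes> \<complex>\<^sup>b\<close> to operators on \<open>\<complex>\<^sup>c \<otimes> \<complex>\<^sup>d\<close> is
  realized by a protocol of finitely many rounds. In each round one party applies a local
  instrument, possibly changing the dimension of its system (adding or discarding local ancillas),
  and announces the outcome \<open>k\<close>; the remaining protocol \<open>\<Psi> k\<close> may depend on \<open>k\<close>, hence on all earlier
  outcomes. The outcomes are forgotten at the end, so that \<open>\<Lambda>\<close> is the sum over all branches; it is
  completely positive and trace preserving because every instrument is trace preserving in total.\<close>

inductive locc :: "nat \<Rightarrow> nat \<Rightarrow> nat \<Rightarrow> nat \<Rightarrow> (complex mat \<Rightarrow> complex mat) \<Rightarrow> bool" where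
  stop: "locc a b a b (\<lambda>X. X)"
| alice: "instrument a a' r \<Phi> \<Longrightarrow> (\<And>k. k < r \<Longrightarrow> locc a' b c d (\<Psi> k)) \<Longrightarrow>
    locc a b c d (\<lambda>X. mat_sum (c * d) (\<lambda>k. \<Psi> k (act_left a a' b (\<Phi> k) X)) r)"
| bob: "instrument b b' r \<Phi> \<Longrightarrow> (\<And>k. k < r \<Longrightarrow> locc a b' c d (\<Psi> k)) \<Longrightarrow>
    locc a b c d (\<lambda>X. mat_sum (c * d) (\<lambda>k. \<Psi> k (act_right a b b' (\<Phi> k) X)) r)"

definition optimal_fidelity :: "complex mat \<Rightarrow> real" where
  "optimal_fidelity \<rho> = (SUP \<Lambda> \<in> {\<Lambda>. locc 2 2 2 2 \<Lambda>}. singlet_fraction (\<Lambda> \<rho>))"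

section \<open>The local actions on product operators\<close>

lemma mult_add_less: "(i::nat) < m \<Longrightarrow> j < b \<Longrightarrow> i * b + j < m * b"
  using mult_le_mono1[of "Suc i" m b] by simp

lemma act_left_tensor:
  assumes "linear_op m n \<Phi>" "A \<in> carrier_mat m m" "B \<in> carrier_mat b b"
  shows "act_left m n b \<Phi> (tensor_mat A B) = tensor_mat (\<Phi> A) B"
proof -
  have c: "\<Phi> A \<in> carrier_mat n n" and h: "\<And>c. \<Phi> (c \<cdot>\<^sub>m A) = c \<cdot>\<^sub>m \<Phi> A"
    using assms by (auto simp: linear_op_def)
  have blk: "mat m m (\<lambda>(i, k). tensor_mat A B $$ (i * b + r mod b, k * b + s mod b))
      = B $$ (r mod b, s mod b) \<cdot>\<^sub>m A" if "b > 0" for r s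
    using assms that by (intro eq_matI) (auto simp: tensor_mat_def mult_add_less mult.commute)
  show ?thesis
  proof (rule eq_matI)
    fix r s assume rs: "r < dim_row (tensor_mat (\<Phi> A) B)" "s < dim_col (tensor_mat (\<Phi> A) B)"
    hence rs': "r < n * b" "s < n * b" using c assms by (auto simp: tensor_mat_def)
    hence b: "b > 0" by (cases b) auto
    have d: "r div b < n" "s div b < n" using rs' by (auto simp: less_mult_imp_div_less)
    show "act_left m n b \<Phi> (tensor_mat A B) $$ (r, s) = tensor_mat (\<Phi> A) B $$ (r, s)"
      using c assms rs' d by (auto simp: act_left_def blk[OF b] h) (simp add: tensor_mat_def)
  qed (use c assms in \<open>auto simp: act_left_def tensor_mat_def\<close>)
qed

lemma act_right_tensor:
  assumes "linear_op m n \<Phi>" "A \<in> carrier_mat a a" "B \<in> carrier_mat m m"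
  shows "act_right a m n \<Phi> (tensor_mat A B) = tensor_mat A (\<Phi> B)"
proof -
  have c: "\<Phi> B \<in> carrier_mat n n" and h: "\<And>c. \<Phi> (c \<cdot>\<^sub>m B) = c \<cdot>\<^sub>m \<Phi> B"
    using assms by (auto simp: linear_op_def)
  have blk: "mat m m (\<lambda>(i, k). tensor_mat A B $$ ((r div n) * m + i, (s div n) * m + k))
      = A $$ (r div n, s div n) \<cdot>\<^sub>m B" if "r div n < a" "s div n < a" for r s
    using assms that by (intro eq_matI) (auto simp: tensor_mat_def mult_add_less)
  show ?thesis
  proof (rule eq_matI)
    fix r s assume rs: "r < dim_row (tensor_mat A (\<Phi> B))" "s < dim_col (tensor_mat A (\<Phi> B))"
    hence rs': "r < a * n" "s < a * n" using c assms by (auto simp: tensor_mat_def)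
    hence n: "n > 0" by (cases n) auto
    have d: "r div n < a" "s div n < a" using rs' by (auto simp: less_mult_imp_div_less)
    show "act_right a m n \<Phi> (tensor_mat A B) $$ (r, s) = tensor_mat A (\<Phi> B) $$ (r, s)"
      using c assms rs' n by (auto simp: act_right_def blk[OF d] h) (simp add: tensor_mat_def)
  qed (use c assms in \<open>auto simp: act_right_def tensor_mat_def\<close>)
qed

end

theory Submission
  imports "HOL-Analysis.Function_Topology" "HOL-Analysis.Topology_Euclidean_Space" Defs
begin

text \<open>Both sides are compared with the least trace \<open>t\<close> of an operator \<open>\<tau> \<ge> \<rho>\<close> with positive partial
  transpose, which for two qubits means separable; \<open>\<tau> = \<rho> + Z\<close> normalizes to the mixture
  \<open>(1 - p) \<rho> + p \<rho>\<^sub>Z\<close> with \<open>1 / (1 - p) = t\<close>.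

  LOCC operations map separable states to separable states, whose fidelity is at most \<open>1 / 2\<close>, so that
  \<open>(1 - p) F(\<Lambda> \<rho>) \<le> 1 / 2\<close> for every admissible mixture. Conversely, let \<open>\<rho>\<close> have full rank. A
  two-dimensional subspace of \<open>\<complex>\<^sup>2 \<otimes> \<complex>\<^sup>2\<close> contains a product vector, so that the kernel of the partial
  transpose \<open>\<tau>\<^sup>\<Gamma>\<close> of the minimizer is spanned by at most one vector \<open>\<phi>\<close>. Optimality against adding a
  product state gives \<open>t / 2 \<le> 1 / 2 - \<langle>\<phi>|\<rho>\<^sup>\<Gamma>|\<phi>\<rangle>\<close> for a suitable scaling of \<open>\<phi>\<close>, and this is the
  fidelity reached when Alice applies the filter determined by \<open>\<phi>\<close> and both parties prepare \<open>|00\<rangle>\<close>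
  upon failure. The general case follows by adding white noise.\<close>

section \<open>Positive operators on a finite index set\<close>

text \<open>One constant makes the two bounds meet. The vectors (A^dagger tensor I) psi_- with a
  contraction A are those whose squared overlap with product unit vectors is at most 1/2. If \<phi>
  attains this bound, a product operator of trace s can raise the form of the partial transpose at
  \<phi> by s/2; minimality of \<tau> against this gain gives tr(\<tau> - \<rho>) \<le> -2
  <\<phi>|\<rho>^\<Gamma>|\<phi>>. The same scaling makes A an admissible filter. The fidelity
  reached has its form because the partial transpose of the Bell projector is I/2 - |psi_-><psi_-|.
  Full rank keeps the kernel small: on product vectors the forms of \<tau> and \<tau>^\<Gamma> agree
  up to a conjugation, so a product vector in the kernel of \<tau>^\<Gamma> would give a null vector
  of \<tau> \<ge> \<rho>. Separability is obtained by subtracting a multiple of the identity until a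
  kernel vector appears. If that vector is entangled, a local filter moves the operator to the
  symmetric subspace, where it is a positive real quadratic form on Minkowski space with vanishing
  Lorentz trace. Such a form is a sum of squares of null vectors, and these are, up to sign,
  positive matrices of rank at most one.\<close>

definition sesq :: "('i::finite \<Rightarrow> 'i \<Rightarrow> complex) \<Rightarrow> ('i \<Rightarrow> complex) \<Rightarrow> ('i \<Rightarrow> complex) \<Rightarrow> complex" where
  "sesq X u v = (\<Sum>r\<in>UNIV. \<Sum>s\<in>UNIV. cnj (u r) * X r s * v s)"

definition pos :: "('i::finite \<Rightarrow> 'i \<Rightarrow> complex) \<Rightarrow> bool" where
  "pos X \<longleftrightarrow> (\<forall>v. 0 \<le> sesq X v v)"

definition ket :: "'i \<Rightarrow> 'i \<Rightarrow> complex" where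
  "ket r = (\<lambda>i. if i = r then 1 else 0)"

lemma sesq_add_right: "sesq X u (\<lambda>i. v i + w i) = sesq X u v + sesq X u w"
  by (simp add: sesq_def algebra_simps sum.distrib)

lemma sesq_add_left: "sesq X (\<lambda>i. v i + w i) u = sesq X v u + sesq X w u"
  by (simp add: sesq_def algebra_simps sum.distrib)

lemma sesq_scale_right: "sesq X u (\<lambda>i. c * v i) = c * sesq X u v"
  by (simp add: sesq_def algebra_simps sum_distrib_left)

lemma sesq_scale_left: "sesq X (\<lambda>i. c * v i) u = cnj c * sesq X v u"
  by (simp add: sesq_def algebra_simps sum_distrib_left)

lemma sesq_add_op: "sesq (\<lambda>r s. X r s + Y r s) u v = sesq X u v + sesq Y u v"
  by (simp add: sesq_def algebra_simps sum.distrib)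

lemma sesq_diff_op: "sesq (\<lambda>r s. X r s - Y r s) u v = sesq X u v - sesq Y u v"
  by (simp add: sesq_def algebra_simps sum_subtractf)

lemma sesq_scale_op: "sesq (\<lambda>r s. c * X r s) u v = c * sesq X u v"
  by (simp add: sesq_def algebra_simps sum_distrib_left)

lemmas sesq_linear = sesq_add_right sesq_add_left sesq_scale_right sesq_scale_left
  sesq_add_op sesq_diff_op sesq_scale_op

lemma sesq_rank_one:
  "sesq (\<lambda>r s. x r * cnj (y s)) u v = (\<Sum>r\<in>UNIV. cnj (u r) * x r) * (\<Sum>s\<in>UNIV. cnj (y s) * v s)"
  unfolding sesq_def sum_product by (simp add: ac_simps)

lemma sesq_ket_left: "sesq X (ket r) v = (\<Sum>s\<in>UNIV. X r s * v s)"
proof -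
  have "sesq X (ket r) v = (\<Sum>i\<in>UNIV. if i = r then \<Sum>s\<in>UNIV. X i s * v s else 0)"
    unfolding sesq_def ket_def by (intro sum.cong) auto
  then show ?thesis by simp
qed

lemma sesq_ket: "sesq X (ket r) (ket s) = X r s"
  by (simp add: sesq_ket_left) (simp add: ket_def if_distrib[of "\<lambda>x. _ * x"] cong: if_cong)

lemma mult_cnj_nonneg: "0 \<le> z * cnj z" "0 \<le> cnj z * z"
  by (simp_all add: complex_mult_cnj less_eq_complex_def)

lemma pos_rank_one: "pos (\<lambda>r s. x r * cnj (x s))"
proof -
  have "(\<Sum>s\<in>UNIV. cnj (x s) * v s) = cnj (\<Sum>r\<in>UNIV. cnj (v r) * x r)" for v
    by (simp add: mult.commute)
  then show ?thesis
    by (simp only: pos_def sesq_rank_one mult_cnj_nonneg simp_thms)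
qed

lemma pos_add: "pos X \<Longrightarrow> pos Y \<Longrightarrow> pos (\<lambda>r s. X r s + Y r s)"
  by (simp add: pos_def sesq_linear)

lemma pos_scale: "0 \<le> c \<Longrightarrow> pos X \<Longrightarrow> pos (\<lambda>r s. c * X r s)"
  by (simp add: pos_def sesq_linear)

lemma quad_add:
  "sesq X (\<lambda>i. u i + c * v i) (\<lambda>i. u i + c * v i) =
     sesq X u u + c * sesq X u v + cnj c * sesq X v u + c * cnj c * sesq X v v"
  by (simp add: sesq_linear algebra_simps)

text \<open>Polarization: the form is real on all vectors, and reality at u + v and u + iv fixes
  both parts of \<open>sesq X v u\<close>. Hermiticity comes with \<open>pos\<close> because
  nonnegative complex numbers are real.\<close>

lemma pos_sesq_sym:
  assumes "pos X" shows "sesq X v u = cnj (sesq X u v)"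
proof -
  have im: "Im (sesq X w w) = 0" for w
    using assms by (simp add: pos_def less_eq_complex_def)
  have "Im (sesq X u v + sesq X v u) = 0" 
    using im[of "\<lambda>i. u i + 1 * v i"] im[of u] im[of v] unfolding quad_add by simp
  moreover have "Im (\<i> * sesq X u v - \<i> * sesq X v u) = 0" 
    using im[of "\<lambda>i. u i + \<i> * v i"] im[of u] im[of v] unfolding quad_add by simp
  ultimately show ?thesis by (simp add: complex_eq_iff)
qed

lemma pos_sym: "pos X \<Longrightarrow> X s r = cnj (X r s)"
  using pos_sesq_sym[of X "ket s" "ket r"] by (simp add: sesq_ket)

lemma pos_diag: "pos X \<Longrightarrow> 0 \<le> X r r"
  unfolding pos_def by (metis sesq_ket)

text \<open>The form is tested at \<open>ket r\<close> plus a phase times \<open>ket s\<close>, the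
  phase turning the cross term into minus the modulus of \<open>X r s\<close>. Hence a bounded trace
  bounds all entries, the source of compactness later on.\<close>

lemma pos_entry_bound:
  assumes "pos X" shows "2 * cmod (X r s) \<le> Re (X r r) + Re (X s s)"
proof -
  define c where "c = - cnj (sgn (X r s))"
  have "0 \<le> Re (sesq X (\<lambda>i. ket r i + c * ket s i) (\<lambda>i. ket r i + c * ket s i))"
    using assms by (simp add: pos_def less_eq_complex_def)
  also have "\<dots> = Re (X r r) + 2 * Re (c * X r s) + Re (c * cnj c * X s s)"
    unfolding quad_add sesq_ket using pos_sym[OF assms, of s r] by simp
  also have "c * X r s = - cmod (X r s)"
    using complex_norm_square[of "X r s"]
    by (cases "X r s = 0") (auto simp: c_def sgn_eq power2_eq_square mult.commute divide_eq_eq)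
  also have "Re (c * cnj c * X s s) \<le> Re (X s s)"
    using pos_diag[OF assms, of s]
    using complex_norm_square[of "X r s"]
    by (cases "X r s = 0") (auto simp: c_def sgn_eq power2_eq_square less_eq_complex_def mult.commute)
  finally show ?thesis by simp
qed

text \<open>If v is a null vector, the form at u + c v has no term quadratic in c, so it can stay
  nonnegative only if the cross term vanishes.\<close>

lemma pos_kernel:
  assumes "pos X" "sesq X v v = 0" shows "sesq X u v = 0"
proof (rule ccontr)
  assume n: "sesq X u v \<noteq> 0"
  define z where "z = sesq X u v"
  \<comment> \<open>Chosen so that the value of the form below is exactly -1.\<close>
  define t where "t = (Re (sesq X u u) + 1) / (2 * (cmod z)\<^sup>2)"
  have "0 \<le> Re (sesq X (\<lambda>i. u i + (- t * cnj z) * v i) (\<lambda>i. u i + (- t * cnj z) * v i))"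
    using assms by (simp add: pos_def less_eq_complex_def)
  also have "\<dots> = Re (sesq X u u) - 2 * t * (cmod z)\<^sup>2"
    unfolding quad_add assms(2) pos_sesq_sym[OF assms(1), of v u] 
    by (simp add: z_def[symmetric] cmod_def power2_eq_square) (simp add: algebra_simps)
  also have "\<dots> = -1" using n by (simp add: t_def z_def field_simps)
  finally show False by simp
qed

lemma pos_row_zero:
  assumes "pos X" "X s s = 0" shows "X r s = 0" "X s r = 0"
  using pos_kernel[OF assms(1), of "ket s" "ket r"] assms pos_sym[OF assms(1), of s r]
  by (simp_all add: sesq_ket)

text \<open>The junk value \<open>x / 0 = 0\<close> is right here: if \<open>X s s = 0\<close>, the row and column \<open>s\<close> of \<open>X\<close> vanish.\<close>

lemma schur_complement:
  assumes "pos X" shows "pos (\<lambda>r t. X r t - X r s * X s t / X s s)"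
proof (cases "X s s = 0")
  case True then show ?thesis using assms by simp
next
  case False
  show ?thesis unfolding pos_def
  proof
    fix v
    define w where "w = sesq X (ket s) v"
    have re: "cnj (X s s) = X s s" by (rule pos_sym[OF assms, symmetric])
    have w': "sesq X v (ket s) = cnj w" unfolding w_def by (rule pos_sesq_sym[OF assms])
    have "(\<lambda>r t. X r s * X s t / X s s) = (\<lambda>r t. (1 / X s s) * (X r s * cnj (X t s)))"
      unfolding pos_sym[OF assms, of s, symmetric] by simp
    then have "sesq (\<lambda>r t. X r s * X s t / X s s) v v = (1 / X s s) *
      ((\<Sum>r\<in>UNIV. cnj (v r) * X r s) * (\<Sum>t\<in>UNIV. cnj (X t s) * v t))"
      by (simp only: sesq_scale_op sesq_rank_one)
    moreover have "(\<Sum>t\<in>UNIV. cnj (X t s) * v t) = w"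
      unfolding w_def sesq_ket_left pos_sym[OF assms, of s, symmetric] by simp
    moreover have "(\<Sum>r\<in>UNIV. cnj (v r) * X r s) = cnj w"
      unfolding w_def sesq_ket_left cnj_sum complex_cnj_mult pos_sym[OF assms, of _ s, symmetric]
      by (simp add: mult.commute)
    ultimately have 1: "sesq (\<lambda>r t. X r s * X s t / X s s) v v = cnj w * w / X s s"
      by simp
    \<comment> \<open>This multiple of \<open>ket s\<close> minimizes the form over v plus multiples
      of \<open>ket s\<close>; the minimum is the value of the Schur complement at v.\<close>
    have "0 \<le> sesq X (\<lambda>i. v i + (- w / X s s) * ket s i) (\<lambda>i. v i + (- w / X s s) * ket s i)"
      using assms by (simp add: pos_def)
    also have "\<dots> = sesq X v v - cnj w * w / X s s"
      unfolding quad_add w' w_def[symmetric] sesq_ket using False re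
      by (simp add: field_simps)
    finally show "0 \<le> sesq (\<lambda>r t. X r t - X r s * X s t / X s s) v v"
      by (simp add: sesq_diff_op 1)
  qed
qed

text \<open>Cholesky decomposition: the Schur complement at \<open>a\<close> clears row and column
  \<open>a\<close>, and the part removed is the dyad of \<open>x\<close>. The set \<open>A\<close>
  holds the rows that may still be nonzero. Real entries stay real in each step, which yields the
  version for real quadratic forms.\<close>

lemma pos_decomposition_aux:
  fixes A :: "'i::finite set"
  assumes "finite A" "pos X" "\<And>r s. X r s \<noteq> 0 \<Longrightarrow> r \<in> A"
  shows "\<exists>vs. (\<forall>r s. X r s = (\<Sum>v\<leftarrow>vs. v r * cnj (v s))) \<and>
    ((\<forall>r s. X r s \<in> \<real>) \<longrightarrow> (\<forall>v\<in>set vs. \<forall>r. v r \<in> \<real>))"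
  using assms
proof (induction A arbitrary: X rule: finite_induct)
  case empty
  then show ?case by (intro exI[of _ "[]"]) auto
next
  case (insert a A)
  define x where "x = (\<lambda>r. X r a / complex_of_real (sqrt (Re (X a a))))"
  define Y where "Y = (\<lambda>r t. X r t - X r a * X a t / X a a)"
  have d: "0 \<le> X a a" by (rule pos_diag[OF insert.prems(1)])
  then have sq: "complex_of_real (sqrt (Re (X a a))) * complex_of_real (sqrt (Re (X a a))) = X a a"
    by (simp add: less_eq_complex_def complex_eq_iff)
  have xx: "x r * cnj (x s) = X r a * X a s / X a a" for r s
    using pos_sym[OF insert.prems(1), of a s] by (simp add: x_def sq)
  have YA: "r \<in> A" if "Y r s \<noteq> 0" for r s
  proof (cases "r = a")
    case True
    have "Y a s = 0"
      using pos_row_zero[OF insert.prems(1), of a] by (cases "X a a = 0") (auto simp: Y_def)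
    then show ?thesis using that True by simp
  next
    case False
    have "X r s \<noteq> 0 \<or> X r a \<noteq> 0" using that by (auto simp: Y_def)
    then show ?thesis using insert.prems(2)[of r] False by blast
  qed
  obtain vs where vs: "\<And>r s. Y r s = (\<Sum>v\<leftarrow>vs. v r * cnj (v s))"
    "(\<forall>r s. Y r s \<in> \<real>) \<longrightarrow> (\<forall>v\<in>set vs. \<forall>r. v r \<in> \<real>)"
    using insert.IH[of Y] schur_complement[OF insert.prems(1), of a] YA
    unfolding Y_def by blast
  have "X r s = (\<Sum>v\<leftarrow>x # vs. v r * cnj (v s))" for r s
    using vs(1)[of r s] by (simp add: xx Y_def algebra_simps)
  moreover have "v r \<in> \<real>" if R: "\<forall>r s. X r s \<in> \<real>" and v: "v \<in> set (x # vs)" for v r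
  proof -
    have "\<forall>r s. Y r s \<in> \<real>" "x r \<in> \<real>" using R by (auto simp: Y_def x_def)
    then show ?thesis using vs(2) v by auto
  qed
  ultimately show ?case by blast
qed

lemma pos_decomposition:
  assumes "pos X"
  obtains vs where "\<And>r s. X r s = (\<Sum>v\<leftarrow>vs. v r * cnj (v s))"
  using pos_decomposition_aux[OF finite_class.finite_UNIV assms] by auto

text \<open>The complex form is the real form at the real part plus the real form at the imaginary
  part; the cross terms cancel by symmetry. The Cholesky vectors are then real, so the conjugation
  disappears.\<close>

lemma real_pos_decomposition:
  fixes R :: "'i::finite \<Rightarrow> 'i \<Rightarrow> real"
  assumes sym: "\<And>r s. R r s = R s r" and nonneg: "\<And>y. 0 \<le> (\<Sum>r\<in>UNIV. \<Sum>s\<in>UNIV. y r * R r s * y s)"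
  obtains vs where "\<And>r s. R r s = (\<Sum>v\<leftarrow>vs. v r * v s)"
proof -
  have "pos (\<lambda>r s. complex_of_real (R r s))" unfolding pos_def
  proof
    fix v
    have swap: "(\<Sum>r\<in>UNIV. \<Sum>s\<in>UNIV. Im (v r) * R r s * Re (v s)) = (\<Sum>r\<in>UNIV. \<Sum>s\<in>UNIV. Re (v r) * R r s * Im (v s))"
      by (subst sum.swap) (simp add: sym mult.commute mult.left_commute)
    have "Re (sesq (\<lambda>r s. complex_of_real (R r s)) v v) =
      (\<Sum>r\<in>UNIV. \<Sum>s\<in>UNIV. Re (v r) * R r s * Re (v s)) + (\<Sum>r\<in>UNIV. \<Sum>s\<in>UNIV. Im (v r) * R r s * Im (v s))"
      by (simp add: sesq_def sum.distrib)
    moreover have "Im (sesq (\<lambda>r s. complex_of_real (R r s)) v v) = 0"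
      using swap by (simp add: sesq_def sum_subtractf)
    ultimately show "0 \<le> sesq (\<lambda>r s. complex_of_real (R r s)) v v"
      using nonneg[of "\<lambda>r. Re (v r)"] nonneg[of "\<lambda>r. Im (v r)"] by (simp add: less_eq_complex_def)
  qed
  from pos_decomposition_aux[OF finite_class.finite_UNIV this] obtain vs where
    vs: "\<And>r s. complex_of_real (R r s) = (\<Sum>v\<leftarrow>vs. v r * cnj (v s))" "\<And>v r. v \<in> set vs \<Longrightarrow> v r \<in> \<real>"
    by auto
  have "R r s = (\<Sum>v\<leftarrow>map (\<lambda>v r. Re (v r)) vs. v r * v s)" for r s
  proof -
    have "complex_of_real (\<Sum>v\<leftarrow>ws. Re (v r) * Re (v s)) = (\<Sum>v\<leftarrow>ws. v r * cnj (v s))"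
      if "set ws \<subseteq> set vs" for ws
      using that 
    proof (induction ws)
      case (Cons w ws)
      then have "w r \<in> \<real>" "w s \<in> \<real>" using vs(2) by auto
      then show ?case using Cons by (auto simp: complex_is_Real_iff complex_eq_iff)
    qed auto
    from this[of vs] have "complex_of_real (R r s) = complex_of_real (\<Sum>v\<leftarrow>vs. Re (v r) * Re (v s))"
      using vs(1) by simp
    then show ?thesis by (simp only: of_real_eq_iff) (simp add: comp_def)
  qed
  then show thesis by (rule that)
qed

section \<open>Isotropic decompositions of real quadratic forms\<close>

lemma sum_list_remove1: "x \<in> set xs \<Longrightarrow> (\<Sum>y\<leftarrow>xs. f y) = f x + (\<Sum>y\<leftarrow>remove1 x xs. (f y :: real))"
  by (induction xs) auto

text \<open>Two vectors on which the form \<open>q\<close> has opposite signs are rotated in their plane until one of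
  them is isotropic; this does not change the sum of the dyads.\<close>

lemma isotropic_decomposition:
  fixes q :: "('i \<Rightarrow> real) \<Rightarrow> real"
  assumes quad: "\<And>\<alpha> \<beta> u v. q (\<lambda>i. \<alpha> * u i + \<beta> * v i) = \<alpha>\<^sup>2 * q u + 2 * \<alpha> * \<beta> * b u v + \<beta>\<^sup>2 * q v"
    and "(\<Sum>v\<leftarrow>vs. q v) = 0"
  shows "\<exists>ws. (\<forall>w\<in>set ws. q w = 0) \<and> (\<forall>r s. (\<Sum>w\<leftarrow>ws. w r * w s) = (\<Sum>v\<leftarrow>vs. v r * v s))"
  using assms(2)
proof (induction "length vs" arbitrary: vs)
  case 0
  then show ?case by (intro exI[of _ "[]"]) auto
next
  case (Suc n)
  show ?case
  proof (cases "\<forall>v\<in>set vs. q v = 0")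
    case True then show ?thesis by blast
  next
    case False
    have neg: "(\<Sum>v\<leftarrow>xs. - q v) = - (\<Sum>v\<leftarrow>xs. q v)" for xs
      by (induction xs) auto
    have "\<exists>u\<in>set vs. q u > 0"
    proof (rule ccontr)
      assume "\<not> ?thesis"
      then have "\<forall>v\<in>set vs. 0 \<le> - q v" by force
      moreover have "(\<Sum>v\<leftarrow>vs. - q v) = 0" using Suc.prems by (simp add: neg)
      ultimately have "\<forall>x\<in>set (map (\<lambda>v. - q v) vs). x = 0"
        by (subst sum_list_nonneg_eq_0_iff[symmetric]) auto
      then show False using False by auto
    qed
    then obtain u where u: "u \<in> set vs" "q u > 0" by blast
    have "\<exists>w\<in>set vs. q w < 0"
    proof (rule ccontr)
      assume "\<not> ?thesis"
      then have "\<forall>v\<in>set vs. 0 \<le> q v" by force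
      then have "\<forall>v\<in>set vs. q v = 0" using sum_list_nonneg_eq_0_iff[of "map q vs"] Suc.prems by auto
      then show False using False by simp
    qed
    then obtain w where w: "w \<in> set vs" "q w < 0" by blast
    define rest where "rest = remove1 w (remove1 u vs)"
    have w1: "w \<in> set (remove1 u vs)" using u w by (metis in_set_remove1 less_asym)
    have split: "(\<Sum>y\<leftarrow>vs. f y) = f u + f w + (\<Sum>y\<leftarrow>rest. f y)" for f :: "_ \<Rightarrow> real"
      unfolding rest_def sum_list_remove1[OF u(1)] sum_list_remove1[OF w1] by simp
    have len: "length rest = n - 1" "n \<ge> 1"
      using u(1) w1 Suc.hyps(2) length_pos_if_in_set[OF w1] by (auto simp: rest_def length_remove1)
    define D where "D = (b u w)\<^sup>2 - q u * q w"
    have D: "D \<ge> 0" using mult_pos_neg[OF u(2) w(2)] zero_le_power2[of "b u w"] by (simp only: D_def)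
    \<comment> \<open>A root of q (u + t w) = 0, real because \<open>q u\<close> and
      \<open>q w\<close> have opposite signs.\<close>
    define t where "t = (- b u w + sqrt D) / q w"
    have t: "q u + 2 * t * b u w + t\<^sup>2 * q w = 0"
    proof -
      have "q w * (q u + 2 * t * b u w + t\<^sup>2 * q w) = q w * q u + 2 * (t * q w) * b u w + (t * q w)\<^sup>2"
        by (simp add: power2_eq_square algebra_simps)
      also have "t * q w = - b u w + sqrt D" using w(2) by (simp add: t_def)
      also have "q w * q u + 2 * (- b u w + sqrt D) * b u w + (- b u w + sqrt D)\<^sup>2 = 0"
        using D by (simp add: power2_eq_square algebra_simps) (simp add: D_def power2_eq_square)
      finally show ?thesis using w(2) by simp
    qed
    \<comment> \<open>\<open>u'\<close> and \<open>w'\<close> arise from \<open>u\<close> and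
      \<open>w\<close> by the rotation with cosine \<open>m\<close> and sine
      \<open>m * t\<close>.\<close>
    define m where "m = 1 / sqrt (1 + t\<^sup>2)"
    have "1 + t\<^sup>2 > 0" by (simp add: add_pos_nonneg)
    then have m: "m\<^sup>2 * (1 + t\<^sup>2) = 1" by (simp add: m_def power_divide)
    define u' where "u' = (\<lambda>i. m * u i + (m * t) * w i)"
    define w' where "w' = (\<lambda>i. (- m * t) * u i + m * w i)"
    have "q u' = m\<^sup>2 * (q u + 2 * t * b u w + t\<^sup>2 * q w)"
      unfolding u'_def quad by (simp add: power2_eq_square algebra_simps)
    then have qu': "q u' = 0" using t by simp
    have "q u' + q w' = (m\<^sup>2 * (1 + t\<^sup>2)) * (q u + q w)"
      unfolding u'_def w'_def quad by (simp add: power2_eq_square algebra_simps)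
    then have qw': "q w' = q u + q w" using m qu' by simp
    have dy: "u' r * u' s + w' r * w' s = u r * u s + w r * w s" for r s
    proof -
      have "u' r * u' s + w' r * w' s = (m\<^sup>2 * (1 + t\<^sup>2)) * (u r * u s + w r * w s)"
        by (simp add: u'_def w'_def power2_eq_square algebra_simps)
      then show ?thesis using m by simp
    qed
    have "(\<Sum>v\<leftarrow>w' # rest. q v) = 0" using split[of q] Suc.prems qw' by simp
    moreover have "n = length (w' # rest)" using len by simp
    ultimately obtain ws where ws: "\<forall>w\<in>set ws. q w = 0"
      "\<forall>r s. (\<Sum>w\<leftarrow>ws. w r * w s) = (\<Sum>v\<leftarrow>w' # rest. v r * v s)"
      using Suc.hyps(1) by blast
    have "(\<Sum>w\<leftarrow>u' # ws. w r * w s) = (\<Sum>v\<leftarrow>vs. v r * v s)" for r s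
      using ws(2) dy[of r s] split[of "\<lambda>v. v r * v s"] by simp
    then show ?thesis using ws(1) qu' by (intro exI[of _ "u' # ws"]) auto
  qed
qed

section \<open>Separability of two-qubit operators with positive partial transpose\<close>

type_synonym pair = "bool \<times> bool"

lemma sum_bool: "(\<Sum>i\<in>UNIV. f i) = f False + f True"
  by (simp add: UNIV_bool add.commute)

lemma sum_pair: "(\<Sum>r\<in>UNIV. f (r :: pair)) = f (False, False) + f (False, True) + f (True, False) + f (True, True)"
proof -
  have "(\<Sum>r\<in>UNIV. f r) = (\<Sum>i\<in>UNIV. \<Sum>j\<in>UNIV. f (i, j))"
    by (simp add: sum.cartesian_product flip: UNIV_Times_UNIV)
  then show ?thesis by (simp add: sum_bool add.assoc)
qed

lemma sum_prod_UNIV: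
  "(\<Sum>r\<in>UNIV. f (r :: 'a::finite \<times> 'b::finite)) = (\<Sum>i\<in>UNIV. \<Sum>j\<in>UNIV. f (i, j))"
  by (simp add: sum.cartesian_product flip: UNIV_Times_UNIV)

definition tens :: "('a \<Rightarrow> 'a \<Rightarrow> complex) \<Rightarrow> ('b \<Rightarrow> 'b \<Rightarrow> complex) \<Rightarrow> 'a \<times> 'b \<Rightarrow> 'a \<times> 'b \<Rightarrow> complex" where
  "tens A B = (\<lambda>r s. A (fst r) (fst s) * B (snd r) (snd s))"

definition kron :: "('a \<Rightarrow> complex) \<Rightarrow> ('b \<Rightarrow> complex) \<Rightarrow> 'a \<times> 'b \<Rightarrow> complex" where
  "kron a b = (\<lambda>r. a (fst r) * b (snd r))"

definition pt :: "('a \<times> 'b \<Rightarrow> 'a \<times> 'b \<Rightarrow> complex) \<Rightarrow> 'a \<times> 'b \<Rightarrow> 'a \<times> 'b \<Rightarrow> complex" where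
  "pt X = (\<lambda>r s. X (fst r, snd s) (fst s, snd r))"

lemma pt_pt [simp]: "pt (pt X) = X"
  by (simp add: pt_def)

lemma pt_add: "pt (\<lambda>r s. X r s + Y r s) = (\<lambda>r s. pt X r s + pt Y r s)"
  by (simp add: pt_def)

text \<open>On product vectors partial transposition merely conjugates the second factor. A product
  null vector of \<open>pt X\<close> thus yields one of \<open>X\<close>, which later excludes
  product vectors from the kernel.\<close>

lemma sesq_pt_kron: "sesq (pt X) (kron a b) (kron a b) = sesq X (kron a (\<lambda>j. cnj (b j))) (kron a (\<lambda>j. cnj (b j)))"
proof -
  have "sesq (pt X) (kron a b) (kron a b) =
    (\<Sum>i\<in>UNIV. \<Sum>j\<in>UNIV. \<Sum>k\<in>UNIV. \<Sum>l\<in>UNIV. cnj (a i) * cnj (b j) * X (i, l) (k, j) * (a k * b l))"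
    by (simp add: sesq_def sum_prod_UNIV pt_def kron_def)
  also have "\<dots> = (\<Sum>i\<in>UNIV. \<Sum>k\<in>UNIV. \<Sum>j\<in>UNIV. \<Sum>l\<in>UNIV. cnj (a i) * cnj (b j) * X (i, l) (k, j) * (a k * b l))"
    by (intro sum.cong refl sum.swap)
  also have "\<dots> = (\<Sum>i\<in>UNIV. \<Sum>k\<in>UNIV. \<Sum>l\<in>UNIV. \<Sum>j\<in>UNIV. cnj (a i) * cnj (b j) * X (i, l) (k, j) * (a k * b l))"
    by (intro sum.cong refl sum.swap)
  also have "\<dots> = (\<Sum>i\<in>UNIV. \<Sum>l\<in>UNIV. \<Sum>k\<in>UNIV. \<Sum>j\<in>UNIV. cnj (a i) * cnj (b j) * X (i, l) (k, j) * (a k * b l))"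
    by (intro sum.cong refl sum.swap)
  also have "\<dots> = sesq X (kron a (\<lambda>j. cnj (b j))) (kron a (\<lambda>j. cnj (b j)))"
    by (simp add: sesq_def sum_prod_UNIV kron_def ac_simps)
  finally show ?thesis .
qed

text \<open>The cone of unnormalized separable operators. Nonnegative scalars are absorbed by a
  factor, so products and sums suffice; weights and states are recovered in
  \<open>sepc_decomposition\<close>.\<close>

inductive sepc :: "('a::finite \<times> 'b::finite \<Rightarrow> 'a \<times> 'b \<Rightarrow> complex) \<Rightarrow> bool" where
  sepc_tens: "pos A \<Longrightarrow> pos B \<Longrightarrow> sepc (tens A B)"
| sepc_add: "sepc X \<Longrightarrow> sepc Y \<Longrightarrow> sepc (\<lambda>r s. X r s + Y r s)"

lemma pos_zero: "pos (\<lambda>r s. 0)"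
  by (simp add: pos_def sesq_def)

lemma sepc_zero: "sepc (\<lambda>r s. 0)"
  using sepc_tens[OF pos_zero pos_zero] by (simp add: tens_def)

lemma pos_transpose:
  assumes "pos A" shows "pos (\<lambda>r s. A s r)"
  unfolding pos_def
proof
  fix v
  have "sesq (\<lambda>r s. A s r) v v = sesq A (\<lambda>r. cnj (v r)) (\<lambda>r. cnj (v r))"
    unfolding sesq_def by (subst sum.swap) (simp add: mult.commute mult.left_commute)
  then show "0 \<le> sesq (\<lambda>r s. A s r) v v" using assms by (simp add: pos_def)
qed

lemma sepc_pt: "sepc X \<Longrightarrow> sepc (pt X)"
proof (induction rule: sepc.induct)
  case (sepc_tens A B)
  have "pt (tens A B) = tens A (\<lambda>r s. B s r)" by (simp add: pt_def tens_def)
  then show ?case using sepc.sepc_tens[OF sepc_tens(1) pos_transpose[OF sepc_tens(2)]] by simp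
next
  case (sepc_add X Y)
  then show ?case unfolding pt_add by (intro sepc.sepc_add)
qed

section \<open>Local filters\<close>

definition conj_by :: "('i \<Rightarrow> 'j::finite \<Rightarrow> complex) \<Rightarrow> ('j \<Rightarrow> 'j \<Rightarrow> complex) \<Rightarrow> 'i \<Rightarrow> 'i \<Rightarrow> complex" where
  "conj_by K X = (\<lambda>r s. \<Sum>p\<in>UNIV. \<Sum>q\<in>UNIV. K r p * X p q * cnj (K s q))"

lemma sesq_conj_by:
  "sesq (conj_by K X) u v = sesq X (\<lambda>p. \<Sum>r\<in>UNIV. cnj (K r p) * u r) (\<lambda>p. \<Sum>r\<in>UNIV. cnj (K r p) * v r)"
proof -
  have "sesq (conj_by K X) u v = (\<Sum>r\<in>UNIV. \<Sum>s\<in>UNIV. \<Sum>p\<in>UNIV. \<Sum>q\<in>UNIV. cnj (u r) * K r p * X p q * (cnj (K s q) * v s))"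
    by (simp add: sesq_def conj_by_def sum_distrib_left sum_distrib_right mult.assoc)
  also have "\<dots> = (\<Sum>r\<in>UNIV. \<Sum>p\<in>UNIV. \<Sum>s\<in>UNIV. \<Sum>q\<in>UNIV. cnj (u r) * K r p * X p q * (cnj (K s q) * v s))"
    by (intro sum.cong refl sum.swap)
  also have "\<dots> = (\<Sum>p\<in>UNIV. \<Sum>r\<in>UNIV. \<Sum>s\<in>UNIV. \<Sum>q\<in>UNIV. cnj (u r) * K r p * X p q * (cnj (K s q) * v s))"
    by (rule sum.swap)
  also have "\<dots> = (\<Sum>p\<in>UNIV. \<Sum>r\<in>UNIV. \<Sum>q\<in>UNIV. \<Sum>s\<in>UNIV. cnj (u r) * K r p * X p q * (cnj (K s q) * v s))"
    by (intro sum.cong refl sum.swap)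
  also have "\<dots> = (\<Sum>p\<in>UNIV. \<Sum>q\<in>UNIV. \<Sum>r\<in>UNIV. \<Sum>s\<in>UNIV. cnj (u r) * K r p * X p q * (cnj (K s q) * v s))"
    by (intro sum.cong refl sum.swap)
  also have "\<dots> = sesq X (\<lambda>p. \<Sum>r\<in>UNIV. cnj (K r p) * u r) (\<lambda>p. \<Sum>r\<in>UNIV. cnj (K r p) * v r)"
    unfolding sesq_def
    by (simp add: sum_distrib_left sum_distrib_right mult.commute mult.left_commute mult.assoc)
  finally show ?thesis .
qed

lemma pos_conj_by: "pos X \<Longrightarrow> pos (conj_by K X)"
  by (simp add: pos_def sesq_conj_by)

lemma conj_by_add: "conj_by K (\<lambda>r s. X r s + Y r s) = (\<lambda>r s. conj_by K X r s + conj_by K Y r s)"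
  by (simp add: conj_by_def algebra_simps sum.distrib)

lemma conj_by_tens: "conj_by (tens G H) (tens A B) = tens (conj_by G A) (conj_by H B)"
proof (intro ext)
  fix r s
  have "conj_by (tens G H) (tens A B) r s = (\<Sum>i\<in>UNIV. \<Sum>j\<in>UNIV. \<Sum>k\<in>UNIV. \<Sum>l\<in>UNIV.
      (G (fst r) i * A i k * cnj (G (fst s) k)) * (H (snd r) j * B j l * cnj (H (snd s) l)))"
    by (simp add: conj_by_def tens_def sum_prod_UNIV mult.commute mult.left_commute mult.assoc)
  also have "\<dots> = (\<Sum>i\<in>UNIV. \<Sum>k\<in>UNIV. \<Sum>j\<in>UNIV. \<Sum>l\<in>UNIV.
      (G (fst r) i * A i k * cnj (G (fst s) k)) * (H (snd r) j * B j l * cnj (H (snd s) l)))"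
    by (intro sum.cong refl sum.swap)
  also have "\<dots> = tens (conj_by G A) (conj_by H B) r s"
    unfolding conj_by_def tens_def by (simp only: sum_distrib_right) (simp only: sum_distrib_left)
  finally show "conj_by (tens G H) (tens A B) r s = tens (conj_by G A) (conj_by H B) r s" .
qed

lemma sepc_conj_by: "sepc X \<Longrightarrow> sepc (conj_by (tens G H) X)"
proof (induction rule: sepc.induct)
  case (sepc_tens A B)
  then show ?case unfolding conj_by_tens by (intro sepc.sepc_tens pos_conj_by)
next
  case (sepc_add X Y)
  then show ?case unfolding conj_by_add by (intro sepc.sepc_add)
qed

lemma conj_by_conj_by: "conj_by L (conj_by K X) = conj_by (\<lambda>r p. \<Sum>i\<in>UNIV. L r i * K i p) X"
proof -
  have a: "conj_by M Y r s = sesq Y (\<lambda>p. cnj (M r p)) (\<lambda>p. cnj (M s p))"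
    for M :: "'x \<Rightarrow> 'y::finite \<Rightarrow> complex" and Y r s by (simp add: conj_by_def sesq_def)
  show ?thesis
    by (intro ext) (simp add: a sesq_conj_by mult.commute)
qed

lemma conj_by_id: "conj_by (\<lambda>r p. if r = p then 1 else 0) X = X"
proof (intro ext)
  fix r s
  have "conj_by (\<lambda>r p. if r = p then 1 else 0) X r s = sesq X (ket r) (ket s)"
    unfolding conj_by_def sesq_def ket_def by (intro sum.cong refl) auto
  then show "conj_by (\<lambda>r p. if r = p then 1 else 0) X r s = X r s" by (simp add: sesq_ket)
qed

text \<open>Partial transposition turns a local filter into the one with conjugated second factor,
  so positivity of the partial transpose survives local filtering.\<close>

lemma pt_conj_by: "pt (conj_by (tens G H) X) = conj_by (tens G (\<lambda>i j. cnj (H i j))) (pt X)"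
proof (intro ext)
  fix r s
  let ?t = "\<lambda>i j k l. G (fst r) i * H (snd s) j * X (i, j) (k, l) * (cnj (G (fst s) k) * cnj (H (snd r) l))"
  have "pt (conj_by (tens G H) X) r s = (\<Sum>i\<in>UNIV. \<Sum>j\<in>UNIV. \<Sum>k\<in>UNIV. \<Sum>l\<in>UNIV. ?t i j k l)"
    by (simp add: conj_by_def tens_def pt_def sum_prod_UNIV)
  also have "\<dots> = (\<Sum>i\<in>UNIV. \<Sum>k\<in>UNIV. \<Sum>j\<in>UNIV. \<Sum>l\<in>UNIV. ?t i j k l)"
    by (intro sum.cong refl sum.swap)
  also have "\<dots> = (\<Sum>i\<in>UNIV. \<Sum>k\<in>UNIV. \<Sum>l\<in>UNIV. \<Sum>j\<in>UNIV. ?t i j k l)"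
    by (intro sum.cong refl sum.swap)
  also have "\<dots> = (\<Sum>i\<in>UNIV. \<Sum>l\<in>UNIV. \<Sum>k\<in>UNIV. \<Sum>j\<in>UNIV. ?t i j k l)"
    by (intro sum.cong refl sum.swap)
  also have "\<dots> = conj_by (tens G (\<lambda>i j. cnj (H i j))) (pt X) r s"
    by (simp add: conj_by_def tens_def pt_def sum_prod_UNIV mult.commute mult.left_commute)
  finally show "pt (conj_by (tens G H) X) r s = conj_by (tens G (\<lambda>i j. cnj (H i j))) (pt X) r s" .
qed

lemma inverse_2x2:
  fixes G :: "bool \<Rightarrow> bool \<Rightarrow> complex"
  assumes "G False False * G True True - G False True * G True False \<noteq> 0"
  obtains G' where "\<And>i j. (\<Sum>k\<in>UNIV. G' i k * G k j) = (if i = j then 1 else 0)"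
proof
  define d where "d = G False False * G True True - G False True * G True False"
  show "(\<Sum>k\<in>UNIV. (if i = k then G (\<not> i) (\<not> i) else - G i k) / d * G k j) = (if i = j then 1 else 0)" for i j
    using assms unfolding d_def[symmetric] sum_bool
    by (cases i; cases j) (simp_all add: d_def divide_simps mult.commute)
qed

text \<open>Invertible local filters are undone by local filters, which preserve the cone.
  Separability may therefore be checked in the most convenient local frame.\<close>

lemma sepc_of_filtered:
  fixes G H :: "bool \<Rightarrow> bool \<Rightarrow> complex"
  assumes "G False False * G True True - G False True * G True False \<noteq> 0"
    and "H False False * H True True - H False True * H True False \<noteq> 0"
    and "sepc (conj_by (tens G H) X)"
  shows "sepc X"
proof -
  obtain G' where G': "\<And>i j. (\<Sum>k\<in>UNIV. G' i k * G k j) = (if i = j then 1 else 0)"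
    using inverse_2x2[OF assms(1)] by blast
  obtain H' where H': "\<And>i j. (\<Sum>k\<in>UNIV. H' i k * H k j) = (if i = j then 1 else 0)"
    using inverse_2x2[OF assms(2)] by blast
  have "(\<Sum>i\<in>UNIV. tens G' H' r i * tens G H i p) = (if r = p then 1 else 0)" for r p
  proof -
    have "(\<Sum>i\<in>UNIV. tens G' H' r i * tens G H i p) =
      (\<Sum>k\<in>UNIV. G' (fst r) k * G k (fst p)) * (\<Sum>k\<in>UNIV. H' (snd r) k * H k (snd p))"
      by (simp add: tens_def sum_prod_UNIV sum_product mult.commute mult.left_commute mult.assoc)
    then show ?thesis by (auto simp: G' H' prod_eq_iff)
  qed
  then have "conj_by (tens G' H') (conj_by (tens G H) X) = X"
    by (simp add: conj_by_conj_by conj_by_id)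
  then show ?thesis using sepc_conj_by[OF assms(3), of G' H'] by simp
qed

section \<open>Operators with a kernel vector: the symmetric subspace and the product case\<close>

lemma pos_2x2:
  assumes "A False False = complex_of_real x" "A True True = complex_of_real y"
    "A True False = cnj (A False True)" "0 \<le> x" "0 \<le> y" "(cmod (A False True))\<^sup>2 \<le> x * y"
  shows "pos A"
  unfolding pos_def
proof
  fix v :: "bool \<Rightarrow> complex"
  define z where "z = cnj (v False) * A False True * v True"
  have e: "sesq A v v = x * (cmod (v False))\<^sup>2 + (z + cnj z) + y * (cmod (v True))\<^sup>2"
    unfolding sesq_def sum_bool assms(1-3) z_def
    using complex_norm_square[of "v False"] complex_norm_square[of "v True"]
    by (simp add: ac_simps)
  have "cmod z = cmod (v False) * cmod (A False True) * cmod (v True)"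
    by (simp add: z_def norm_mult)
  also have "cmod (A False True) \<le> sqrt x * sqrt y"
    using assms(6) by (metis real_le_rsqrt real_sqrt_mult)
  then have "cmod (v False) * cmod (A False True) * cmod (v True) \<le> cmod (v False) * (sqrt x * sqrt y) * cmod (v True)"
    by (intro mult_right_mono mult_left_mono) auto
  finally have "- Re z \<le> (sqrt x * cmod (v False)) * (sqrt y * cmod (v True))"
    using abs_Re_le_cmod[of z] by (simp add: mult.commute mult.left_commute)
  moreover have "0 \<le> (sqrt x * cmod (v False) - sqrt y * cmod (v True))\<^sup>2" by simp
  ultimately have "0 \<le> x * (cmod (v False))\<^sup>2 + 2 * Re z + y * (cmod (v True))\<^sup>2"
    using assms(4,5) by (simp add: power2_diff power_mult_distrib)
  then show "0 \<le> sesq A v v" unfolding e by (simp add: less_eq_complex_def)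
qed

text \<open>Left unnormalized. For a positive operator, a vanishing form at this vector means
  support on the symmetric subspace.\<close>

definition singlet :: "pair \<Rightarrow> complex" where
  "singlet = (\<lambda>r. if r = (False, True) then 1 else if r = (True, False) then -1 else 0)"

text \<open>Hermitian 2x2 matrices in four real coordinates: the diagonal entries sit at equal bits,
  the real and imaginary part of the upper off-diagonal entry at \<open>(False, True)\<close> and
  \<open>(True, False)\<close>.\<close>

definition herm :: "(pair \<Rightarrow> real) \<Rightarrow> bool \<Rightarrow> bool \<Rightarrow> complex" where
  "herm x = (\<lambda>i j. if i \<and> j then x (True, True) else if \<not> i \<and> \<not> j then x (False, False) else
     if j then Complex (x (False, True)) (x (True, False)) else Complex (x (False, True)) (- x (True, False)))"

text \<open>The determinant of \<open>herm x\<close>, that is, the Minkowski form.\<close>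

definition lorentz :: "(pair \<Rightarrow> real) \<Rightarrow> real" where
  "lorentz x = x (False, False) * x (True, True) - (x (False, True))\<^sup>2 - (x (True, False))\<^sup>2"

text \<open>With vanishing determinant \<open>herm w\<close> is semidefinite up to a sign, and the
  sign cancels in the tensor square.\<close>

lemma sepc_herm_square:
  assumes "lorentz w = 0" shows "sepc (tens (herm w) (herm w))"
proof -
  have prod: "w (False, False) * w (True, True) = (w (False, True))\<^sup>2 + (w (True, False))\<^sup>2"
    using assms by (simp add: lorentz_def)
  then have "0 \<le> w (False, False) * w (True, True)" by simp
  then consider "0 \<le> w (False, False)" "0 \<le> w (True, True)" | "w (False, False) \<le> 0" "w (True, True) \<le> 0"
    by (auto simp: zero_le_mult_iff)
  then show ?thesis
  proof cases
    case 1
    have "pos (herm w)"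
      by (rule pos_2x2[of _ "w (False, False)" "w (True, True)"])
        (use 1 prod in \<open>simp_all add: herm_def complex_eq_iff cmod_power2\<close>)
    then show ?thesis by (rule sepc_tens) fact
  next
    case 2
    have "pos (\<lambda>i j. - herm w i j)"
      by (rule pos_2x2[of _ "- w (False, False)" "- w (True, True)"])
        (use 2 prod in \<open>simp_all add: herm_def complex_eq_iff cmod_power2\<close>)
    then have "sepc (tens (\<lambda>i j. - herm w i j) (\<lambda>i j. - herm w i j))" by (rule sepc_tens) fact
    then show ?thesis by (simp add: tens_def)
  qed
qed

text \<open>An operator \<open>P\<close> on the symmetric subspace is a quadratic form \<open>R\<close> on the dual of the
  Hermitian matrices, \<open>P = \<Sum> R\<^sub>m\<^sub>n E\<^sub>m \<otimes> E\<^sub>n\<close>; the values of \<open>R\<close> are those of \<open>pt P\<close> on Hermitian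
  matrices, viewed as vectors. So \<open>R\<close> is positive, and it has trace zero against the determinant.\<close>

lemma sepc_of_singlet_kernel:
  assumes P: "pos P" and Q: "pos (pt P)" and ker: "sesq P singlet singlet = 0"
  shows "sepc P"
proof -
  \<comment> \<open>Since the singlet is in the kernel, the columns at 01 and 10 agree, and by
    hermiticity the rows do; six numbers then determine \<open>P\<close>.\<close>
  have right: "P r (False, True) = P r (True, False)" for r
    using pos_kernel[OF P ker, of "ket r"]
    by (simp add: sesq_ket_left sum_pair singlet_def)
  have left: "P (True, False) r = P (False, True) r" for r
    using right[of r] pos_sym[OF P, of "(True, False)" r] pos_sym[OF P, of "(False, True)" r] by simp
  define p0 a b p1 c p3 where 
    "p0 = Re (P (False, False) (False, False))" and "a = P (False, False) (False, True)" and
    "b = P (False, False) (True, True)" and "p1 = Re (P (False, True) (False, True))" and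
    "c = P (False, True) (True, True)" and "p3 = Re (P (True, True) (True, True))"
  have diag: "complex_of_real (Re (P r r)) = P r r" for r
    using pos_diag[OF P, of r] by (simp add: less_eq_complex_def complex_eq_iff)
  have entries [simp]:
    "P (False, False) (False, False) = p0" "P (False, False) (False, True) = a"
    "P (False, False) (True, False) = a" "P (False, False) (True, True) = b"
    "P (False, True) (False, False) = cnj a" "P (False, True) (False, True) = p1"
    "P (False, True) (True, False) = p1" "P (False, True) (True, True) = c"
    "P (True, False) (False, False) = cnj a" "P (True, False) (False, True) = p1"
    "P (True, False) (True, False) = p1" "P (True, False) (True, True) = c"
    "P (True, True) (False, False) = cnj b" "P (True, True) (False, True) = cnj c"
    "P (True, True) (True, False) = cnj c" "P (True, True) (True, True) = p3"
    using diag[of "(False, False)"] diag[of "(False, True)"] diag[of "(True, True)"]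
      pos_sym[OF P, of "(False, True)" "(False, False)"] pos_sym[OF P, of "(True, True)" "(False, False)"]
      pos_sym[OF P, of "(True, True)" "(False, True)"] left right[symmetric]
    by (simp_all add: p0_def a_def b_def p1_def c_def p3_def)
  \<comment> \<open>Found by comparing entries in P = \<Sum> R_mn E_m tensor E_n. Writing x and y
    for \<open>(False, True)\<close> and \<open>(True, False)\<close>, the off-diagonal block solves
    R_xx + R_yy = p1 and R_xx - R_yy + 2 i R_xy = b.\<close>
  define R :: "pair \<Rightarrow> pair \<Rightarrow> real" where "R = (\<lambda>(i, j) (k, l).
    if \<not> i \<and> \<not> j then if \<not> k \<and> \<not> l then p0 else if k \<and> l then p1 else if l then Re a else Im a
    else if i \<and> j then if \<not> k \<and> \<not> l then p1 else if k \<and> l then p3 else if l then Re c else Im c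
    else if \<not> k \<and> \<not> l then if j then Re a else Im a
    else if k \<and> l then if j then Re c else Im c
    else if i \<noteq> k then Im b / 2 else if j then (p1 + Re b) / 2 else (p1 - Re b) / 2)"
  have "R r s = R s r" for r s
    by (cases r; cases s) (auto simp: R_def)
  moreover have "0 \<le> (\<Sum>r\<in>UNIV. \<Sum>s\<in>UNIV. y r * R r s * y s)" for y
  proof -
    \<comment> \<open>Halving off the diagonal makes tr(h E_m) equal to \<open>y m\<close>. Because
      \<open>P\<close> is supported on the symmetric subspace, two column indices may be exchanged,
      and the form of \<open>pt P\<close> at \<open>h\<close> becomes \<Sum> R_mn tr(h E_m) tr(h
      E_n).\<close>
    define h :: "pair \<Rightarrow> complex" where "h = (\<lambda>(i, j). herm (\<lambda>r. if fst r = snd r then y r else y r / 2) i j)"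
    have "0 \<le> Re (sesq (pt P) h h)" using Q by (simp add: pos_def less_eq_complex_def)
    also have "Re (sesq (pt P) h h) = (\<Sum>r\<in>UNIV. \<Sum>s\<in>UNIV. y r * R r s * y s)"
      unfolding sesq_def sum_pair
      by (simp add: R_def h_def herm_def pt_def) (simp add: field_simps)
    finally show ?thesis .
  qed
  ultimately obtain vs where vs: "\<And>r s. R r s = (\<Sum>v\<leftarrow>vs. v r * v s)"
    using real_pos_decomposition by blast
  define \<beta> :: "(pair \<Rightarrow> real) \<Rightarrow> (pair \<Rightarrow> real) \<Rightarrow> real" where "\<beta> = (\<lambda>x y.
    (x (False, False) * y (True, True) + x (True, True) * y (False, False)) / 2
     - x (False, True) * y (False, True) - x (True, False) * y (True, False))"
  \<comment> \<open>The trace of \<open>R\<close> against the determinant form. It vanishes because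
    the entries of \<open>P\<close> at (01, 01) and (01, 10) are both \<open>p1\<close>, which is
    the kernel condition once more.\<close>
  have "(\<Sum>v\<leftarrow>vs. lorentz v) = R (False, False) (True, True) - R (False, True) (False, True) - R (True, False) (True, False)"
    by (simp add: vs lorentz_def sum_list_subtractf power2_eq_square)
  also have "\<dots> = 0" by (simp add: R_def field_simps)
  finally have "(\<Sum>v\<leftarrow>vs. lorentz v) = 0" .
  moreover have "lorentz (\<lambda>i. s * u i + t * v i) = s\<^sup>2 * lorentz u + 2 * s * t * \<beta> u v + t\<^sup>2 * lorentz v" for s t u v
    by (simp add: lorentz_def \<beta>_def power2_eq_square algebra_simps)
  ultimately obtain ws where ws: "\<And>w. w \<in> set ws \<Longrightarrow> lorentz w = 0"
    "\<And>r s. (\<Sum>w\<leftarrow>ws. w r * w s) = (\<Sum>v\<leftarrow>vs. v r * v s)"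
    using isotropic_decomposition[of lorentz \<beta> vs] by blast
  define E where "E = (\<lambda>(T :: pair \<Rightarrow> pair \<Rightarrow> real) r s. \<Sum>m\<in>UNIV. \<Sum>n\<in>UNIV.
    herm (\<lambda>t. if t = m then 1 else 0) (fst r) (fst s) * herm (\<lambda>t. if t = n then 1 else 0) (snd r) (snd s) * T m n)"
  \<comment> \<open>A dyad of w returns to the tensor square of \<open>herm w\<close>, which is
    separable once w is isotropic.\<close>
  have E_sq: "E (\<lambda>r s. w r * w s) = tens (herm w) (herm w)" for w
  proof -
    have "herm w i j = (\<Sum>m\<in>UNIV. herm (\<lambda>t. if t = m then 1 else 0) i j * w m)" for i j
      by (cases i; cases j) (simp_all add: sum_pair herm_def complex_eq_iff)
    then show ?thesis
      by (intro ext) (simp add: E_def tens_def sum_product mult.commute mult.left_commute mult.assoc)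
  qed
  have sums: "sepc (E (\<lambda>r s. \<Sum>w\<leftarrow>us. w r * w s))" if "set us \<subseteq> set ws" for us
    using that
  proof (induction us)
    case Nil
    then show ?case by (simp add: E_def sepc_zero)
  next
    case (Cons w us)
    have "E (\<lambda>r s. w r * w s + (\<Sum>w\<leftarrow>us. w r * w s)) =
      (\<lambda>r s. E (\<lambda>r s. w r * w s) r s + E (\<lambda>r s. \<Sum>w\<leftarrow>us. w r * w s) r s)"
      by (simp add: E_def sum.distrib algebra_simps)
    moreover have "sepc (E (\<lambda>r s. w r * w s))"
      unfolding E_sq using ws(1) Cons.prems by (intro sepc_herm_square) auto
    ultimately show ?case using Cons by (auto intro: sepc_add)
  qed
  have "(\<lambda>r s. \<Sum>w\<leftarrow>ws. w r * w s) = R" unfolding ws(2) vs[symmetric] ..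
  with sums[of ws] have "sepc (E R)" by simp
  moreover have "E R r s = P r s" for r s
    by (cases r; cases s; rename_tac i j k l; case_tac i; case_tac j; case_tac k; case_tac l)
      (simp_all add: E_def sum_pair herm_def R_def complex_eq_iff field_simps)
  then have "E R = P" by (intro ext)
  ultimately show ?thesis by simp
qed

text \<open>The diagonal entry at 00 vanishes for both \<open>P\<close> and \<open>pt P\<close>. So
  \<open>P\<close> lives on 01, 10, 11, and the zero row of \<open>pt P\<close> removes the
  coherence between 01 and 10. Splitting off the dyad through 01 leaves one piece on 01, 11, where
  the second bit is \<open>True\<close>, and the Schur complement on 10, 11, where the first bit is
  \<open>True\<close>; each is a product.\<close>

lemma sepc_of_ket_kernel:
  fixes P :: "pair \<Rightarrow> pair \<Rightarrow> complex"
  assumes P: "pos P" and Q: "pos (pt P)" and ker: "P (False, False) (False, False) = 0"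
  shows "sepc P"
proof -
  define s where "s = (False, True)"
  define eT :: "bool \<Rightarrow> bool \<Rightarrow> complex" where "eT = (\<lambda>i k. ket True i * cnj (ket True k))"
  define P' where "P' = (\<lambda>r t. P r t - P r s * P s t / P s s)"
  define A where "A = (\<lambda>i k. (1 / P s s) * (P (i, True) s * cnj (P (k, True) s)))"
  define B where "B = (\<lambda>j l. P' (True, j) (True, l))"
  have z: "P (False, False) r = 0" "P r (False, False) = 0" for r
    using pos_row_zero[OF P ker] by auto
  have "pt P (False, False) (False, False) = 0" using ker by (simp add: pt_def)
  from pos_row_zero(2)[OF Q this, of "(True, True)"] have z': "P (False, True) (True, False) = 0"
    by (simp add: pt_def)
  have z'': "P (True, False) (False, True) = 0" using pos_sym[OF P, of "(True, False)" "(False, True)"] z' by simp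
  have "0 \<le> 1 / P s s" using pos_diag[OF P, of s] by (auto simp: less_eq_complex_def Re_divide Im_divide)
  then have "pos A" unfolding A_def by (intro pos_scale pos_rank_one)
  have P': "pos P'" unfolding P'_def by (rule schur_complement[OF P])
  have "pos B" unfolding pos_def
  proof
    fix v
    have "sesq B v v = sesq P' (kron (ket True) v) (kron (ket True) v)"
      by (simp add: sesq_def sum_prod_UNIV sum_bool kron_def ket_def B_def)
    then show "0 \<le> sesq B v v" using P' by (simp add: pos_def)
  qed
  have eT: "pos eT" unfolding eT_def by (rule pos_rank_one)
  have cn: "cnj (P (k, True) s) = P s (k, True)" for k using pos_sym[OF P, of s "(k, True)"] by simp
  have "P r t = tens A eT r t + tens eT B r t" for r t
  proof (cases "P s s = 0")
    case True
    then have "P s r = 0" "P r s = 0" for r using pos_row_zero[OF P True] by auto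
    then show ?thesis using True z z' z''
      by (cases r; cases t; rename_tac i j k l; case_tac i; case_tac j; case_tac k; case_tac l)
        (simp_all add: tens_def A_def B_def eT_def ket_def P'_def s_def)
  next
    case False
    then show ?thesis using z z' z'' unfolding A_def cn
      by (cases r; cases t; rename_tac i j k l; case_tac i; case_tac j; case_tac k; case_tac l)
        (simp_all add: tens_def B_def eT_def ket_def P'_def s_def)
  qed
  then have "P = (\<lambda>r t. tens A eT r t + tens eT B r t)" by (simp add: fun_eq_iff)
  moreover have "sepc (\<lambda>r t. tens A eT r t + tens eT B r t)"
    by (intro sepc_add sepc_tens) fact+
  ultimately show ?thesis by simp
qed

text \<open>The coefficient matrix has rank one and factors through the row and the column of a
  nonzero entry.\<close>

lemma product_of_det_zero:
  fixes \<phi> :: "pair \<Rightarrow> complex"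
  assumes "\<phi> \<noteq> (\<lambda>r. 0)"
    and d: "\<phi> (False, False) * \<phi> (True, True) = \<phi> (False, True) * \<phi> (True, False)"
  obtains a b where "\<phi> = kron a b"
proof -
  obtain i0 j0 where n: "\<phi> (i0, j0) \<noteq> 0" using assms(1) by (auto simp: fun_eq_iff)
  have "\<phi> (i, j) * \<phi> (i0, j0) = \<phi> (i, j0) * \<phi> (i0, j)" for i j
    using d by (cases i; cases j; cases i0; cases j0) (simp_all add: mult.commute)
  then have "\<phi> = kron (\<lambda>i. \<phi> (i, j0)) (\<lambda>j. \<phi> (i0, j) / \<phi> (i0, j0))"
    using n by (auto simp: kron_def fun_eq_iff divide_simps)
  then show thesis by (rule that)
qed

text \<open>A local filter turns the kernel vector into the singlet or into a basis vector, according to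
  whether it is entangled or not.\<close>

lemma sepc_of_kernel:
  fixes P :: "pair \<Rightarrow> pair \<Rightarrow> complex"
  assumes P: "pos P" and Q: "pos (pt P)" and ne: "\<phi> \<noteq> (\<lambda>r. 0)" and ker: "sesq P \<phi> \<phi> = 0"
  shows "sepc P"
proof (cases "\<phi> (False, False) * \<phi> (True, True) = \<phi> (False, True) * \<phi> (True, False)")
  case False
  define G :: "bool \<Rightarrow> bool \<Rightarrow> complex" where "G = (\<lambda>i j. if i = j then 1 else 0)"
  \<comment> \<open>The rows are chosen so that the adjoint of the filter sends
    \<open>singlet\<close> to \<phi>. The determinant is the conjugate of that of \<phi>, nonzero
    because \<phi> is entangled.\<close>
  define H where "H = (\<lambda>i j. if i then cnj (\<phi> (False, j)) else - cnj (\<phi> (True, j)))"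
  have "(\<lambda>p. \<Sum>r\<in>UNIV. cnj (tens G H r p) * singlet r) = \<phi>"
    by (rule ext, rename_tac p, case_tac p, rename_tac i j, case_tac i)
      (simp_all add: sum_pair tens_def G_def H_def singlet_def)
  then have "sesq (conj_by (tens G H) P) singlet singlet = 0"
    using ker by (simp add: sesq_conj_by)
  then have "sepc (conj_by (tens G H) P)"
    using P Q by (intro sepc_of_singlet_kernel) (simp_all add: pt_conj_by pos_conj_by)
  moreover have "H False False * H True True - H False True * H True False =
      cnj (\<phi> (False, False) * \<phi> (True, True) - \<phi> (False, True) * \<phi> (True, False)) * -1 * -1"
    by (simp add: H_def algebra_simps)
  then have "H False False * H True True - H False True * H True False \<noteq> 0"
    using False by (simp del: complex_cnj_diff complex_cnj_mult)
  ultimately show ?thesis by (intro sepc_of_filtered[of G H P]) (simp_all add: G_def)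
next
  case True
  obtain a b where ab: "\<phi> = kron a b" using product_of_det_zero[OF ne True] by blast
  \<comment> \<open>Row \<open>False\<close> is the conjugate of c and row \<open>True\<close> is
    orthogonal to it, so the adjoint sends \<open>ket False\<close> to c, and the determinant is the
    squared norm of c.\<close>
  define K where "K = (\<lambda>(c :: bool \<Rightarrow> complex) i j. if i then if j then c False else - c True else cnj (c j))"
  have K: "K c False False * K c True True - K c False True * K c True False \<noteq> 0" if "c \<noteq> (\<lambda>i. 0)" for c
  proof -
    have "K c False False * K c True True - K c False True * K c True False = of_real ((cmod (c False))\<^sup>2 + (cmod (c True))\<^sup>2)"
      unfolding of_real_add complex_norm_square by (simp add: K_def mult.commute)
    moreover have "c False \<noteq> 0 \<or> c True \<noteq> 0" using that by (metis (full_types))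
    ultimately show ?thesis by (simp only: of_real_eq_0_iff) (auto simp: add_nonneg_eq_0_iff)
  qed
  have nab: "a \<noteq> (\<lambda>i. 0)" "b \<noteq> (\<lambda>i. 0)" using ne by (auto simp: ab kron_def)
  have "(\<lambda>p. \<Sum>r\<in>UNIV. cnj (tens (K a) (K b) r p) * ket (False, False) r) = \<phi>"
    by (simp add: sum_pair tens_def K_def ket_def ab kron_def fun_eq_iff)
  then have "sesq (conj_by (tens (K a) (K b)) P) (ket (False, False)) (ket (False, False)) = 0"
    using ker by (simp add: sesq_conj_by)
  then have "sepc (conj_by (tens (K a) (K b)) P)"
    using P Q by (intro sepc_of_ket_kernel) (simp_all add: pt_conj_by pos_conj_by sesq_ket)
  then show ?thesis by (intro sepc_of_filtered[of "K a" "K b" P] K nab)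
qed

section \<open>Compactness, least eigenvalues and positive partial transposes\<close>

lemma compact_funs:
  fixes K :: "'i \<Rightarrow> 'a::topological_space set"
  assumes "\<And>i. compact (K i)" shows "compact {f. \<forall>i. f i \<in> K i}"
proof -
  have "compactin (product_topology (\<lambda>i. euclidean) UNIV) (PiE UNIV K)"
    unfolding compactin_PiE using assms by simp
  moreover have "PiE UNIV K = {f. \<forall>i. f i \<in> K i}" by (auto simp: PiE_def)
  ultimately show ?thesis by (simp add: euclidean_product_topology)
qed

definition norm2 :: "('i::finite \<Rightarrow> complex) \<Rightarrow> real" where
  "norm2 v = (\<Sum>i\<in>UNIV. (cmod (v i))\<^sup>2)"

lemma norm2_scale: "norm2 (\<lambda>i. c * v i) = (cmod c)\<^sup>2 * norm2 v"
  by (simp add: norm2_def norm_mult power_mult_distrib sum_distrib_left)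

lemma norm2_eq_0: "norm2 v = 0 \<longleftrightarrow> v = (\<lambda>i. 0)"
  by (auto simp: norm2_def sum_nonneg_eq_0_iff)

lemma norm2_nonneg: "0 \<le> norm2 v"
  by (simp add: norm2_def sum_nonneg)

lemma continuous_on_coordinate: "continuous_on A (\<lambda>f. f i :: 'a::topological_space)"
  by (rule continuous_on_subset[OF continuous_on_product_coordinates]) simp

lemma continuous_on_sesq [continuous_intros]:
  "continuous_on A (\<lambda>v. sesq X v v)"
  unfolding sesq_def by (intro continuous_intros continuous_on_coordinate)

lemma continuous_on_norm2 [continuous_intros]: "continuous_on A norm2"
  unfolding norm2_def by (intro continuous_intros continuous_on_coordinate)

text \<open>Vectors are plain functions with the product topology, so bounded coordinates give
  compactness by Tychonoff, and the sphere is closed.\<close>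

lemma compact_sphere: "compact {v :: 'i::finite \<Rightarrow> complex. norm2 v = 1}"
proof -
  have "cmod (v i) \<le> 1" if "norm2 v = 1" for v :: "'i \<Rightarrow> complex" and i
  proof -
    have "(cmod (v i))\<^sup>2 \<le> norm2 v" unfolding norm2_def by (rule member_le_sum) auto
    then show ?thesis using that by (simp add: abs_square_le_1)
  qed
  then have "{v :: 'i \<Rightarrow> complex. norm2 v = 1} = {v. \<forall>i. v i \<in> cball 0 1} \<inter> {v. norm2 v = 1}"
    by auto
  moreover have "compact ({v :: 'i \<Rightarrow> complex. \<forall>i. v i \<in> cball 0 1} \<inter> {v. norm2 v = 1})"
    by (intro compact_Int_closed compact_funs compact_cball closed_Collect_eq continuous_intros)
  ultimately show ?thesis by simp
qed

lemma norm2_normalize: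
  assumes "v \<noteq> (\<lambda>i. 0)"
  obtains u where "norm2 u = 1" "v = (\<lambda>i. complex_of_real (sqrt (norm2 v)) * u i)"
proof
  have "norm2 v > 0" using assms norm2_nonneg[of v] norm2_eq_0[of v] by linarith
  then show "norm2 (\<lambda>i. complex_of_real (1 / sqrt (norm2 v)) * v i) = 1"
    unfolding norm2_scale norm_of_real by (simp add: power_divide)
  show "v = (\<lambda>i. complex_of_real (sqrt (norm2 v)) * (complex_of_real (1 / sqrt (norm2 v)) * v i))"
    using \<open>norm2 v > 0\<close> by (simp flip: mult.assoc of_real_mult)
qed

text \<open>The Rayleigh quotient attains its minimum on the unit sphere; homogeneity extends the
  inequality to all vectors.\<close>

lemma pos_least_eigenvalue:
  fixes X :: "'i::finite \<Rightarrow> 'i \<Rightarrow> complex"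
  assumes "pos X"
  obtains s v where "0 \<le> s" "norm2 v = 1" "sesq X v v = complex_of_real s"
    "\<And>w. s * norm2 w \<le> Re (sesq X w w)"
proof -
  have "norm2 (ket i) = 1" for i :: 'i
    by (simp add: norm2_def ket_def if_distrib[of cmod] if_distrib[of "\<lambda>x. x\<^sup>2"] cong: if_cong)
  then have ne: "{v :: 'i \<Rightarrow> complex. norm2 v = 1} \<noteq> {}" by blast
  have "continuous_on {v :: 'i \<Rightarrow> complex. norm2 v = 1} (\<lambda>v. Re (sesq X v v))"
    by (intro continuous_intros)
  from continuous_attains_inf[OF compact_sphere ne this] obtain v where
    v: "norm2 v = 1" "\<And>w. norm2 w = 1 \<Longrightarrow> Re (sesq X v v) \<le> Re (sesq X w w)" by auto
  have nn: "0 \<le> sesq X v v" using assms by (simp add: pos_def)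
  show thesis
  proof (rule that[of "Re (sesq X v v)" v])
    show "0 \<le> Re (sesq X v v)" "sesq X v v = complex_of_real (Re (sesq X v v))"
      using nn by (simp_all add: less_eq_complex_def complex_eq_iff)
    show "Re (sesq X v v) * norm2 w \<le> Re (sesq X w w)" for w
    proof (cases "w = (\<lambda>i. 0)")
      case True
      then show ?thesis by (simp add: norm2_def sesq_def)
    next
      case False
      then obtain u where u: "norm2 u = 1" "w = (\<lambda>i. complex_of_real (sqrt (norm2 w)) * u i)"
        by (rule norm2_normalize)
      have "sesq X w w = complex_of_real (norm2 w) * sesq X u u"
        by (subst (1 2) u(2)) (simp add: sesq_linear norm2_nonneg flip: mult.assoc of_real_mult)
      then show ?thesis using v(2)[OF u(1)] norm2_nonneg[of w] by (simp add: mult.commute mult_left_mono)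
    qed
  qed (fact v(1))
qed

definition idop :: "'i \<Rightarrow> 'i \<Rightarrow> complex" where
  "idop = (\<lambda>r s. if r = s then 1 else 0)"

lemma sesq_idop: "sesq idop v v = complex_of_real (norm2 v)"
proof -
  have "sesq idop v v = (\<Sum>r\<in>UNIV. cnj (v r) * v r)"
    by (simp add: sesq_def idop_def if_distrib[of "\<lambda>x. _ * x * _"] cong: if_cong)
  then show ?thesis unfolding norm2_def of_real_sum complex_norm_square by (simp add: mult.commute)
qed

lemma pos_idop: "pos idop"
  by (simp add: pos_def sesq_idop norm2_nonneg less_eq_complex_def)

lemma pt_idop: "pt idop = idop"
  by (auto simp: pt_def idop_def prod_eq_iff fun_eq_iff)

lemma sepc_idop: "sepc (idop :: 'a::finite \<times> 'b::finite \<Rightarrow> 'a \<times> 'b \<Rightarrow> complex)"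
proof -
  have e: "tens idop idop = (idop :: 'a \<times> 'b \<Rightarrow> 'a \<times> 'b \<Rightarrow> complex)"
    by (auto simp: tens_def idop_def prod_eq_iff fun_eq_iff)
  show ?thesis by (subst e[symmetric]) (intro sepc_tens pos_idop)
qed

lemma sepc_scale: "0 \<le> c \<Longrightarrow> sepc X \<Longrightarrow> sepc (\<lambda>r s. complex_of_real c * X r s)"
proof -
  assume c: "0 \<le> c" and "sepc X"
  from this(2) show ?thesis
  proof (induction rule: sepc.induct)
    case (sepc_tens A B)
    have "pos (\<lambda>r s. complex_of_real c * A r s)"
      using c sepc_tens(1) by (intro pos_scale) (simp add: less_eq_complex_def)
    from sepc.sepc_tens[OF this sepc_tens(2)] show ?case by (simp add: tens_def mult.assoc)
  next
    case (sepc_add X Y)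
    then show ?case by (simp add: distrib_left sepc.sepc_add)
  qed
qed

text \<open>The identity is separable and equals its partial transpose. Subtracting it with the
  smaller of the least eigenvalues of \<open>X\<close> and \<open>pt X\<close> keeps both positive
  and gives one of them a kernel vector. Since \<open>pt\<close> preserves the cone, either case
  suffices.\<close>

theorem sepc_of_ppt:
  fixes X :: "pair \<Rightarrow> pair \<Rightarrow> complex"
  assumes "pos X" "pos (pt X)" shows "sepc X"
proof -
  have main: "sepc Y" if Y: "pos Y" and s: "0 \<le> s" "norm2 v = 1" "sesq Y v v = complex_of_real s"
      "\<And>w. s * norm2 w \<le> Re (sesq Y w w)" "\<And>w. s * norm2 w \<le> Re (sesq (pt Y) w w)"
      and Q: "pos (pt Y)"
    for Y :: "pair \<Rightarrow> pair \<Rightarrow> complex" and s v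
  proof -
    define Z where "Z = (\<lambda>r t. Y r t - complex_of_real s * idop r t)"
    have ptZ: "pt Z = (\<lambda>r t. pt Y r t - complex_of_real s * idop r t)"
      unfolding Z_def by (subst pt_idop[symmetric]) (simp add: pt_def)
    have "pos Z"
      using s Y by (simp add: Z_def pos_def sesq_linear sesq_idop less_eq_complex_def)
    moreover have "pos (pt Z)" unfolding ptZ
      using s Q by (simp add: pos_def sesq_linear sesq_idop less_eq_complex_def)
    moreover have "sesq Z v v = 0" using s by (simp add: Z_def sesq_linear sesq_idop)
    moreover have "v \<noteq> (\<lambda>i. 0)" using s(2) norm2_eq_0[of v] by auto
    ultimately have "sepc Z" by (intro sepc_of_kernel[of Z v])
    from sepc_add[OF this sepc_scale[OF s(1) sepc_idop]] show ?thesis by (simp add: Z_def)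
  qed
  obtain s v where s: "0 \<le> s" "norm2 v = 1" "sesq X v v = complex_of_real s"
    "\<And>w. s * norm2 w \<le> Re (sesq X w w)" using pos_least_eigenvalue[OF assms(1)] by blast
  obtain s' v' where s': "0 \<le> s'" "norm2 v' = 1" "sesq (pt X) v' v' = complex_of_real s'"
    "\<And>w. s' * norm2 w \<le> Re (sesq (pt X) w w)" using pos_least_eigenvalue[OF assms(2)] by blast
  show ?thesis
  proof (cases "s \<le> s'")
    case True
    then have "s * norm2 w \<le> Re (sesq (pt X) w w)" for w :: "pair \<Rightarrow> complex"
      using s'(4)[of w] mult_right_mono[OF True norm2_nonneg[of w]] by linarith
    then show ?thesis using main[OF assms(1) s] assms(2) by blast
  next
    case False
    then have "s' * norm2 w \<le> Re (sesq (pt (pt X)) w w)" for w :: "pair \<Rightarrow> complex"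
      using s(4)[of w] mult_right_mono[of s' s "norm2 w"] norm2_nonneg[of w] by simp
    then have "sepc (pt X)" using main[OF assms(2) s'] assms(1) by simp
    then show ?thesis using sepc_pt by fastforce
  qed
qed

section \<open>Traces, bounds on forms and small perturbations\<close>

definition rtr :: "('i::finite \<Rightarrow> 'i \<Rightarrow> complex) \<Rightarrow> real" where
  "rtr X = (\<Sum>r\<in>UNIV. Re (X r r))"

lemma rtr_add: "rtr (\<lambda>r s. X r s + Y r s) = rtr X + rtr Y"
  by (simp add: rtr_def sum.distrib)

lemma rtr_scale: "rtr (\<lambda>r s. complex_of_real c * X r s) = c * rtr X"
  by (simp add: rtr_def sum_distrib_left)

lemma rtr_diff: "rtr (\<lambda>r s. X r s - Y r s) = rtr X - rtr Y"
  by (simp add: rtr_def sum_subtractf)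

lemma rtr_rank_one: "rtr (\<lambda>r s. v r * cnj (v s)) = norm2 v"
  unfolding rtr_def norm2_def cmod_power2 by (simp add: power2_eq_square)

lemma rtr_idop: "rtr (idop :: 'i::finite \<Rightarrow> _) = CARD('i)"
  by (simp add: rtr_def idop_def)

lemma pos_Re_diag: "pos X \<Longrightarrow> 0 \<le> Re (X r r)"
  using pos_diag[of X r] by (simp add: less_eq_complex_def)

lemma pos_rtr_nonneg: "pos X \<Longrightarrow> 0 \<le> rtr X"
  unfolding rtr_def by (intro sum_nonneg pos_Re_diag)

lemma pos_entry_le_rtr:
  assumes "pos X" shows "cmod (X r s) \<le> rtr X"
proof -
  have "Re (X i i) \<le> rtr X" for i
    unfolding rtr_def using pos_Re_diag[OF assms] by (intro member_le_sum) auto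
  from this[of r] this[of s] pos_entry_bound[OF assms, of r s] show ?thesis by linarith
qed

lemma sesq_bound: "cmod (sesq X v v) \<le> (\<Sum>r\<in>UNIV. \<Sum>s\<in>UNIV. cmod (X r s)) * norm2 v"
proof -
  have le: "cmod (v r) * cmod (v s) \<le> norm2 v" for r s
  proof -
    have "(cmod (v i))\<^sup>2 \<le> norm2 v" for i
      unfolding norm2_def by (intro member_le_sum) auto
    then have "cmod (v i) \<le> sqrt (norm2 v)" for i by (simp add: real_le_rsqrt)
    then have "cmod (v r) * cmod (v s) \<le> sqrt (norm2 v) * sqrt (norm2 v)"
      by (intro mult_mono) (auto simp: norm2_nonneg)
    then show ?thesis by (simp add: norm2_nonneg)
  qed
  have "cmod (sesq X v v) \<le> (\<Sum>r\<in>UNIV. \<Sum>s\<in>UNIV. cmod (cnj (v r) * X r s * v s))"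
    unfolding sesq_def by (rule order_trans[OF norm_sum sum_mono]) (rule norm_sum)
  also have "\<dots> \<le> (\<Sum>r\<in>UNIV. \<Sum>s\<in>UNIV. cmod (X r s) * norm2 v)"
  proof (intro sum_mono)
    fix r s
    have "cmod (cnj (v r) * X r s * v s) = cmod (X r s) * (cmod (v r) * cmod (v s))"
      by (simp add: norm_mult)
    also have "\<dots> \<le> cmod (X r s) * norm2 v" by (intro mult_left_mono le) simp
    finally show "cmod (cnj (v r) * X r s * v s) \<le> cmod (X r s) * norm2 v" .
  qed
  finally show ?thesis by (simp add: sum_distrib_right)
qed

lemma herm_sesq_real:
  assumes "\<And>r s. X s r = cnj (X r s)" shows "Im (sesq X v v) = 0"
proof -
  have "cnj (sesq X v v) = (\<Sum>r\<in>UNIV. \<Sum>s\<in>UNIV. cnj (v s) * X s r * v r)"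
    by (simp add: sesq_def assms[symmetric] mult.commute mult.left_commute)
  also have "\<dots> = sesq X v v" unfolding sesq_def by (rule sum.swap)
  finally show ?thesis by (simp add: complex_eq_iff)
qed

lemma pos_pt_sesq_real: "pos X \<Longrightarrow> Im (sesq (pt X) v v) = 0"
  by (rule herm_sesq_real) (unfold pt_def, rule pos_sym)

lemma sesq_quadratic: "sesq X (\<lambda>i. c * v i) (\<lambda>i. c * v i) = complex_of_real ((cmod c)\<^sup>2) * sesq X v v"
  unfolding complex_norm_square by (simp add: sesq_linear)

lemma pos_of_unit_vectors:
  assumes "\<And>v. norm2 v = 1 \<Longrightarrow> 0 \<le> sesq X v v" shows "pos X"
  unfolding pos_def
proof
  fix v
  show "0 \<le> sesq X v v"
  proof (cases "v = (\<lambda>i. 0)")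
    case True
    then show ?thesis by (simp add: sesq_def)
  next
    case False
    then obtain u where u: "norm2 u = 1" "v = (\<lambda>i. complex_of_real (sqrt (norm2 v)) * u i)"
      by (rule norm2_normalize)
    have "sesq X v v = complex_of_real (norm2 v) * sesq X u u"
      by (subst (1 2) u(2)) (simp add: sesq_quadratic norm2_nonneg)
    then show ?thesis using assms[OF u(1)] norm2_nonneg[of v] by (simp add: less_eq_complex_def)
  qed
qed

text \<open>Only unit vectors on which \<open>H\<close> is not positive can do harm. They form a
  compact set free of null vectors of \<open>P\<close>, so \<open>P\<close> has a positive lower
  bound there, which absorbs a small multiple of \<open>H\<close>.\<close>

lemma pos_perturbation:
  fixes P H :: "'i::finite \<Rightarrow> 'i \<Rightarrow> complex"
  assumes P: "pos P" and H: "\<And>v. Im (sesq H v v) = 0"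
    and dir: "\<And>v. v \<noteq> (\<lambda>i. 0) \<Longrightarrow> sesq P v v = 0 \<Longrightarrow> 0 < Re (sesq H v v)"
  obtains e where "0 < e" "e \<le> 1" "pos (\<lambda>r s. P r s + complex_of_real e * H r s)"
proof -
  define K where "K = {v :: 'i \<Rightarrow> complex. norm2 v = 1} \<inter> {v. Re (sesq H v v) \<le> 0}"
  have cK: "compact K" unfolding K_def
    by (intro compact_Int_closed compact_sphere closed_Collect_le continuous_intros)
  have posP: "0 \<le> Re (sesq P v v)" "Im (sesq P v v) = 0" for v
    using P by (simp_all add: pos_def less_eq_complex_def)
  have "\<exists>c>0. \<forall>v\<in>K. c \<le> Re (sesq P v v)"
  proof (cases "K = {}")
    case False
    have "continuous_on K (\<lambda>v. Re (sesq P v v))" by (intro continuous_intros)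
    from continuous_attains_inf[OF cK False this] obtain u where
      u: "u \<in> K" "\<And>v. v \<in> K \<Longrightarrow> Re (sesq P u u) \<le> Re (sesq P v v)" by blast
    have "sesq P u u \<noteq> 0" using u(1) dir[of u] norm2_eq_0[of u] by (auto simp: K_def)
    then have "0 < Re (sesq P u u)" using posP[of u] by (simp add: complex_eq_iff)
    then show ?thesis using u(2) by blast
  qed (auto intro: exI[of _ 1])
  then obtain c where c: "0 < c" "\<And>v. v \<in> K \<Longrightarrow> c \<le> Re (sesq P v v)" by blast
  define M where "M = (\<Sum>r\<in>UNIV. \<Sum>s\<in>UNIV. cmod (H r s))"
  have M: "0 \<le> M" unfolding M_def by (intro sum_nonneg) simp
  \<comment> \<open>The summand 1 guards against \<open>M = 0\<close>; the cap at 1 allows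
    \<open>e\<close> to serve as a convex weight.\<close>
  define e where "e = min 1 (c / (M + 1))"
  have e: "0 < e" "e \<le> 1" using c(1) M by (auto simp: e_def)
  have "e * M \<le> c / (M + 1) * M" using M by (intro mult_right_mono) (auto simp: e_def)
  also have "\<dots> \<le> c" using c(1) M by (simp add: field_simps)
  finally have eM: "e * M \<le> c" .
  have "pos (\<lambda>r s. P r s + complex_of_real e * H r s)"
  proof (rule pos_of_unit_vectors)
    fix v :: "'i \<Rightarrow> complex"
    assume v: "norm2 v = 1"
    have "0 \<le> Re (sesq P v v) + e * Re (sesq H v v)"
    proof (cases "v \<in> K")
      case True
      have "\<bar>Re (sesq H v v)\<bar> \<le> M"
        using sesq_bound[of H v] abs_Re_le_cmod[of "sesq H v v"] v by (simp add: M_def)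
      then have "e * - M \<le> e * Re (sesq H v v)" using e by (intro mult_left_mono) auto
      then show ?thesis using eM c(2)[OF True] by simp
    next
      case False
      then have "0 < Re (sesq H v v)" using v by (simp add: K_def)
      then show ?thesis using posP(1)[of v] e by simp
    qed
    then show "0 \<le> sesq (\<lambda>r s. P r s + complex_of_real e * H r s) v v"
      using posP(2)[of v] H[of v] by (simp add: sesq_linear less_eq_complex_def)
  qed
  with e show thesis by (rule that)
qed

section \<open>The optimal mixture\<close>

text \<open>Positivity of the partial transpose stands in for separability because it is visibly
  closed and can be controlled through kernel vectors.\<close>

definition ppt_majorants :: "('a::finite \<times> 'b::finite \<Rightarrow> 'a \<times> 'b \<Rightarrow> complex) \<Rightarrow> ('a \<times> 'b \<Rightarrow> 'a \<times> 'b \<Rightarrow> complex) set" where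
  "ppt_majorants \<rho> = {\<sigma>. pos (\<lambda>r s. \<sigma> r s - \<rho> r s) \<and> pos (pt \<sigma>)}"

lemma ppt_majorants_pos: "pos \<rho> \<Longrightarrow> \<sigma> \<in> ppt_majorants \<rho> \<Longrightarrow> pos \<sigma>"
  using pos_add[of "\<lambda>r s. \<sigma> r s - \<rho> r s" \<rho>] by (simp add: ppt_majorants_def)

lemma continuous_on_entry: "continuous_on A (\<lambda>\<sigma>. \<sigma> r s :: complex)"
  by (rule continuous_on_product_then_coordinatewise[OF continuous_on_coordinate])

lemma closed_ppt_majorants: "closed (ppt_majorants \<rho>)"
  unfolding ppt_majorants_def pos_def less_eq_complex_def sesq_def pt_def
  by (intro closed_Collect_conj closed_Collect_all closed_Collect_le closed_Collect_eq continuous_intros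
      continuous_on_entry)

text \<open>A large multiple of the identity is feasible. Feasible operators are positive, so their
  entries are bounded by the trace, and those of trace at most that of the multiple form a compact
  set.\<close>

lemma ppt_majorant_least:
  fixes \<rho> :: "'a::finite \<times> 'b::finite \<Rightarrow> 'a \<times> 'b \<Rightarrow> complex"
  assumes "pos \<rho>"
  obtains \<tau> where "\<tau> \<in> ppt_majorants \<rho>" "\<And>\<sigma>. \<sigma> \<in> ppt_majorants \<rho> \<Longrightarrow> rtr \<tau> \<le> rtr \<sigma>"
proof -
  define C where "C = (\<Sum>r\<in>UNIV. \<Sum>s\<in>UNIV. cmod (\<rho> r s))"
  define I where "I = (\<lambda>(r :: 'a \<times> 'b) s. complex_of_real C * idop r s)"
  have C: "0 \<le> C" unfolding C_def by (intro sum_nonneg) simp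
  have "pos (\<lambda>r s. I r s - \<rho> r s)"
    unfolding pos_def
  proof
    fix v
    have "Re (sesq \<rho> v v) \<le> C * norm2 v"
      using sesq_bound[of \<rho> v] abs_Re_le_cmod[of "sesq \<rho> v v"] by (simp add: C_def)
    moreover have "Im (sesq \<rho> v v) = 0" using assms by (simp add: pos_def less_eq_complex_def)
    ultimately show "0 \<le> sesq (\<lambda>r s. I r s - \<rho> r s) v v"
      by (simp add: I_def sesq_linear sesq_idop less_eq_complex_def)
  qed
  moreover have "pt I = I" unfolding I_def by (auto simp: pt_def idop_def fun_eq_iff)
  moreover have "pos I" unfolding I_def using C by (intro pos_scale pos_idop) (simp add: less_eq_complex_def)
  ultimately have I: "I \<in> ppt_majorants \<rho>" by (simp add: ppt_majorants_def)
  define K where "K = {\<sigma> :: 'a \<times> 'b \<Rightarrow> 'a \<times> 'b \<Rightarrow> complex. \<forall>r. \<sigma> r \<in> {f. \<forall>s. f s \<in> cball 0 (rtr I)}}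
    \<inter> (ppt_majorants \<rho> \<inter> {\<sigma>. rtr \<sigma> \<le> rtr I})"
  have cont: "continuous_on A rtr" for A :: "('a \<times> 'b \<Rightarrow> 'a \<times> 'b \<Rightarrow> complex) set"
    unfolding rtr_def by (intro continuous_intros continuous_on_entry)
  have "compact K" unfolding K_def
    by (intro compact_Int_closed compact_funs compact_cball closed_Int closed_ppt_majorants closed_Collect_le
        cont continuous_intros)
  moreover have mem: "\<sigma> \<in> K" if "\<sigma> \<in> ppt_majorants \<rho>" "rtr \<sigma> \<le> rtr I" for \<sigma>
    using that order_trans[OF pos_entry_le_rtr[OF ppt_majorants_pos[OF assms that(1)]] that(2)]
    by (simp add: K_def)
  then have "K \<noteq> {}" using I by blast
  ultimately obtain \<tau> where \<tau>: "\<tau> \<in> K" "\<And>\<sigma>. \<sigma> \<in> K \<Longrightarrow> rtr \<tau> \<le> rtr \<sigma>"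
    using continuous_attains_inf[OF _ _ cont, of K] by blast
  show thesis
  proof (rule that[of \<tau>])
    show "\<tau> \<in> ppt_majorants \<rho>" using \<tau>(1) by (simp add: K_def)
    show "rtr \<tau> \<le> rtr \<sigma>" if "\<sigma> \<in> ppt_majorants \<rho>" for \<sigma>
      using that mem[OF that] \<tau> by (cases "rtr \<sigma> \<le> rtr I") (auto simp: K_def)
  qed
qed

text \<open>A two-dimensional subspace of \<open>\<complex>\<^sup>2 \<otimes> \<complex>\<^sup>2\<close> contains a product vector, on which the form of \<open>pt X\<close>
  is a value of the form of \<open>X\<close>.\<close>

lemma pt_kernel_dim_le_1:
  fixes X :: "pair \<Rightarrow> pair \<Rightarrow> complex"
  assumes strict: "\<And>v. v \<noteq> (\<lambda>r. 0) \<Longrightarrow> sesq X v v \<noteq> 0" and Q: "pos (pt X)"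
    and \<phi>: "\<phi> \<noteq> (\<lambda>r. 0)" "sesq (pt X) \<phi> \<phi> = 0" and v: "sesq (pt X) v v = 0"
  obtains c where "v = (\<lambda>r. c * \<phi> r)"
proof -
  define dt where "dt = (\<lambda>u :: pair \<Rightarrow> complex. u (False, False) * u (True, True) - u (False, True) * u (True, False))"
  have prod: "u = (\<lambda>r. 0)" if u0: "sesq (pt X) u u = 0" and u1: "dt u = 0" for u
  proof (rule ccontr)
    assume ne: "u \<noteq> (\<lambda>r. 0)"
    obtain a b where ab: "u = kron a b"
      using product_of_det_zero[OF ne] u1 by (auto simp: dt_def)
    have "sesq X (kron a (\<lambda>j. cnj (b j))) (kron a (\<lambda>j. cnj (b j))) = 0"
      using u0 unfolding ab sesq_pt_kron .
    then have "kron a (\<lambda>j. cnj (b j)) = (\<lambda>r. 0)" using strict by blast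
    then have "kron a b = (\<lambda>r. 0)" by (auto simp: kron_def fun_eq_iff)
    then show False using ne ab by simp
  qed
  define B where "B = v (False, False) * \<phi> (True, True) + \<phi> (False, False) * v (True, True)
    - v (False, True) * \<phi> (True, False) - \<phi> (False, True) * v (True, False)"
  have dt: "dt \<phi> \<noteq> 0" using prod[OF \<phi>(2)] \<phi>(1) by blast
  \<comment> \<open>A root of det(v + z \<phi>) = 0, a genuine quadratic because \<phi> is not a
    product. The combination is then a product vector in the kernel, hence zero.\<close>
  define z where "z = (- B + csqrt (B\<^sup>2 - 4 * dt \<phi> * dt v)) / (2 * dt \<phi>)"
  have root: "dt \<phi> * z\<^sup>2 + B * z + dt v = 0"
  proof -
    have "2 * dt \<phi> * z + B = csqrt (B\<^sup>2 - 4 * dt \<phi> * dt v)" using dt by (simp add: z_def)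
    then have "(2 * dt \<phi> * z + B)\<^sup>2 = B\<^sup>2 - 4 * dt \<phi> * dt v" by simp
    then have "4 * dt \<phi> * (dt \<phi> * z\<^sup>2 + B * z + dt v) = 0" by (simp add: power2_eq_square algebra_simps)
    then show ?thesis using dt by simp
  qed
  have "dt (\<lambda>i. v i + z * \<phi> i) = 0"
    using root by (simp add: dt_def B_def power2_eq_square algebra_simps)
  moreover have "sesq (pt X) (\<lambda>i. v i + z * \<phi> i) (\<lambda>i. v i + z * \<phi> i) = 0"
    unfolding quad_add using pos_kernel[OF Q \<phi>(2)] pos_kernel[OF Q v] \<phi>(2) v by simp
  ultimately have "(\<lambda>i. v i + z * \<phi> i) = (\<lambda>r. 0)" using prod by blast
  then have "v = (\<lambda>r. - z * \<phi> r)" by (simp add: fun_eq_iff add_eq_0_iff)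
  then show thesis by (rule that)
qed

text \<open>Read as a 2x2 matrix, \<phi> has squared operator norm at most 1/2; equivalently, its
  squared overlap with product unit vectors is at most 1/2. Multiplied by sqrt 2 the matrix is a
  contraction, hence usable as a filter.\<close>

definition contractive :: "(pair \<Rightarrow> complex) \<Rightarrow> bool" where
  "contractive \<phi> \<longleftrightarrow> (\<forall>x. norm2 (\<lambda>j. \<Sum>i\<in>UNIV. cnj (\<phi> (i, j)) * x i) \<le> norm2 x / 2)"

text \<open>The scale is set by the maximum over the unit sphere. The maximizer \<open>a\<close> is
  kept because the product vector of largest overlap is built from it.\<close>

lemma contractive_normalization:
  assumes "\<phi> \<noteq> (\<lambda>r. 0)"
  obtains c a where "0 < c" "contractive (\<lambda>r. complex_of_real c * \<phi> r)" "norm2 a = 1"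
    "norm2 (\<lambda>j. \<Sum>i\<in>UNIV. cnj (complex_of_real c * \<phi> (i, j)) * a i) = 1 / 2"
proof -
  define f where "f = (\<lambda>x :: bool \<Rightarrow> complex. norm2 (\<lambda>j. \<Sum>i\<in>UNIV. cnj (\<phi> (i, j)) * x i))"
  have "continuous_on {v :: bool \<Rightarrow> complex. norm2 v = 1} f"
    unfolding f_def norm2_def
    by (intro continuous_intros continuous_on_coordinate)
  moreover have nk: "norm2 (ket k) = 1" for k :: bool
    by (cases k) (simp_all add: norm2_def sum_bool ket_def)
  then have "{v :: bool \<Rightarrow> complex. norm2 v = 1} \<noteq> {}" by blast
  ultimately obtain a where a: "norm2 a = 1" "\<And>x. norm2 x = 1 \<Longrightarrow> f x \<le> f a"
    using continuous_attains_sup[OF compact_sphere, of f] by auto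
  have scale: "f (\<lambda>i. z * x i) = (cmod z)\<^sup>2 * f x" for z x
    unfolding f_def norm2_scale[symmetric] by (simp add: sum_distrib_left mult.left_commute)
  have "f a \<noteq> 0"
  proof
    assume "f a = 0"
    then have "f (ket k) \<le> 0" for k using a(2)[OF nk[of k]] by simp
    moreover have "0 \<le> f (ket k)" for k unfolding f_def by (rule norm2_nonneg)
    ultimately have "f (ket k) = 0" for k by (intro antisym)
    then have z: "(\<lambda>j. \<Sum>i\<in>UNIV. cnj (\<phi> (i, j)) * ket k i) = (\<lambda>i. 0)" for k
      by (simp only: f_def norm2_eq_0)
    have "\<phi> (k, j) = 0" for k j
      using fun_cong[OF z[of k], of j] by (cases k) (simp_all add: ket_def sum_bool)
    then show False using assms by auto
  qed
  then have fa: "0 < f a" using norm2_nonneg[of "\<lambda>j. \<Sum>i\<in>UNIV. cnj (\<phi> (i, j)) * a i"] by (simp add: f_def less_le)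
  define c where "c = sqrt (1 / (2 * f a))"
  have c2: "c\<^sup>2 = 1 / (2 * f a)" and c: "0 < c" using fa by (simp_all add: c_def)
  have n: "norm2 (\<lambda>j. \<Sum>i\<in>UNIV. cnj (complex_of_real c * \<phi> (i, j)) * x i) = f x / (2 * f a)" for x
  proof -
    have "(\<lambda>j. \<Sum>i\<in>UNIV. cnj (complex_of_real c * \<phi> (i, j)) * x i) = (\<lambda>j. complex_of_real c * (\<Sum>i\<in>UNIV. cnj (\<phi> (i, j)) * x i))"
      by (simp add: sum_distrib_left mult.assoc)
    then show ?thesis using c by (simp only: norm2_scale norm_of_real) (simp add: c2 f_def)
  qed
  have "f x \<le> f a * norm2 x" for x
  proof (cases "x = (\<lambda>i. 0)")
    case True
    then show ?thesis by (simp add: f_def norm2_def)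
  next
    case False
    then obtain u where u: "norm2 u = 1" "x = (\<lambda>i. complex_of_real (sqrt (norm2 x)) * u i)"
      by (rule norm2_normalize)
    have "f x = norm2 x * f u" by (subst u(2), subst scale) (simp add: norm2_nonneg)
    then show ?thesis using a(2)[OF u(1)] norm2_nonneg[of x] by (simp add: mult.commute mult_left_mono)
  qed
  then have "contractive (\<lambda>r. complex_of_real c * \<phi> r)"
    unfolding contractive_def n using fa by (simp add: field_simps)
  moreover have "norm2 (\<lambda>j. \<Sum>i\<in>UNIV. cnj (complex_of_real c * \<phi> (i, j)) * a i) = 1 / 2"
    unfolding n using fa by simp
  ultimately show thesis using c a(1) by (intro that) 
qed

text \<open>At the minimum \<open>\<tau>\<close>, moving towards \<open>\<rho>\<close> while adding a little of the product state \<open>e e\<^sup>*\<close> on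
  which \<open>\<phi>\<close> is largest keeps \<open>pt \<tau>\<close> positive as soon as it does so to first order on its kernel
  \<open>\<phi>\<close>; comparing traces gives the bound.\<close>

lemma minimal_majorant_bound:
  fixes \<rho> :: "pair \<Rightarrow> pair \<Rightarrow> complex"
  assumes \<rho>: "pos \<rho>" and strict: "\<And>v. v \<noteq> (\<lambda>r. 0) \<Longrightarrow> 0 < Re (sesq \<rho> v v)"
    and \<tau>: "\<tau> \<in> ppt_majorants \<rho>" and least: "\<And>\<sigma>. \<sigma> \<in> ppt_majorants \<rho> \<Longrightarrow> rtr \<tau> \<le> rtr \<sigma>"
  shows "\<exists>\<phi>. contractive \<phi> \<and> rtr \<tau> \<le> rtr \<rho> - 2 * Re (sesq (pt \<rho>) \<phi> \<phi>)"
proof -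
  define Z where "Z = (\<lambda>r s. \<tau> r s - \<rho> r s)"
  have Z: "pos Z" and Q: "pos (pt \<tau>)" using \<tau> by (simp_all add: ppt_majorants_def Z_def)
  have rtrZ: "rtr Z = rtr \<tau> - rtr \<rho>" by (simp add: Z_def rtr_diff)
  have zero: "contractive (\<lambda>r. 0)" by (simp add: contractive_def norm2_def sum_nonneg)
  \<comment> \<open>The surplus \<open>Z\<close> is shifted to (1 - e) Z + e D. On the kernel of
    \<open>pt \<tau>\<close> the first-order change is positive, so a small step stays feasible and
    minimality compares the traces.\<close>
  have move: "rtr Z \<le> rtr D" if D: "pos D"
    and dir: "\<And>v. v \<noteq> (\<lambda>r. 0) \<Longrightarrow> sesq (pt \<tau>) v v = 0 \<Longrightarrow> Re (sesq (pt Z) v v) < Re (sesq (pt D) v v)" for D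
  proof -
    define H where "H = (\<lambda>r s. pt D r s - pt Z r s)"
    have im: "Im (sesq H v v) = 0" for v
      by (simp add: H_def sesq_linear pos_pt_sesq_real D Z)
    have dirH: "0 < Re (sesq H v v)" if "v \<noteq> (\<lambda>r. 0)" "sesq (pt \<tau>) v v = 0" for v
      using dir[OF that] by (simp add: H_def sesq_linear)
    obtain e where e: "0 < e" "e \<le> 1" "pos (\<lambda>r s. pt \<tau> r s + complex_of_real e * H r s)"
      by (rule pos_perturbation[OF Q im dirH])
    define \<sigma> where "\<sigma> = (\<lambda>r s. \<tau> r s + complex_of_real e * (D r s - Z r s))"
    have "pt \<sigma> = (\<lambda>r s. pt \<tau> r s + complex_of_real e * H r s)" by (simp add: \<sigma>_def H_def pt_def)
    moreover have "(\<lambda>r s. \<sigma> r s - \<rho> r s) = (\<lambda>r s. complex_of_real (1 - e) * Z r s + complex_of_real e * D r s)"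
      by (simp add: \<sigma>_def Z_def algebra_simps)
    moreover have "pos (\<lambda>r s. complex_of_real (1 - e) * Z r s + complex_of_real e * D r s)"
      using e by (intro pos_add pos_scale Z D) (auto simp: less_eq_complex_def)
    ultimately have "\<sigma> \<in> ppt_majorants \<rho>" using e(3) by (simp add: ppt_majorants_def)
    from least[OF this] have "0 \<le> e * (rtr D - rtr Z)"
      by (simp add: \<sigma>_def rtr_add rtr_scale rtr_diff)
    then show ?thesis using e(1) by (simp add: zero_le_mult_iff)
  qed
  show ?thesis
  proof (cases "\<exists>\<phi>. \<phi> \<noteq> (\<lambda>r. 0) \<and> sesq (pt \<tau>) \<phi> \<phi> = 0")
    \<comment> \<open>Without null vectors even \<open>D = 0\<close> is an admissible direction, so
      \<open>Z\<close> has trace at most 0 and \<phi> = 0 serves.\<close>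
    case False
    have "rtr Z \<le> rtr (\<lambda>(r :: pair) (s :: pair). 0)"
      by (rule move[OF pos_zero]) (use False in blast)
    moreover have "rtr (\<lambda>(r :: pair) (s :: pair). 0) = 0" by (simp add: rtr_def)
    ultimately have "rtr \<tau> \<le> rtr \<rho>" by (simp add: rtrZ)
    then show ?thesis using zero by (intro exI[of _ "\<lambda>r. 0"]) (simp add: sesq_def)
  next
    case True
    then obtain \<phi>0 where \<phi>0: "\<phi>0 \<noteq> (\<lambda>r. 0)" "sesq (pt \<tau>) \<phi>0 \<phi>0 = 0" by blast
    obtain c a where c: "0 < c" "contractive (\<lambda>r. complex_of_real c * \<phi>0 r)" "norm2 a = 1"
      "norm2 (\<lambda>j. \<Sum>i\<in>UNIV. cnj (complex_of_real c * \<phi>0 (i, j)) * a i) = 1 / 2"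
      by (rule contractive_normalization[OF \<phi>0(1)])
    define \<phi> where "\<phi> = (\<lambda>r. complex_of_real c * \<phi>0 r)"
    define b where "b = (\<lambda>j. \<Sum>i\<in>UNIV. cnj (\<phi> (i, j)) * a i)"
    have nb: "norm2 b = 1 / 2" using c(4) by (simp add: b_def \<phi>_def)
    have \<phi>: "\<phi> \<noteq> (\<lambda>r. 0)" "sesq (pt \<tau>) \<phi> \<phi> = 0"
      using \<phi>0 c(1) by (auto simp: \<phi>_def sesq_quadratic fun_eq_iff)
    define g where "g = Re (sesq (pt Z) \<phi> \<phi>)"
    have "pt Z = (\<lambda>r s. pt \<tau> r s - pt \<rho> r s)" by (simp add: Z_def pt_def)
    then have g: "g = - Re (sesq (pt \<rho>) \<phi> \<phi>)" using \<phi>(2) by (simp add: g_def sesq_linear)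
    have "rtr Z \<le> 2 * g"
    proof (rule ccontr)
      assume lt: "\<not> rtr Z \<le> 2 * g"
      have "rtr Z \<noteq> 0"
      proof
        assume "rtr Z = 0"
        then have "Z r s = 0" for r s using pos_entry_le_rtr[OF Z, of r s] by simp
        then have "g = 0" by (simp add: g_def sesq_def pt_def)
        then show False using lt \<open>rtr Z = 0\<close> by simp
      qed
      then have rZ: "0 < rtr Z" using pos_rtr_nonneg[OF Z] by simp
      \<comment> \<open>The midpoint of max 0 (4 g) and 2 tr Z: \<open>d / 4\<close> exceeds
        \<open>g\<close>, so \<open>D\<close> beats \<open>Z\<close> on \<phi>, while the trace
        \<open>d / 2\<close> of \<open>D\<close> stays below that of \<open>Z\<close>.\<close>
      define d where "d = (max 0 (4 * g) + 2 * rtr Z) / 2"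
      have d: "0 \<le> d" "4 * g < d" "d < 2 * rtr Z" using rZ lt by (auto simp: d_def)
      \<comment> \<open>Partial transposition conjugates \<open>b\<close>; the overlap of the
        resulting \<open>e'\<close> with \<phi> is then the squared norm 1/2 of
        \<open>b\<close>.\<close>
      define e where "e = kron a b"
      define D where "D = (\<lambda>r s. complex_of_real d * (e r * cnj (e s)))"
      have D: "pos D" unfolding D_def using d(1) by (intro pos_scale pos_rank_one) (simp add: less_eq_complex_def)
      have "norm2 e = norm2 a * norm2 b"
        by (simp add: norm2_def e_def kron_def sum_prod_UNIV sum_product norm_mult power_mult_distrib)
      then have rD: "rtr D = d / 2" unfolding D_def rtr_scale rtr_rank_one by (simp add: c(3) nb)
      define e' where "e' = kron a (\<lambda>j. cnj (b j))"
      have ptD: "pt D = (\<lambda>r s. complex_of_real d * (e' r * cnj (e' s)))"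
        by (simp add: D_def pt_def e_def e'_def kron_def ac_simps)
      have "(\<Sum>r\<in>UNIV. cnj (\<phi> r) * e' r) = (\<Sum>j\<in>UNIV. b j * cnj (b j))"
        unfolding b_def e'_def kron_def sum_prod_UNIV
        by (subst sum.swap) (simp add: sum_distrib_right ac_simps)
      also have "\<dots> = complex_of_real (norm2 b)"
        unfolding norm2_def of_real_sum complex_norm_square ..
      finally have s1: "(\<Sum>r\<in>UNIV. cnj (\<phi> r) * e' r) = 1 / 2" by (simp add: nb)
      have "(\<Sum>r\<in>UNIV. cnj (e' r) * \<phi> r) = cnj (\<Sum>r\<in>UNIV. cnj (\<phi> r) * e' r)"
        by (simp add: mult.commute)
      then have s2: "(\<Sum>r\<in>UNIV. cnj (e' r) * \<phi> r) = 1 / 2" unfolding s1 by simp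
      have "sesq (pt D) \<phi> \<phi> = complex_of_real (d / 4)"
        unfolding ptD sesq_scale_op sesq_rank_one s1 s2 by simp
      then have Dphi: "Re (sesq (pt D) \<phi> \<phi>) = d / 4" by (simp only: Re_complex_of_real)
      have "rtr Z \<le> rtr D"
      proof (rule move[OF D])
        fix v :: "pair \<Rightarrow> complex"
        assume v: "v \<noteq> (\<lambda>r. 0)" "sesq (pt \<tau>) v v = 0"
        \<comment> \<open>The majorant inherits definiteness from \<rho>, so every null vector of
          \<open>pt \<tau>\<close> is a multiple of \<phi>.\<close>
        have ne: "sesq \<tau> u u \<noteq> 0" if "u \<noteq> (\<lambda>r. 0)" for u
        proof -
          have "sesq \<tau> u u = sesq \<rho> u u + sesq Z u u" by (simp add: Z_def sesq_linear)
          then have "0 < Re (sesq \<tau> u u)"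
            using strict[OF that] Z by (simp add: pos_def less_eq_complex_def add_pos_nonneg)
          then show ?thesis by auto
        qed
        obtain k where k: "v = (\<lambda>r. k * \<phi> r)"
          by (rule pt_kernel_dim_le_1[OF ne Q \<phi> v(2)])
        have "k \<noteq> 0" using v(1) k by auto
        then show "Re (sesq (pt Z) v v) < Re (sesq (pt D) v v)"
          unfolding k sesq_quadratic using d(2) Dphi by (simp add: g_def)
      qed
      then show False using rD d(3) by simp
    qed
    then show ?thesis using c(2) g unfolding rtrZ \<phi>_def[symmetric] by (intro exI[of _ \<phi>]) simp
  qed
qed

text \<open>Here \<tau> is minimal for \<rho> itself; the noise affects only the choice of \<phi>.
  Hence the \<epsilon> in the bound, and no limit of the vectors \<phi> is taken.\<close>

theorem optimal_majorant:
  fixes \<rho> :: "pair \<Rightarrow> pair \<Rightarrow> complex"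
  assumes \<rho>: "pos \<rho>" and tr: "rtr \<rho> = 1"
  obtains \<tau> where "pos (\<lambda>r s. \<tau> r s - \<rho> r s)" "sepc \<tau>"
    "\<And>\<epsilon>. 0 < \<epsilon> \<Longrightarrow> \<exists>\<phi>. contractive \<phi> \<and> rtr \<tau> / 2 \<le> 1 / 2 - Re (sesq (pt \<rho>) \<phi> \<phi>) + \<epsilon>"
proof -
  obtain \<tau> where \<tau>: "\<tau> \<in> ppt_majorants \<rho>" "\<And>\<sigma>. \<sigma> \<in> ppt_majorants \<rho> \<Longrightarrow> rtr \<tau> \<le> rtr \<sigma>"
    using ppt_majorant_least[OF \<rho>] by blast
  have "\<exists>\<phi>. contractive \<phi> \<and> rtr \<tau> / 2 \<le> 1 / 2 - Re (sesq (pt \<rho>) \<phi> \<phi>) + \<epsilon>" if \<epsilon>: "0 < \<epsilon>" for \<epsilon>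
  proof -
    define m where "m = 1 / (1 + \<epsilon>)"
    have m: "0 < m" "m < 1" using \<epsilon> by (simp_all add: m_def)
    \<comment> \<open>Keeps the trace of \<rho>' at one in dimension four.\<close>
    define n where "n = (1 - m) / 4"
    have n: "0 < n" using m by (simp add: n_def)
    define \<rho>' where "\<rho>' = (\<lambda>r s. complex_of_real m * \<rho> r s + complex_of_real n * idop r s)"
    have sq: "sesq \<rho>' v v = m * sesq \<rho> v v + n * norm2 v" for v
      by (simp add: \<rho>'_def sesq_linear sesq_idop)
    have "pos \<rho>'" unfolding \<rho>'_def using m n
      by (intro pos_add pos_scale \<rho> pos_idop) (simp_all add: less_eq_complex_def)
    moreover have strict: "0 < Re (sesq \<rho>' v v)" if "v \<noteq> (\<lambda>r. 0)" for v
    proof -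
      have "0 < norm2 v" using that norm2_nonneg[of v] norm2_eq_0[of v] by linarith
      then have "0 < n * norm2 v" using n by simp
      moreover have "0 \<le> m * Re (sesq \<rho> v v)" using \<rho> m by (simp add: pos_def less_eq_complex_def)
      ultimately show ?thesis by (simp add: sq)
    qed
    moreover obtain \<tau>' where \<tau>': "\<tau>' \<in> ppt_majorants \<rho>'" "\<And>\<sigma>. \<sigma> \<in> ppt_majorants \<rho>' \<Longrightarrow> rtr \<tau>' \<le> rtr \<sigma>"
      using ppt_majorant_least[OF \<open>pos \<rho>'\<close>] by blast
    ultimately obtain \<phi> where \<phi>: "contractive \<phi>" "rtr \<tau>' \<le> rtr \<rho>' - 2 * Re (sesq (pt \<rho>') \<phi> \<phi>)"
      using minimal_majorant_bound[of \<rho>' \<tau>'] by blast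
    have "rtr \<rho>' = m + n * 4" by (simp add: \<rho>'_def rtr_add rtr_scale tr rtr_idop)
    then have "rtr \<rho>' = 1" by (simp add: n_def field_simps)
    moreover have "pt \<rho>' = (\<lambda>r s. complex_of_real m * pt \<rho> r s + complex_of_real n * idop r s)"
      unfolding \<rho>'_def by (subst pt_idop[symmetric]) (simp add: pt_def)
    then have "Re (sesq (pt \<rho>') \<phi> \<phi>) = m * Re (sesq (pt \<rho>) \<phi> \<phi>) + n * norm2 \<phi>"
      by (simp add: sesq_linear sesq_idop)
    moreover have "0 \<le> n * norm2 \<phi>" using n norm2_nonneg[of \<phi>] by simp
    ultimately have up: "rtr \<tau>' \<le> 1 - 2 * (m * Re (sesq (pt \<rho>) \<phi> \<phi>))" using \<phi>(2) by linarith
    \<comment> \<open>Since \<rho>' lies above m \<rho>, a majorant of \<rho>' divided by m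
      majorizes \<rho>. The factor 1 / m = 1 + \<epsilon> is the source of the error term.\<close>
    define \<sigma> where "\<sigma> = (\<lambda>r s. complex_of_real (1 / m) * \<tau>' r s)"
    have "pos (pt \<sigma>)"
    proof -
      have "pt \<sigma> = (\<lambda>r s. complex_of_real (1 / m) * pt \<tau>' r s)" by (simp add: \<sigma>_def pt_def)
      moreover have "pos (\<lambda>r s. complex_of_real (1 / m) * pt \<tau>' r s)"
        using \<tau>'(1) m by (intro pos_scale) (simp_all add: ppt_majorants_def less_eq_complex_def)
      ultimately show ?thesis by simp
    qed
    moreover have "pos (\<lambda>r s. \<sigma> r s - \<rho> r s)"
    proof -
      have "(\<lambda>r s. \<sigma> r s - \<rho> r s) = (\<lambda>r s. complex_of_real (1 / m) * ((\<tau>' r s - \<rho>' r s) + complex_of_real n * idop r s))"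
        using m by (simp add: \<sigma>_def \<rho>'_def field_simps)
      moreover have "pos (\<lambda>r s. complex_of_real (1 / m) * ((\<tau>' r s - \<rho>' r s) + complex_of_real n * idop r s))" using \<tau>'(1) m n
        by (intro pos_scale pos_add pos_idop) (simp_all add: ppt_majorants_def less_eq_complex_def)
      ultimately show ?thesis by simp
    qed
    ultimately have "rtr \<tau> \<le> rtr \<sigma>" by (intro \<tau>(2)) (simp add: ppt_majorants_def)
    also have "rtr \<sigma> = rtr \<tau>' / m" unfolding \<sigma>_def rtr_scale by simp
    also have "\<dots> \<le> (1 - 2 * (m * Re (sesq (pt \<rho>) \<phi> \<phi>))) / m" using up m by (simp add: divide_right_mono)
    also have "\<dots> = 1 + \<epsilon> - 2 * Re (sesq (pt \<rho>) \<phi> \<phi>)"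
      using m \<epsilon> by (simp add: diff_divide_distrib) (simp add: m_def)
    finally show ?thesis using \<phi>(1) \<epsilon> by (intro exI[of _ \<phi>]) simp
  qed
  moreover have "sepc \<tau>"
    using sepc_of_ppt[OF ppt_majorants_pos[OF \<rho> \<tau>(1)]] \<tau>(1) by (simp add: ppt_majorants_def)
  ultimately show thesis using \<tau>(1) by (intro that[of \<tau>]) (auto simp: ppt_majorants_def)
qed

section \<open>Quadratic forms of matrices\<close>

lemma scalar_prod_form:
  assumes "X \<in> carrier_mat n n" "v \<in> carrier_vec n"
  shows "(X *\<^sub>v v) \<bullet>c v = (\<Sum>i<n. \<Sum>j<n. cnj (v $ i) * X $$ (i, j) * v $ j)"
  using assms by (simp add: scalar_prod_def atLeast0LessThan sum_distrib_left mult.commute mult.left_commute)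

lemma psd_iff:
  "psd n X \<longleftrightarrow> X \<in> carrier_mat n n \<and> (\<forall>v. 0 \<le> (\<Sum>i<n. \<Sum>j<n. cnj (v i) * X $$ (i, j) * v j))"
proof -
  have "(\<forall>v\<in>carrier_vec n. 0 \<le> (X *\<^sub>v v) \<bullet>c v) \<longleftrightarrow>
      (\<forall>v. 0 \<le> (\<Sum>i<n. \<Sum>j<n. cnj (v i) * X $$ (i, j) * v j))" if X: "X \<in> carrier_mat n n"
  proof
    assume a: "\<forall>v\<in>carrier_vec n. 0 \<le> (X *\<^sub>v v) \<bullet>c v"
    show "\<forall>v. 0 \<le> (\<Sum>i<n. \<Sum>j<n. cnj (v i) * X $$ (i, j) * v j)"
    proof
      fix v
      show "0 \<le> (\<Sum>i<n. \<Sum>j<n. cnj (v i) * X $$ (i, j) * v j)"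
        using bspec[OF a vec_carrier[of n v]] scalar_prod_form[OF X vec_carrier[of n v]] by simp
    qed
  next
    assume "\<forall>v. 0 \<le> (\<Sum>i<n. \<Sum>j<n. cnj (v i) * X $$ (i, j) * v j)"
    then show "\<forall>v\<in>carrier_vec n. 0 \<le> (X *\<^sub>v v) \<bullet>c v" by (simp add: scalar_prod_form[OF X])
  qed
  then show ?thesis unfolding psd_def by blast
qed

lemma psd_mat_sum:
  assumes "\<And>k. k < r \<Longrightarrow> psd n (A k)" shows "psd n (mat_sum n A r)"
  unfolding psd_iff
proof (intro conjI allI)
  fix v
  have "(\<Sum>i<n. \<Sum>j<n. cnj (v i) * mat_sum n A r $$ (i, j) * v j) =
      (\<Sum>i<n. \<Sum>j<n. \<Sum>k<r. cnj (v i) * A k $$ (i, j) * v j)"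
    by (intro sum.cong refl) (simp add: mat_sum_def sum_distrib_left sum_distrib_right)
  also have "\<dots> = (\<Sum>i<n. \<Sum>k<r. \<Sum>j<n. cnj (v i) * A k $$ (i, j) * v j)"
    by (intro sum.cong refl sum.swap)
  also have "\<dots> = (\<Sum>k<r. \<Sum>i<n. \<Sum>j<n. cnj (v i) * A k $$ (i, j) * v j)"
    by (rule sum.swap)
  also have "0 \<le> \<dots>" using assms by (intro sum_nonneg[of "{..<r}"]) (auto simp: psd_iff)
  finally show "0 \<le> (\<Sum>i<n. \<Sum>j<n. cnj (v i) * mat_sum n A r $$ (i, j) * v j)" .
qed (simp add: mat_sum_def)

lemma scalar_prod_mat_sum:
  assumes "\<And>k. k < r \<Longrightarrow> A k \<in> carrier_mat n n" "v \<in> carrier_vec n"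
  shows "(mat_sum n A r *\<^sub>v v) \<bullet>c v = (\<Sum>k<r. (A k *\<^sub>v v) \<bullet>c v)"
proof -
  have "mat_sum n A r \<in> carrier_mat n n" by (simp add: mat_sum_def)
  from scalar_prod_form[OF this assms(2)]
  have "(mat_sum n A r *\<^sub>v v) \<bullet>c v = (\<Sum>i<n. \<Sum>j<n. \<Sum>k<r. cnj (v $ i) * A k $$ (i, j) * v $ j)"
    by (simp add: mat_sum_def sum_distrib_left sum_distrib_right)
  also have "\<dots> = (\<Sum>i<n. \<Sum>k<r. \<Sum>j<n. cnj (v $ i) * A k $$ (i, j) * v $ j)"
    by (intro sum.cong refl sum.swap)
  also have "\<dots> = (\<Sum>k<r. \<Sum>i<n. \<Sum>j<n. cnj (v $ i) * A k $$ (i, j) * v $ j)"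
    by (rule sum.swap)
  also have "\<dots> = (\<Sum>k<r. (A k *\<^sub>v v) \<bullet>c v)"
  proof (rule sum.cong)
    fix k assume "k \<in> {..<r}"
    then show "(\<Sum>i<n. \<Sum>j<n. cnj (v $ i) * A k $$ (i, j) * v $ j) = (A k *\<^sub>v v) \<bullet>c v"
      using scalar_prod_form[of "A k" n v] assms by simp
  qed simp
  finally show ?thesis .
qed

lemma psd_permute:
  assumes X: "psd n X" and \<pi>: "bij_betw \<pi> {..<n} {..<n}"
  shows "psd n (mat n n (\<lambda>(r, s). X $$ (\<pi> r, \<pi> s)))"
  unfolding psd_iff
proof (intro conjI allI)
  fix v :: "nat \<Rightarrow> complex"
  define w where "w i = v (inv_into {..<n} \<pi> i)" for i
  have w: "w (\<pi> i) = v i" if "i < n" for i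
    using \<pi> that by (simp add: w_def bij_betw_def)
  have "(\<Sum>i<n. \<Sum>j<n. cnj (v i) * mat n n (\<lambda>(r, s). X $$ (\<pi> r, \<pi> s)) $$ (i, j) * v j) =
      (\<Sum>i<n. \<Sum>j<n. cnj (w (\<pi> i)) * X $$ (\<pi> i, \<pi> j) * w (\<pi> j))"
    by (intro sum.cong refl) (simp add: w)
  also have "\<dots> = (\<Sum>i<n. \<Sum>j<n. cnj (w (\<pi> i)) * X $$ (\<pi> i, j) * w j)"
    by (intro sum.cong refl sum.reindex_bij_betw[OF \<pi>])
  also have "\<dots> = (\<Sum>i<n. \<Sum>j<n. cnj (w i) * X $$ (i, j) * w j)"
    by (rule sum.reindex_bij_betw[OF \<pi>])
  finally show "0 \<le> (\<Sum>i<n. \<Sum>j<n. cnj (v i) * mat n n (\<lambda>(r, s). X $$ (\<pi> r, \<pi> s)) $$ (i, j) * v j)"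
    using X by (simp add: psd_iff)
qed simp

section \<open>Linearity and positivity of LOCC operations\<close>

lemma linear_op_act_left:
  assumes "linear_op m n \<Phi>" shows "linear_op (m * b) (n * b) (act_left m n b \<Phi>)"
proof -
  let ?blk = "\<lambda>X r s. mat m m (\<lambda>(i, k). X $$ (i * b + r mod b, k * b + s mod b))"
  have car: "\<Phi> (?blk X r s) \<in> carrier_mat n n" for X r s
    using assms by (simp add: linear_op_def)
  show ?thesis
    unfolding linear_op_def
  proof (intro conjI ballI allI)
    fix X Y :: "complex mat" assume X: "X \<in> carrier_mat (m * b) (m * b)" and Y: "Y \<in> carrier_mat (m * b) (m * b)"
    show "act_left m n b \<Phi> (X + Y) = act_left m n b \<Phi> X + act_left m n b \<Phi> Y"
    proof (rule eq_matI)
      fix r s assume rs: "r < dim_row (act_left m n b \<Phi> X + act_left m n b \<Phi> Y)"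
        "s < dim_col (act_left m n b \<Phi> X + act_left m n b \<Phi> Y)"
      then have rs: "r < n * b" "s < n * b" by (simp_all add: act_left_def)
      then have b: "b > 0" by (cases b) auto
      have "?blk (X + Y) r s = ?blk X r s + ?blk Y r s"
        using X Y b by (intro eq_matI) (auto simp: mult_add_less)
      then have "\<Phi> (?blk (X + Y) r s) = \<Phi> (?blk X r s) + \<Phi> (?blk Y r s)"
        using assms by (simp add: linear_op_def)
      then show "act_left m n b \<Phi> (X + Y) $$ (r, s) = (act_left m n b \<Phi> X + act_left m n b \<Phi> Y) $$ (r, s)"
        using rs carrier_matD[OF car] by (simp add: act_left_def less_mult_imp_div_less)
    qed (simp_all add: act_left_def)
  next
    fix c and X :: "complex mat" assume X: "X \<in> carrier_mat (m * b) (m * b)"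
    show "act_left m n b \<Phi> (c \<cdot>\<^sub>m X) = c \<cdot>\<^sub>m act_left m n b \<Phi> X"
    proof (rule eq_matI)
      fix r s assume rs: "r < dim_row (c \<cdot>\<^sub>m act_left m n b \<Phi> X)" "s < dim_col (c \<cdot>\<^sub>m act_left m n b \<Phi> X)"
      then have rs: "r < n * b" "s < n * b" by (simp_all add: act_left_def)
      then have b: "b > 0" by (cases b) auto
      have "?blk (c \<cdot>\<^sub>m X) r s = c \<cdot>\<^sub>m ?blk X r s"
        using X b by (intro eq_matI) (auto simp: mult_add_less)
      then have "\<Phi> (?blk (c \<cdot>\<^sub>m X) r s) = c \<cdot>\<^sub>m \<Phi> (?blk X r s)"
        using assms by (simp add: linear_op_def)
      then show "act_left m n b \<Phi> (c \<cdot>\<^sub>m X) $$ (r, s) = (c \<cdot>\<^sub>m act_left m n b \<Phi> X) $$ (r, s)"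
        using rs carrier_matD[OF car] by (simp add: act_left_def less_mult_imp_div_less)
    qed (simp_all add: act_left_def)
  qed (simp add: act_left_def)
qed

section \<open>Exchange of the tensor factors\<close>

definition swap_index :: "nat \<Rightarrow> nat \<Rightarrow> nat \<Rightarrow> nat" where
  "swap_index a m r = (r mod a) * m + r div a"

definition swap_mat :: "nat \<Rightarrow> nat \<Rightarrow> complex mat \<Rightarrow> complex mat" where
  "swap_mat a m X = mat (m * a) (m * a) (\<lambda>(r, s). X $$ (swap_index a m r, swap_index a m s))"

lemma swap_index_less: "r < m * a \<Longrightarrow> swap_index a m r < a * m"
  unfolding swap_index_def by (cases "a = 0") (auto intro!: mult_add_less simp: less_mult_imp_div_less)

lemma swap_index_swap_index: "r < m * a \<Longrightarrow> swap_index m a (swap_index a m r) = r"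
  by (cases "m = 0") (auto simp: swap_index_def less_mult_imp_div_less mult.commute)

lemma bij_swap_index: "bij_betw (swap_index a m) {..<m * a} {..<m * a}"
proof (rule bij_betw_byWitness[of _ "swap_index m a"])
  show "\<forall>r\<in>{..<m * a}. swap_index m a (swap_index a m r) = r"
    by (simp add: swap_index_swap_index)
  show "\<forall>r\<in>{..<m * a}. swap_index a m (swap_index m a r) = r"
    using swap_index_swap_index[of _ a m] by (simp add: mult.commute[of m a])
  show "swap_index a m ` {..<m * a} \<subseteq> {..<m * a}"
    using swap_index_less[of _ m a] by (auto simp: mult.commute[of a m])
  show "swap_index m a ` {..<m * a} \<subseteq> {..<m * a}"
    using swap_index_less[of _ a m] by (auto simp: mult.commute[of a m])
qed

lemma psd_swap_mat: "psd (a * m) X \<Longrightarrow> psd (m * a) (swap_mat a m X)"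
  unfolding swap_mat_def by (intro psd_permute bij_swap_index) (simp add: mult.commute)

lemma linear_op_swap_mat: "linear_op (a * m) (m * a) (swap_mat a m)"
  unfolding linear_op_def swap_mat_def
  by (auto intro!: eq_matI simp: swap_index_less)

text \<open>Complete positivity is stated with the ancilla on the right only. Conjugation with the
  exchange of factors carries linearity and positivity over to Bob's side.\<close>

lemma act_right_conv_act_left:
  "act_right a m n \<Phi> X = swap_mat n a (act_left m n a \<Phi> (swap_mat a m X))"
proof (rule eq_matI)
  fix r s assume "r < dim_row (swap_mat n a (act_left m n a \<Phi> (swap_mat a m X)))"
    "s < dim_col (swap_mat n a (act_left m n a \<Phi> (swap_mat a m X)))"
  then have rs: "r < a * n" "s < a * n" by (simp_all add: swap_mat_def)
  then have n: "n > 0" by (cases n) auto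
  have d: "r div n < a" "s div n < a" using rs by (auto simp: less_mult_imp_div_less)
  have "mat m m (\<lambda>(i, k). swap_mat a m X $$ (i * a + r div n, k * a + s div n)) =
      mat m m (\<lambda>(i, k). X $$ ((r div n) * m + i, (s div n) * m + k))"
    using d by (intro eq_matI) (auto simp: swap_mat_def swap_index_def mult_add_less)
  then show "act_right a m n \<Phi> X $$ (r, s) = swap_mat n a (act_left m n a \<Phi> (swap_mat a m X)) $$ (r, s)"
    using rs n d by (simp add: act_right_def swap_mat_def[of n a] act_left_def swap_index_def mult_add_less)
qed (simp_all add: act_right_def swap_mat_def)

lemma linear_op_comp: "linear_op m n F \<Longrightarrow> linear_op n k G \<Longrightarrow> linear_op m k (\<lambda>X. G (F X))"
  by (simp add: linear_op_def)

lemma linear_op_act_right: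
  assumes "linear_op m n \<Phi>" shows "linear_op (a * m) (a * n) (act_right a m n \<Phi>)"
  unfolding act_right_conv_act_left[abs_def]
  by (rule linear_op_comp[OF _ linear_op_swap_mat],
      rule linear_op_comp[OF linear_op_swap_mat linear_op_act_left[OF assms]])

lemma psd_act_right:
  assumes "completely_positive m n \<Phi>" "psd (a * m) X" shows "psd (a * n) (act_right a m n \<Phi> X)"
  unfolding act_right_conv_act_left
  using assms by (intro psd_swap_mat) (auto simp: completely_positive_def intro: psd_swap_mat)

lemma linear_op_mat_sum_pointwise:
  assumes "\<And>k. k < r \<Longrightarrow> linear_op m n (F k)" shows "linear_op m n (\<lambda>X. mat_sum n (\<lambda>k. F k X) r)"
  unfolding linear_op_def
proof (intro conjI ballI allI)
  fix X Y :: "complex mat" assume X: "X \<in> carrier_mat m m" and Y: "Y \<in> carrier_mat m m"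
  have "F k (X + Y) $$ (i, j) = F k X $$ (i, j) + F k Y $$ (i, j)" if "k < r" "i < n" "j < n" for k i j
  proof -
    have "F k (X + Y) = F k X + F k Y" "F k Y \<in> carrier_mat n n"
      using assms[OF that(1)] X Y unfolding linear_op_def by blast+
    then show ?thesis using that by simp
  qed
  then show "mat_sum n (\<lambda>k. F k (X + Y)) r = mat_sum n (\<lambda>k. F k X) r + mat_sum n (\<lambda>k. F k Y) r"
    by (intro eq_matI) (simp_all add: mat_sum_def sum.distrib)
next
  fix c and X :: "complex mat" assume X: "X \<in> carrier_mat m m"
  have "F k (c \<cdot>\<^sub>m X) $$ (i, j) = c * F k X $$ (i, j)" if "k < r" "i < n" "j < n" for k i j
  proof -
    have "F k (c \<cdot>\<^sub>m X) = c \<cdot>\<^sub>m F k X" "F k X \<in> carrier_mat n n"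
      using assms[OF that(1)] X unfolding linear_op_def by blast+
    then show ?thesis using that by simp
  qed
  then show "mat_sum n (\<lambda>k. F k (c \<cdot>\<^sub>m X)) r = c \<cdot>\<^sub>m mat_sum n (\<lambda>k. F k X) r"
    by (intro eq_matI) (simp_all add: mat_sum_def sum_distrib_left)
qed (simp add: mat_sum_def)

lemma locc_linear: "locc a b c d \<Lambda> \<Longrightarrow> linear_op (a * b) (c * d) \<Lambda>"
proof (induction rule: locc.induct)
  case (stop a b)
  then show ?case by (simp add: linear_op_def)
next
  case (alice a a' r \<Phi> b c d \<Psi>)
  then show ?case
    by (intro linear_op_mat_sum_pointwise linear_op_comp[OF linear_op_act_left])
      (auto simp: instrument_def completely_positive_def)
next
  case (bob b b' r \<Phi> a c d \<Psi>)
  then show ?case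
    by (intro linear_op_mat_sum_pointwise linear_op_comp[OF linear_op_act_right])
      (auto simp: instrument_def completely_positive_def)
qed

lemma locc_psd: "locc a b c d \<Lambda> \<Longrightarrow> psd (a * b) X \<Longrightarrow> psd (c * d) (\<Lambda> X)"
proof (induction arbitrary: X rule: locc.induct)
  case (alice a a' r \<Phi> b c d \<Psi>)
  then show ?case by (intro psd_mat_sum alice.IH) (auto simp: instrument_def completely_positive_def)
next
  case (bob b b' r \<Phi> a c d \<Psi>)
  then show ?case by (intro psd_mat_sum bob.IH psd_act_right) (auto simp: instrument_def)
qed simp

lemma linear_op_mat_sum:
  assumes L: "linear_op m n \<Lambda>" and F: "\<And>k. k < r \<Longrightarrow> F k \<in> carrier_mat m m"
  shows "\<Lambda> (mat_sum m F r) = mat_sum n (\<lambda>k. \<Lambda> (F k)) r"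
  using F
proof (induction r)
  case 0
  define Z where "Z = mat_sum m F 0"
  have Z: "Z \<in> carrier_mat m m" by (simp add: Z_def mat_sum_def)
  \<comment> \<open>The empty sum is the zero matrix, and its image is zero by homogeneity with the
    scalar 0.\<close>
  have "Z = 0 \<cdot>\<^sub>m Z" by (intro eq_matI) (auto simp: Z_def mat_sum_def)
  moreover have "\<Lambda> (0 \<cdot>\<^sub>m Z) = 0 \<cdot>\<^sub>m \<Lambda> Z" using L Z unfolding linear_op_def by blast
  ultimately have z: "\<Lambda> Z = 0 \<cdot>\<^sub>m \<Lambda> Z" by simp
  have car: "\<Lambda> Z \<in> carrier_mat n n" using L Z by (simp add: linear_op_def)
  have "\<Lambda> Z $$ (i, j) = 0" if "i < n" "j < n" for i j
    by (subst z) (use car that in simp)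
  then show ?case unfolding Z_def[symmetric] using car by (intro eq_matI) (auto simp: mat_sum_def)
next
  case (Suc r)
  have "mat_sum m F (Suc r) = mat_sum m F r + F r"
    using Suc.prems[of r] by (intro eq_matI) (auto simp: mat_sum_def)
  then have "\<Lambda> (mat_sum m F (Suc r)) = \<Lambda> (mat_sum m F r) + \<Lambda> (F r)"
    using L Suc.prems[of r] by (simp add: linear_op_def mat_sum_def)
  moreover have "\<Lambda> (F r) \<in> carrier_mat n n" using L Suc.prems[of r] by (simp add: linear_op_def)
  ultimately show ?case using Suc by (intro eq_matI) (auto simp: mat_sum_def)
qed

text \<open>Complete positivity is applied with an ancilla of dimension one.\<close>

lemma psd_completely_positive:
  assumes "completely_positive m n \<Phi>" "psd m X" shows "psd n (\<Phi> X)"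
proof -
  have X: "X \<in> carrier_mat m m" using assms(2) by (simp add: psd_def)
  have "mat m m (\<lambda>(i, k). X $$ (i, k)) = X" using X by (intro eq_matI) auto
  moreover have "\<Phi> X \<in> carrier_mat n n" using assms(1) X by (simp add: completely_positive_def linear_op_def)
  ultimately have "act_left m n 1 \<Phi> X = \<Phi> X" by (intro eq_matI) (auto simp: act_left_def)
  moreover have "psd (m * 1) X" using assms(2) by simp
  then have "psd (n * 1) (act_left m n 1 \<Phi> X)"
    using assms(1) \<open>psd (m * 1) X\<close> unfolding completely_positive_def by blast
  ultimately show ?thesis by simp
qed

text \<open>Every outcome leaves a product operator, and trace preservation of the instrument makes
  the branch traces add up. Stated for unnormalized factors, the bound carries the outcome
  probabilities in the traces, so the final state need not be decomposed.\<close>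

lemma locc_product_bound:
  assumes "locc a b c d \<Lambda>" "psd a \<sigma>" "psd b \<tau>" and \<psi>: "\<psi> \<in> carrier_vec (c * d)"
    and bound: "\<And>\<sigma> \<tau>. psd c \<sigma> \<Longrightarrow> psd d \<tau> \<Longrightarrow>
      Re ((tensor_mat \<sigma> \<tau> *\<^sub>v \<psi>) \<bullet>c \<psi>) \<le> Re (mat_trace \<sigma>) * Re (mat_trace \<tau>) / 2"
  shows "Re ((\<Lambda> (tensor_mat \<sigma> \<tau>) *\<^sub>v \<psi>) \<bullet>c \<psi>) \<le> Re (mat_trace \<sigma>) * Re (mat_trace \<tau>) / 2"
  using assms
proof (induction arbitrary: \<sigma> \<tau> rule: locc.induct)
  case (stop a b)
  then show ?case by simp
next
  case (alice a a' r \<Phi> b c d \<Psi>)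
  have cp: "completely_positive a a' (\<Phi> k)" if "k < r" for k
    using alice.hyps(1) that by (simp add: instrument_def)
  have car: "\<sigma> \<in> carrier_mat a a" "\<tau> \<in> carrier_mat b b" using alice.prems by (simp_all add: psd_def)
  have act: "act_left a a' b (\<Phi> k) (tensor_mat \<sigma> \<tau>) = tensor_mat (\<Phi> k \<sigma>) \<tau>" if "k < r" for k
    using cp[OF that] car by (intro act_left_tensor) (auto simp: completely_positive_def)
  have p: "psd a' (\<Phi> k \<sigma>)" if "k < r" for k
    by (rule psd_completely_positive[OF cp[OF that] alice.prems(1)])
  have carr: "\<Psi> k (tensor_mat (\<Phi> k \<sigma>) \<tau>) \<in> carrier_mat (c * d) (c * d)" if "k < r" for k
    using locc_linear[OF alice.hyps(2)[OF that]] p[OF that] car(2)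
    by (auto simp: linear_op_def psd_def tensor_mat_def)
  have "Re ((mat_sum (c * d) (\<lambda>k. \<Psi> k (act_left a a' b (\<Phi> k) (tensor_mat \<sigma> \<tau>))) r *\<^sub>v \<psi>) \<bullet>c \<psi>) =
      (\<Sum>k<r. Re ((\<Psi> k (tensor_mat (\<Phi> k \<sigma>) \<tau>) *\<^sub>v \<psi>) \<bullet>c \<psi>))"
    using carr alice.prems(3) by (subst scalar_prod_mat_sum) (auto simp: act)
  also have "\<dots> \<le> (\<Sum>k<r. Re (mat_trace (\<Phi> k \<sigma>)) * Re (mat_trace \<tau>) / 2)"
    using alice.IH p alice.prems by (intro sum_mono) auto
  also have "\<dots> = Re (\<Sum>k<r. mat_trace (\<Phi> k \<sigma>)) * Re (mat_trace \<tau>) / 2"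
    by (simp add: sum_distrib_right sum_divide_distrib)
  also have "(\<Sum>k<r. mat_trace (\<Phi> k \<sigma>)) = mat_trace \<sigma>"
    using alice.hyps(1) car(1) by (simp add: instrument_def)
  finally show ?case .
next
  case (bob b b' r \<Phi> a c d \<Psi>)
  have cp: "completely_positive b b' (\<Phi> k)" if "k < r" for k
    using bob.hyps(1) that by (simp add: instrument_def)
  have car: "\<sigma> \<in> carrier_mat a a" "\<tau> \<in> carrier_mat b b" using bob.prems by (simp_all add: psd_def)
  have act: "act_right a b b' (\<Phi> k) (tensor_mat \<sigma> \<tau>) = tensor_mat \<sigma> (\<Phi> k \<tau>)" if "k < r" for k
    using cp[OF that] car by (intro act_right_tensor) (auto simp: completely_positive_def)
  have p: "psd b' (\<Phi> k \<tau>)" if "k < r" for k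
    by (rule psd_completely_positive[OF cp[OF that] bob.prems(2)])
  have carr: "\<Psi> k (tensor_mat \<sigma> (\<Phi> k \<tau>)) \<in> carrier_mat (c * d) (c * d)" if "k < r" for k
    using locc_linear[OF bob.hyps(2)[OF that]] p[OF that] car(1)
    by (auto simp: linear_op_def psd_def tensor_mat_def)
  have "Re ((mat_sum (c * d) (\<lambda>k. \<Psi> k (act_right a b b' (\<Phi> k) (tensor_mat \<sigma> \<tau>))) r *\<^sub>v \<psi>) \<bullet>c \<psi>) =
      (\<Sum>k<r. Re ((\<Psi> k (tensor_mat \<sigma> (\<Phi> k \<tau>)) *\<^sub>v \<psi>) \<bullet>c \<psi>))"
    using carr bob.prems(3) by (subst scalar_prod_mat_sum) (auto simp: act)
  also have "\<dots> \<le> (\<Sum>k<r. Re (mat_trace \<sigma>) * Re (mat_trace (\<Phi> k \<tau>)) / 2)"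
    using bob.IH p bob.prems by (intro sum_mono) auto
  also have "\<dots> = Re (mat_trace \<sigma>) * Re (\<Sum>k<r. mat_trace (\<Phi> k \<tau>)) / 2"
    by (simp add: sum_distrib_left sum_divide_distrib)
  also have "(\<Sum>k<r. mat_trace (\<Phi> k \<tau>)) = mat_trace \<tau>"
    using bob.hyps(1) car(2) by (simp add: instrument_def)
  finally show ?case .
qed

lemma tensor_mat_carrier:
  "A \<in> carrier_mat a a \<Longrightarrow> B \<in> carrier_mat b b \<Longrightarrow> tensor_mat A B \<in> carrier_mat (a * b) (a * b)"
  by (auto simp: tensor_mat_def)

lemma locc_mixture_bound:
  assumes L: "locc a b c d \<Lambda>" and \<psi>: "\<psi> \<in> carrier_vec (c * d)"
    and bound: "\<And>\<sigma> \<tau>. psd c \<sigma> \<Longrightarrow> psd d \<tau> \<Longrightarrow>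
      Re ((tensor_mat \<sigma> \<tau> *\<^sub>v \<psi>) \<bullet>c \<psi>) \<le> Re (mat_trace \<sigma>) * Re (mat_trace \<tau>) / 2"
    and p: "0 \<le> p" "p < 1" and \<rho>: "\<rho> \<in> carrier_mat (a * b) (a * b)" and Z: "psd (a * b) \<rho>Z"
    and sep: "separable a b (complex_of_real (1 - p) \<cdot>\<^sub>m \<rho> + complex_of_real p \<cdot>\<^sub>m \<rho>Z)"
  shows "Re ((\<Lambda> \<rho> *\<^sub>v \<psi>) \<bullet>c \<psi>) \<le> 1 / (2 * (1 - p))"
proof -
  have lin: "linear_op (a * b) (c * d) \<Lambda>" by (rule locc_linear[OF L])
  obtain r q \<sigma> \<tau> where q: "\<And>k. k < r \<Longrightarrow> 0 \<le> q k \<and> is_state a (\<sigma> k) \<and> is_state b (\<tau> k)"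
    "(\<Sum>k<r. q k) = (1 :: real)"
    "complex_of_real (1 - p) \<cdot>\<^sub>m \<rho> + complex_of_real p \<cdot>\<^sub>m \<rho>Z =
      mat_sum (a * b) (\<lambda>k. complex_of_real (q k) \<cdot>\<^sub>m tensor_mat (\<sigma> k) (\<tau> k)) r"
    using sep unfolding separable_def by blast
  have T: "tensor_mat (\<sigma> k) (\<tau> k) \<in> carrier_mat (a * b) (a * b)" if "k < r" for k
    using q(1)[OF that] by (intro tensor_mat_carrier) (auto simp: is_state_def psd_def)
  have Zc: "\<rho>Z \<in> carrier_mat (a * b) (a * b)" using Z by (simp add: psd_def)
  have form_smult: "((z \<cdot>\<^sub>m X) *\<^sub>v \<psi>) \<bullet>c \<psi> = z * ((X *\<^sub>v \<psi>) \<bullet>c \<psi>)" if "X \<in> carrier_mat (c * d) (c * d)" for z X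
    using scalar_prod_form[of "z \<cdot>\<^sub>m X" "c * d" \<psi>] scalar_prod_form[of X "c * d" \<psi>] that \<psi>
    by (simp add: sum_distrib_left mult.left_commute mult.assoc)
  have form_add: "((X + Y) *\<^sub>v \<psi>) \<bullet>c \<psi> = (X *\<^sub>v \<psi>) \<bullet>c \<psi> + (Y *\<^sub>v \<psi>) \<bullet>c \<psi>"
    if "X \<in> carrier_mat (c * d) (c * d)" "Y \<in> carrier_mat (c * d) (c * d)" for X Y
    using scalar_prod_form[of "X + Y" "c * d" \<psi>] scalar_prod_form[of X "c * d" \<psi>]
      scalar_prod_form[of Y "c * d" \<psi>] that \<psi>
    by (simp add: sum.distrib distrib_left distrib_right)
  have LX: "\<Lambda> X \<in> carrier_mat (c * d) (c * d)" if "X \<in> carrier_mat (a * b) (a * b)" for X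
    using lin that by (simp add: linear_op_def)
  have "\<Lambda> (complex_of_real (1 - p) \<cdot>\<^sub>m \<rho> + complex_of_real p \<cdot>\<^sub>m \<rho>Z) =
      complex_of_real (1 - p) \<cdot>\<^sub>m \<Lambda> \<rho> + complex_of_real p \<cdot>\<^sub>m \<Lambda> \<rho>Z"
    using lin \<rho> Zc by (simp add: linear_op_def)
  then have "Re ((\<Lambda> (complex_of_real (1 - p) \<cdot>\<^sub>m \<rho> + complex_of_real p \<cdot>\<^sub>m \<rho>Z) *\<^sub>v \<psi>) \<bullet>c \<psi>) =
      (1 - p) * Re ((\<Lambda> \<rho> *\<^sub>v \<psi>) \<bullet>c \<psi>) + p * Re ((\<Lambda> \<rho>Z *\<^sub>v \<psi>) \<bullet>c \<psi>)"
    using LX[OF \<rho>] LX[OF Zc] by (simp add: form_add form_smult)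
  \<comment> \<open>Dropping this term turns the bound on the mixture into one on (1 - p) times the
    value for \<rho>.\<close>
  moreover have "0 \<le> Re ((\<Lambda> \<rho>Z *\<^sub>v \<psi>) \<bullet>c \<psi>)"
    using locc_psd[OF L Z] \<psi> by (simp add: psd_def less_eq_complex_def)
  then have "0 \<le> p * Re ((\<Lambda> \<rho>Z *\<^sub>v \<psi>) \<bullet>c \<psi>)" using p(1) by simp
  moreover have "Re ((\<Lambda> (complex_of_real (1 - p) \<cdot>\<^sub>m \<rho> + complex_of_real p \<cdot>\<^sub>m \<rho>Z) *\<^sub>v \<psi>) \<bullet>c \<psi>) \<le> 1 / 2"
  proof -
    have "\<Lambda> (mat_sum (a * b) (\<lambda>k. complex_of_real (q k) \<cdot>\<^sub>m tensor_mat (\<sigma> k) (\<tau> k)) r) =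
        mat_sum (c * d) (\<lambda>k. \<Lambda> (complex_of_real (q k) \<cdot>\<^sub>m tensor_mat (\<sigma> k) (\<tau> k))) r"
      using T by (intro linear_op_mat_sum[OF lin]) simp
    moreover have "Re ((mat_sum (c * d) (\<lambda>k. \<Lambda> (complex_of_real (q k) \<cdot>\<^sub>m tensor_mat (\<sigma> k) (\<tau> k))) r *\<^sub>v \<psi>) \<bullet>c \<psi>)
        = (\<Sum>k<r. Re ((\<Lambda> (complex_of_real (q k) \<cdot>\<^sub>m tensor_mat (\<sigma> k) (\<tau> k)) *\<^sub>v \<psi>) \<bullet>c \<psi>))"
      using T LX \<psi> by (subst scalar_prod_mat_sum) auto
    moreover have "\<dots> \<le> (\<Sum>k<r. q k / 2)"
    proof (rule sum_mono)
      fix k assume "k \<in> {..<r}"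
      then have k: "k < r" by simp
      have "\<Lambda> (complex_of_real (q k) \<cdot>\<^sub>m tensor_mat (\<sigma> k) (\<tau> k)) = complex_of_real (q k) \<cdot>\<^sub>m \<Lambda> (tensor_mat (\<sigma> k) (\<tau> k))"
        using lin T[OF k] by (simp add: linear_op_def)
      then have "Re ((\<Lambda> (complex_of_real (q k) \<cdot>\<^sub>m tensor_mat (\<sigma> k) (\<tau> k)) *\<^sub>v \<psi>) \<bullet>c \<psi>) =
          q k * Re ((\<Lambda> (tensor_mat (\<sigma> k) (\<tau> k)) *\<^sub>v \<psi>) \<bullet>c \<psi>)"
        using LX[OF T[OF k]] by (simp add: form_smult)
      also have "\<dots> \<le> q k * (Re (mat_trace (\<sigma> k)) * Re (mat_trace (\<tau> k)) / 2)"
        using q(1)[OF k] by (intro mult_left_mono locc_product_bound[OF L _ _ \<psi> bound]) (auto simp: is_state_def)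
      also have "\<dots> = q k / 2" using q(1)[OF k] by (simp add: is_state_def)
      finally show "Re ((\<Lambda> (complex_of_real (q k) \<cdot>\<^sub>m tensor_mat (\<sigma> k) (\<tau> k)) *\<^sub>v \<psi>) \<bullet>c \<psi>) \<le> q k / 2" .
    qed
    moreover have "(\<Sum>k<r. q k / 2) = 1 / 2" using q(2) by (simp add: sum_divide_distrib[symmetric])
    ultimately show ?thesis unfolding q(3) by simp
  qed
  ultimately have "(1 - p) * Re ((\<Lambda> \<rho> *\<^sub>v \<psi>) \<bullet>c \<psi>) \<le> 1 / 2" by linarith
  then show ?thesis using p(2) by (simp add: field_simps)
qed

section \<open>Two-qubit matrices\<close>

lemma sum_lessThan_2: "(\<Sum>i<2. f i) = f 0 + f (Suc 0)"
  by (simp add: numeral_2_eq_2)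

lemma sum_lessThan_4: "(\<Sum>i<4. f i) = f 0 + f (Suc 0) + f 2 + f 3"
  by (simp add: eval_nat_numeral)

lemma nat_less_2_cases: "(i::nat) < 2 \<Longrightarrow> i = 0 \<or> i = Suc 0"
  by linarith

lemma nat_less_4_cases: "(i::nat) < 4 \<Longrightarrow> i = 0 \<or> i = Suc 0 \<or> i = 2 \<or> i = 3"
  by linarith

text \<open>Start of the dictionary between matrices and operators on bits: the pair (i, j) will get
  the index 2 i + j of the tensor convention.\<close>

definition bit_index :: "bool \<Rightarrow> nat" where
  "bit_index b = (if b then 1 else 0)"

definition pair_index :: "pair \<Rightarrow> nat" where
  "pair_index r = 2 * bit_index (fst r) + bit_index (snd r)"

definition index_bit :: "nat \<Rightarrow> bool" where
  "index_bit n \<longleftrightarrow> n = 1"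

definition index_pair :: "nat \<Rightarrow> pair" where
  "index_pair n = (index_bit (n div 2), index_bit (n mod 2))"

lemmas index_defs = bit_index_def pair_index_def index_bit_def index_pair_def

lemma bij_index_bit: "bij_betw index_bit {..<2} UNIV"
  by (rule bij_betw_byWitness[of _ bit_index]) (auto simp: index_defs dest: nat_less_2_cases)

lemma bij_index_pair: "bij_betw index_pair {..<4} UNIV"
  by (rule bij_betw_byWitness[of _ pair_index]) (auto simp: index_defs dest!: nat_less_4_cases)

definition bit_op :: "complex mat \<Rightarrow> bool \<Rightarrow> bool \<Rightarrow> complex" where
  "bit_op A = (\<lambda>i j. A $$ (bit_index i, bit_index j))"

definition pair_op :: "complex mat \<Rightarrow> pair \<Rightarrow> pair \<Rightarrow> complex" where
  "pair_op A = (\<lambda>r s. A $$ (pair_index r, pair_index s))"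

definition bit_mat :: "(bool \<Rightarrow> bool \<Rightarrow> complex) \<Rightarrow> complex mat" where
  "bit_mat X = mat 2 2 (\<lambda>(i, j). X (index_bit i) (index_bit j))"

definition pair_mat :: "(pair \<Rightarrow> pair \<Rightarrow> complex) \<Rightarrow> complex mat" where
  "pair_mat X = mat 4 4 (\<lambda>(i, j). X (index_pair i) (index_pair j))"

lemma bit_mat_bit_op: "A \<in> carrier_mat 2 2 \<Longrightarrow> bit_mat (bit_op A) = A"
  by (intro eq_matI) (auto simp: bit_mat_def bit_op_def index_defs dest!: nat_less_2_cases)

lemma pair_mat_pair_op: "A \<in> carrier_mat 4 4 \<Longrightarrow> pair_mat (pair_op A) = A"
  by (intro eq_matI) (auto simp: pair_mat_def pair_op_def index_defs dest!: nat_less_4_cases)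

lemma psd_reindex:
  assumes e: "bij_betw e {..<n} (UNIV :: 'i::finite set)"
  shows "psd n (mat n n (\<lambda>(i, j). X (e i) (e j))) \<longleftrightarrow> pos X"
proof -
  have form: "(\<Sum>i<n. \<Sum>j<n. cnj (v (e i)) * mat n n (\<lambda>(i, j). X (e i) (e j)) $$ (i, j) * v (e j)) = sesq X v v" for v
  proof -
    have "(\<Sum>i<n. \<Sum>j<n. cnj (v (e i)) * mat n n (\<lambda>(i, j). X (e i) (e j)) $$ (i, j) * v (e j)) =
      (\<Sum>i<n. \<Sum>j<n. cnj (v (e i)) * X (e i) (e j) * v (e j))"
      by (intro sum.cong refl) simp
    also have "\<dots> = (\<Sum>i<n. \<Sum>s\<in>UNIV. cnj (v (e i)) * X (e i) s * v s)"
      by (intro sum.cong refl sum.reindex_bij_betw[OF e])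
    also have "\<dots> = sesq X v v" unfolding sesq_def by (rule sum.reindex_bij_betw[OF e])
    finally show ?thesis .
  qed
  show ?thesis
  proof
    assume "psd n (mat n n (\<lambda>(i, j). X (e i) (e j)))"
    then have "0 \<le> (\<Sum>i<n. \<Sum>j<n. cnj (v (e i)) * mat n n (\<lambda>(i, j). X (e i) (e j)) $$ (i, j) * v (e j))" for v
      using spec[of _ "\<lambda>i. v (e i)"] unfolding psd_iff by auto
    then show "pos X" unfolding form pos_def by blast
  next
    assume X: "pos X"
    show "psd n (mat n n (\<lambda>(i, j). X (e i) (e j)))"
      unfolding psd_iff
    proof (intro conjI allI)
      fix v :: "nat \<Rightarrow> complex"
      define w where "w r = v (inv_into {..<n} e r)" for r
      have "w (e i) = v i" if "i < n" for i using e that by (simp add: w_def bij_betw_def)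
      then have "(\<Sum>i<n. \<Sum>j<n. cnj (v i) * mat n n (\<lambda>(i, j). X (e i) (e j)) $$ (i, j) * v j) = sesq X w w"
        unfolding form[of w, symmetric] by (intro sum.cong refl) simp
      then show "0 \<le> (\<Sum>i<n. \<Sum>j<n. cnj (v i) * mat n n (\<lambda>(i, j). X (e i) (e j)) $$ (i, j) * v j)"
        using X by (simp add: pos_def)
    qed simp
  qed
qed

lemma psd_bit_mat: "psd 2 (bit_mat X) \<longleftrightarrow> pos X"
  unfolding bit_mat_def by (rule psd_reindex[OF bij_index_bit])

lemma psd_pair_mat: "psd 4 (pair_mat X) \<longleftrightarrow> pos X"
  unfolding pair_mat_def by (rule psd_reindex[OF bij_index_pair])

lemma pos_bit_op: "psd 2 A \<Longrightarrow> pos (bit_op A)"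
  using psd_bit_mat[of "bit_op A"] by (simp add: bit_mat_bit_op psd_def)

lemma pos_pair_op: "psd 4 A \<Longrightarrow> pos (pair_op A)"
  using psd_pair_mat[of "pair_op A"] by (simp add: pair_mat_pair_op psd_def)

lemma mat_trace_bit_mat: "mat_trace (bit_mat X) = (\<Sum>r\<in>UNIV. X r r)"
  by (simp add: mat_trace_def bit_mat_def sum_lessThan_2 sum_bool index_defs)

lemma mat_trace_pair_mat: "mat_trace (pair_mat X) = (\<Sum>r\<in>UNIV. X r r)"
  by (simp add: mat_trace_def pair_mat_def sum_lessThan_4 sum_pair index_defs)

lemma pos_trace_real: "pos X \<Longrightarrow> (\<Sum>r\<in>UNIV. X r r) = complex_of_real (rtr X)"
  using pos_diag[of X] unfolding rtr_def of_real_sum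
  by (intro sum.cong refl) (simp add: less_eq_complex_def complex_eq_iff)

lemma is_state_bit_mat: "pos X \<Longrightarrow> rtr X = 1 \<Longrightarrow> is_state 2 (bit_mat X)"
  by (simp add: is_state_def psd_bit_mat mat_trace_bit_mat pos_trace_real)

lemma is_state_pair_mat: "pos X \<Longrightarrow> rtr X = 1 \<Longrightarrow> is_state 4 (pair_mat X)"
  by (simp add: is_state_def psd_pair_mat mat_trace_pair_mat pos_trace_real)

lemma tensor_mat_bit_mat: "tensor_mat (bit_mat A) (bit_mat B) = pair_mat (tens A B)"
  by (intro eq_matI) (auto simp: tensor_mat_def bit_mat_def pair_mat_def tens_def index_defs dest!: nat_less_4_cases)

lemma pair_mat_add: "pair_mat (\<lambda>r s. X r s + Y r s) = pair_mat X + pair_mat Y"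
  by (intro eq_matI) (auto simp: pair_mat_def)

lemma pair_mat_smult: "pair_mat (\<lambda>r s. c * X r s) = c \<cdot>\<^sub>m pair_mat X"
  by (intro eq_matI) (auto simp: pair_mat_def)

lemma rtr_tens: "pos A \<Longrightarrow> pos B \<Longrightarrow> rtr (tens A B) = rtr A * rtr B"
  using pos_diag[of A] pos_diag[of B]
  by (simp add: rtr_def tens_def sum_prod_UNIV sum_product less_eq_complex_def)

lemma sum_append:
  "(\<Sum>k<m + n. if k < m then f k else g (k - m)) = (\<Sum>k<m. f k) + (\<Sum>k<n::nat. g k :: 'a::comm_monoid_add)"
  by (induction n) (simp_all add: add.assoc)

text \<open>Each product is divided by the traces of its factors, which become its weight. The
  weights sum to the trace rather than to one, a form that is stable under the addition
  rule.\<close>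

lemma sepc_decomposition:
  fixes X :: "pair \<Rightarrow> pair \<Rightarrow> complex"
  assumes "sepc X"
  shows "\<exists>r (q :: nat \<Rightarrow> real) \<sigma> \<tau>. (\<forall>k<r. 0 \<le> q k \<and> is_state 2 (\<sigma> k) \<and> is_state 2 (\<tau> k)) \<and> (\<Sum>k<r. q k) = rtr X \<and>
    pair_mat X = mat_sum (2 * 2) (\<lambda>k. complex_of_real (q k) \<cdot>\<^sub>m tensor_mat (\<sigma> k) (\<tau> k)) r"
  using assms
proof (induction rule: sepc.induct)
  case (sepc_tens A B)
  show ?case
  proof (cases "rtr A = 0 \<or> rtr B = 0")
    \<comment> \<open>A positive factor of trace zero vanishes and cannot be normalized; the empty
      sum represents the product.\<close>
    case True
    have "tens A B r s = 0" for r s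
      using True pos_entry_le_rtr[OF sepc_tens(1), of "fst r" "fst s"] pos_entry_le_rtr[OF sepc_tens(2), of "snd r" "snd s"]
      by (auto simp: tens_def)
    then have "pair_mat (tens A B) = mat_sum (2 * 2) F 0" for F
      by (intro eq_matI) (auto simp: pair_mat_def mat_sum_def)
    moreover have "rtr (tens A B) = 0" using True by (auto simp: rtr_tens[OF sepc_tens])
    ultimately show ?thesis by (intro exI[of _ 0]) simp
  next
    case False
    then have p: "0 < rtr A" "0 < rtr B"
      using pos_rtr_nonneg[OF sepc_tens(1)] pos_rtr_nonneg[OF sepc_tens(2)] by auto
    have st: "is_state 2 (bit_mat (\<lambda>i j. complex_of_real (1 / rtr C) * C i j))" if "pos C" "0 < rtr C" for C
    proof (rule is_state_bit_mat)
      show "pos (\<lambda>i j. complex_of_real (1 / rtr C) * C i j)"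
        using that by (intro pos_scale) (simp_all add: less_eq_complex_def)
      show "rtr (\<lambda>i j. complex_of_real (1 / rtr C) * C i j) = 1"
        unfolding rtr_scale using that by simp
    qed
    define \<sigma> \<tau> where "\<sigma> = bit_mat (\<lambda>i j. complex_of_real (1 / rtr A) * A i j)"
      and "\<tau> = bit_mat (\<lambda>i j. complex_of_real (1 / rtr B) * B i j)"
    have "pair_mat (tens A B) = complex_of_real (rtr A * rtr B) \<cdot>\<^sub>m tensor_mat \<sigma> \<tau>"
      unfolding \<sigma>_def \<tau>_def tensor_mat_bit_mat pair_mat_smult[symmetric]
      using p by (simp add: tens_def)
    moreover have "\<dots> = mat_sum (2 * 2) (\<lambda>k. complex_of_real (rtr A * rtr B) \<cdot>\<^sub>m tensor_mat \<sigma> \<tau>) 1"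
      by (intro eq_matI) (auto simp: mat_sum_def tensor_mat_def \<sigma>_def \<tau>_def bit_mat_def)
    moreover have "is_state 2 \<sigma>" "is_state 2 \<tau>"
      using st sepc_tens p by (simp_all add: \<sigma>_def \<tau>_def)
    ultimately show ?thesis using p rtr_tens[OF sepc_tens]
      by (intro exI[of _ 1] exI[of _ "\<lambda>_. rtr A * rtr B"] exI[of _ "\<lambda>_. \<sigma>"] exI[of _ "\<lambda>_. \<tau>"]) simp
  qed
next
  case (sepc_add X Y)
  obtain r q \<sigma> \<tau> where 1: "\<forall>k<r. 0 \<le> q k \<and> is_state 2 (\<sigma> k) \<and> is_state 2 (\<tau> k)" "(\<Sum>k<r. q k) = rtr X"
    "pair_mat X = mat_sum (2 * 2) (\<lambda>k. complex_of_real (q k) \<cdot>\<^sub>m tensor_mat (\<sigma> k) (\<tau> k)) r"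
    using sepc_add.IH(1) by blast
  obtain r' q' \<sigma>' \<tau>' where 2: "\<forall>k<r'. 0 \<le> q' k \<and> is_state 2 (\<sigma>' k) \<and> is_state 2 (\<tau>' k)" "(\<Sum>k<r'. q' k) = rtr Y"
    "pair_mat Y = mat_sum (2 * 2) (\<lambda>k. complex_of_real (q' k) \<cdot>\<^sub>m tensor_mat (\<sigma>' k) (\<tau>' k)) r'"
    using sepc_add.IH(2) by blast
  let ?q = "\<lambda>k. if k < r then q k else q' (k - r)"
  let ?\<sigma> = "\<lambda>k. if k < r then \<sigma> k else \<sigma>' (k - r)"
  let ?\<tau> = "\<lambda>k. if k < r then \<tau> k else \<tau>' (k - r)"
  let ?F = "\<lambda>k. complex_of_real (q k) \<cdot>\<^sub>m tensor_mat (\<sigma> k) (\<tau> k)"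
  let ?G = "\<lambda>k. complex_of_real (q' k) \<cdot>\<^sub>m tensor_mat (\<sigma>' k) (\<tau>' k)"
  have "pair_mat (\<lambda>r s. X r s + Y r s) = mat_sum (2 * 2) (\<lambda>k. complex_of_real (?q k) \<cdot>\<^sub>m tensor_mat (?\<sigma> k) (?\<tau> k)) (r + r')"
  proof (rule eq_matI)
    fix i j
    assume "i < dim_row (mat_sum (2 * 2) (\<lambda>k. complex_of_real (?q k) \<cdot>\<^sub>m tensor_mat (?\<sigma> k) (?\<tau> k)) (r + r'))"
      "j < dim_col (mat_sum (2 * 2) (\<lambda>k. complex_of_real (?q k) \<cdot>\<^sub>m tensor_mat (?\<sigma> k) (?\<tau> k)) (r + r'))"
    then have ij: "i < 4" "j < 4" by (simp_all add: mat_sum_def)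
    have "(\<Sum>k<r + r'. (complex_of_real (?q k) \<cdot>\<^sub>m tensor_mat (?\<sigma> k) (?\<tau> k)) $$ (i, j)) =
        (\<Sum>k<r + r'. if k < r then ?F k $$ (i, j) else ?G (k - r) $$ (i, j))"
      by (intro sum.cong refl) simp
    also have "\<dots> = (\<Sum>k<r. ?F k $$ (i, j)) + (\<Sum>k<r'. ?G k $$ (i, j))" by (rule sum_append)
    finally show "pair_mat (\<lambda>r s. X r s + Y r s) $$ (i, j) =
        mat_sum (2 * 2) (\<lambda>k. complex_of_real (?q k) \<cdot>\<^sub>m tensor_mat (?\<sigma> k) (?\<tau> k)) (r + r') $$ (i, j)"
      unfolding pair_mat_add 1(3) 2(3) using ij by (simp add: mat_sum_def)
  qed (simp_all add: mat_sum_def pair_mat_def)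
  moreover have "(\<Sum>k<r + r'. ?q k) = rtr (\<lambda>r s. X r s + Y r s)"
    using 1(2) 2(2) by (simp add: rtr_add sum_append)
  moreover have "\<forall>k<r + r'. 0 \<le> ?q k \<and> is_state 2 (?\<sigma> k) \<and> is_state 2 (?\<tau> k)"
    using 1(1) 2(1) by auto
  ultimately show ?case
    by (intro exI[of _ "r + r'"] exI[of _ ?q] exI[of _ ?\<sigma>] exI[of _ ?\<tau>] conjI)
qed

lemma scalar_prod_pair:
  assumes "X \<in> carrier_mat 4 4" "\<psi> \<in> carrier_vec 4"
  shows "(X *\<^sub>v \<psi>) \<bullet>c \<psi> = sesq (pair_op X) (\<lambda>r. \<psi> $ pair_index r) (\<lambda>r. \<psi> $ pair_index r)"
  unfolding scalar_prod_form[OF assms]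
  by (simp add: sesq_def sum_pair sum_lessThan_4 pair_op_def index_defs numeral_3_eq_3 numeral_2_eq_2)

section \<open>Maximally entangled vectors\<close>

lemma norm2_isometry:
  fixes M :: "'i::finite \<Rightarrow> 'j::finite \<Rightarrow> complex"
  assumes "\<And>j l. (\<Sum>k\<in>UNIV. cnj (M k j) * M k l) = (if j = l then 1 else 0)"
  shows "norm2 (\<lambda>k. \<Sum>j\<in>UNIV. M k j * x j) = norm2 x"
proof -
  define K where "K = (\<lambda>r p. cnj (M p r))"
  have "conj_by K idop = idop"
  proof (intro ext)
    fix r s
    have "conj_by K idop r s = (\<Sum>p\<in>UNIV. K r p * cnj (K s p))"
      by (simp add: conj_by_def idop_def if_distrib[of "\<lambda>x. _ * x * _"] cong: if_cong)
    then show "conj_by K idop r s = idop r s" by (simp add: K_def assms idop_def)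
  qed
  then have "sesq idop x x = sesq (conj_by K idop) x x" by simp
  also have "\<dots> = sesq idop (\<lambda>k. \<Sum>j\<in>UNIV. M k j * x j) (\<lambda>k. \<Sum>j\<in>UNIV. M k j * x j)"
    unfolding sesq_conj_by by (simp add: K_def)
  finally show ?thesis by (simp add: sesq_idop)
qed

lemma mat_adjoint_index:
  "A \<in> carrier_mat n n \<Longrightarrow> i < n \<Longrightarrow> j < n \<Longrightarrow> mat_adjoint A $$ (i, j) = cnj (A $$ (j, i))"
  by (simp add: mat_adjoint_def mat_of_rows_index cols_def)

lemma mat_adjoint_carrier: "A \<in> carrier_mat n n \<Longrightarrow> mat_adjoint A \<in> carrier_mat n n"
  using mat_of_rows_carrier(1)[of n "map conjugate (cols A)"] by (simp add: mat_adjoint_def)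

text \<open>The definition provides a left inverse only; in finite dimension it is also a right
  inverse, which gives the second relation.\<close>

lemma unitary_bits:
  assumes "is_unitary 2 U"
  shows "(\<Sum>k\<in>UNIV. cnj (bit_op U k i) * bit_op U k j) = (if i = j then 1 else 0)"
    and "(\<Sum>k\<in>UNIV. bit_op U i k * cnj (bit_op U j k)) = (if i = j then 1 else 0)"
proof -
  have U: "U \<in> carrier_mat 2 2" and a: "mat_adjoint U * U = 1\<^sub>m 2" using assms by (simp_all add: is_unitary_def)
  note adj = mat_adjoint_carrier[OF U]
  have b: "U * mat_adjoint U = 1\<^sub>m 2" by (rule mat_mult_left_right_inverse[OF adj U a])
  have "(mat_adjoint U * U) $$ (bit_index i, bit_index j) = 1\<^sub>m 2 $$ (bit_index i, bit_index j)" using a by simp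
  then show "(\<Sum>k\<in>UNIV. cnj (bit_op U k i) * bit_op U k j) = (if i = j then 1 else 0)"
    using U adj by (cases i; cases j) (simp_all add: scalar_prod_def sum_bool bit_op_def bit_index_def
        mat_adjoint_index numeral_2_eq_2)
  have "(U * mat_adjoint U) $$ (bit_index i, bit_index j) = 1\<^sub>m 2 $$ (bit_index i, bit_index j)" using b by simp
  then show "(\<Sum>k\<in>UNIV. bit_op U i k * cnj (bit_op U j k)) = (if i = j then 1 else 0)"
    using U adj by (cases i; cases j) (simp_all add: scalar_prod_def sum_bool bit_op_def bit_index_def
        mat_adjoint_index numeral_2_eq_2)
qed

lemma bell_vec_index:
  "bell_vec = vec 4 (\<lambda>k. if k = 0 \<or> k = 3 then complex_of_real (1 / sqrt 2) else 0)"
  by (rule eq_vecI) (auto simp: bell_vec_def tensor_vec_def dest!: nat_less_4_cases)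

lemma maximally_entangled_index:
  assumes U: "is_unitary 2 U" and V: "is_unitary 2 V"
  shows "(tensor_mat U V *\<^sub>v bell_vec) $ pair_index (i, j) =
    complex_of_real (1 / sqrt 2) * (\<Sum>k\<in>UNIV. bit_op U i k * bit_op V j k)"
proof -
  have "U \<in> carrier_mat 2 2" "V \<in> carrier_mat 2 2" using U V by (simp_all add: is_unitary_def)
  then show ?thesis
    by (cases i; cases j) (simp_all add: scalar_prod_def bell_vec_index tensor_mat_def sum_bool bit_op_def
        index_defs atLeast0LessThan sum_lessThan_4 algebra_simps)
qed

lemma maximally_entangled_carrier:
  assumes "maximally_entangled \<psi>" shows "\<psi> \<in> carrier_vec 4"
proof -
  obtain U V where UV: "is_unitary 2 U" "is_unitary 2 V" "\<psi> = tensor_mat U V *\<^sub>v bell_vec"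
    using assms by (auto simp: maximally_entangled_def)
  have "tensor_mat U V \<in> carrier_mat 4 4"
    using tensor_mat_carrier[of U 2 V 2] UV(1,2) by (simp add: is_unitary_def)
  moreover have "bell_vec \<in> carrier_vec 4" by (simp add: bell_vec_index)
  ultimately show ?thesis unfolding UV(3) by (rule mult_mat_vec_carrier)
qed

text \<open>The coefficient matrix is U times the transpose of V over sqrt 2, so the inequality even
  holds with equality.\<close>

lemma maximally_entangled_contractive:
  assumes "maximally_entangled \<psi>" shows "contractive (\<lambda>r. \<psi> $ pair_index r)"
proof -
  obtain U V where UV: "is_unitary 2 U" "is_unitary 2 V" "\<psi> = tensor_mat U V *\<^sub>v bell_vec"
    using assms by (auto simp: maximally_entangled_def)
  have "norm2 (\<lambda>j. \<Sum>i\<in>UNIV. cnj (\<psi> $ pair_index (i, j)) * x i) = norm2 x / 2" for x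
  proof -
    have "(\<Sum>i\<in>UNIV. cnj (\<psi> $ pair_index (i, j)) * x i) = complex_of_real (1 / sqrt 2) *
        (\<Sum>k\<in>UNIV. cnj (bit_op V j k) * (\<Sum>i\<in>UNIV. cnj (bit_op U i k) * x i))" for j
      unfolding UV(3) maximally_entangled_index[OF UV(1,2)] by (simp add: sum_bool algebra_simps)
    then have "norm2 (\<lambda>j. \<Sum>i\<in>UNIV. cnj (\<psi> $ pair_index (i, j)) * x i) =
        (cmod (complex_of_real (1 / sqrt 2)))\<^sup>2 *
        norm2 (\<lambda>j. \<Sum>k\<in>UNIV. cnj (bit_op V j k) * (\<Sum>i\<in>UNIV. cnj (bit_op U i k) * x i))"
      by (simp only: norm2_scale)
    also have "norm2 (\<lambda>j. \<Sum>k\<in>UNIV. cnj (bit_op V j k) * (\<Sum>i\<in>UNIV. cnj (bit_op U i k) * x i)) =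
        norm2 (\<lambda>k. \<Sum>i\<in>UNIV. cnj (bit_op U i k) * x i)"
    proof (rule norm2_isometry)
      show "(\<Sum>k\<in>UNIV. cnj (cnj (bit_op V k j)) * cnj (bit_op V k l)) = (if j = l then 1 else 0)" for j l
        using unitary_bits(1)[OF UV(2), of l j] by (simp add: mult.commute split: if_splits)
    qed
    also have "\<dots> = norm2 x"
      using unitary_bits(2)[OF UV(1)] by (intro norm2_isometry) simp
    finally show ?thesis unfolding norm_of_real by (simp add: power_divide)
  qed
  then show ?thesis by (simp add: contractive_def)
qed

lemma cauchy_schwarz_bool:
  fixes y w :: "bool \<Rightarrow> complex"
  shows "(cmod (\<Sum>j\<in>UNIV. y j * w j))\<^sup>2 \<le> norm2 y * norm2 w"
proof -
  have "cmod (\<Sum>j\<in>UNIV. y j * w j) \<le> cmod (y False) * cmod (w False) + cmod (y True) * cmod (w True)"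
    unfolding sum_bool by (rule order_trans[OF norm_triangle_ineq]) (simp add: norm_mult)
  then have "(cmod (\<Sum>j\<in>UNIV. y j * w j))\<^sup>2 \<le> (cmod (y False) * cmod (w False) + cmod (y True) * cmod (w True))\<^sup>2"
    by (intro power_mono) auto
  also have "\<dots> \<le> norm2 y * norm2 w"
    using zero_le_power2[of "cmod (y False) * cmod (w True) - cmod (y True) * cmod (w False)"]
    by (simp add: norm2_def sum_bool power2_eq_square algebra_simps)
  finally show ?thesis .
qed

text \<open>For dyads of v and w the left side is the squared overlap of \<psi> with v tensor w,
  bounded by Cauchy-Schwarz and contractivity. Both sides are additive in \<open>A\<close> and in
  \<open>B\<close>, so decompositions into dyads finish the proof.\<close>

lemma contractive_product_bound:
  assumes \<psi>: "contractive \<psi>" and A: "pos A" and B: "pos B"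
  shows "Re (sesq (tens A B) \<psi> \<psi>) \<le> rtr A * rtr B / 2"
proof -
  obtain vs where vs: "\<And>r s. A r s = (\<Sum>v\<leftarrow>vs. v r * cnj (v s))" using pos_decomposition[OF A] by blast
  obtain ws where ws: "\<And>r s. B r s = (\<Sum>w\<leftarrow>ws. w r * cnj (w s))" using pos_decomposition[OF B] by blast
  define D :: "(bool \<Rightarrow> complex) \<Rightarrow> bool \<Rightarrow> bool \<Rightarrow> complex" where "D v = (\<lambda>r s. v r * cnj (v s))" for v
  have D: "pos (D v)" "rtr (D v) = norm2 v" for v by (simp_all add: D_def pos_rank_one rtr_rank_one)
  have rank_one: "Re (sesq (tens (D v) (D w)) \<psi> \<psi>) \<le> rtr (D v) * rtr (D w) / 2" for v w
  proof -
    define z where "z = (\<Sum>r\<in>UNIV. cnj (\<psi> r) * kron v w r)"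
    have "tens (D v) (D w) = (\<lambda>r s. kron v w r * cnj (kron v w s))"
      by (simp add: tens_def kron_def D_def ac_simps)
    then have "sesq (tens (D v) (D w)) \<psi> \<psi> = z * (\<Sum>s\<in>UNIV. cnj (kron v w s) * \<psi> s)"
      by (simp only: sesq_rank_one z_def)
    also have "(\<Sum>s\<in>UNIV. cnj (kron v w s) * \<psi> s) = cnj z" by (simp add: z_def mult.commute)
    finally have "sesq (tens (D v) (D w)) \<psi> \<psi> = complex_of_real ((cmod z)\<^sup>2)"
      by (simp only: complex_norm_square)
    then have "Re (sesq (tens (D v) (D w)) \<psi> \<psi>) = (cmod z)\<^sup>2" by (simp only: Re_complex_of_real)
    also have "z = (\<Sum>j\<in>UNIV. (\<Sum>i\<in>UNIV. cnj (\<psi> (i, j)) * v i) * w j)"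
      by (simp add: z_def sum_prod_UNIV kron_def sum_bool algebra_simps)
    also have "(cmod \<dots>)\<^sup>2 \<le> norm2 (\<lambda>j. \<Sum>i\<in>UNIV. cnj (\<psi> (i, j)) * v i) * norm2 w"
      by (rule cauchy_schwarz_bool)
    also have "\<dots> \<le> norm2 v / 2 * norm2 w"
      using \<psi> by (intro mult_right_mono norm2_nonneg) (simp add: contractive_def)
    finally show ?thesis by (simp add: D(2))
  qed
  have ind2: "Re (sesq (tens (D v) (\<lambda>r s. \<Sum>w\<leftarrow>us. D w r s)) \<psi> \<psi>) \<le> rtr (D v) * rtr (\<lambda>r s. \<Sum>w\<leftarrow>us. D w r s) / 2" for v us
  proof (induction us)
    case Nil
    then show ?case by (simp add: tens_def sesq_def rtr_def)
  next
    case (Cons u us)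
    have "tens (D v) (\<lambda>r s. D u r s + (\<Sum>w\<leftarrow>us. D w r s)) =
      (\<lambda>r s. tens (D v) (D u) r s + tens (D v) (\<lambda>r s. \<Sum>w\<leftarrow>us. D w r s) r s)"
      by (simp add: tens_def distrib_left)
    then show ?case using Cons rank_one[of v u] by (simp add: sesq_add_op rtr_add distrib_left add_divide_distrib)
  qed
  have ind1: "Re (sesq (tens (\<lambda>r s. \<Sum>v\<leftarrow>us. D v r s) B) \<psi> \<psi>) \<le> rtr (\<lambda>r s. \<Sum>v\<leftarrow>us. D v r s) * rtr B / 2" for us
  proof (induction us)
    case Nil
    then show ?case by (simp add: tens_def sesq_def rtr_def)
  next
    case (Cons u us)
    have "B = (\<lambda>r s. \<Sum>w\<leftarrow>ws. D w r s)" by (simp add: ws D_def fun_eq_iff)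
    then have "Re (sesq (tens (D u) B) \<psi> \<psi>) \<le> rtr (D u) * rtr B / 2" using ind2[of u ws] by simp
    moreover have "tens (\<lambda>r s. D u r s + (\<Sum>v\<leftarrow>us. D v r s)) B =
      (\<lambda>r s. tens (D u) B r s + tens (\<lambda>r s. \<Sum>v\<leftarrow>us. D v r s) B r s)"
      by (simp add: tens_def distrib_right)
    ultimately show ?case using Cons by (simp add: sesq_add_op rtr_add distrib_right add_divide_distrib)
  qed
  have "A = (\<lambda>r s. \<Sum>v\<leftarrow>vs. D v r s)" by (simp add: vs D_def fun_eq_iff)
  then show ?thesis using ind1[of vs] by simp
qed

lemma maximally_entangled_product_bound:
  assumes \<psi>: "maximally_entangled \<psi>" and "psd 2 \<sigma>" "psd 2 \<tau>"
  shows "Re ((tensor_mat \<sigma> \<tau> *\<^sub>v \<psi>) \<bullet>c \<psi>) \<le> Re (mat_trace \<sigma>) * Re (mat_trace \<tau>) / 2"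
proof -
  have car: "\<sigma> \<in> carrier_mat 2 2" "\<tau> \<in> carrier_mat 2 2" using assms by (simp_all add: psd_def)
  have tr: "Re (mat_trace A) = rtr (bit_op A)" if "A \<in> carrier_mat 2 2" for A
    using that by (simp add: mat_trace_def rtr_def sum_lessThan_2 sum_bool bit_op_def bit_index_def)
  have "tensor_mat \<sigma> \<tau> \<in> carrier_mat 4 4" using tensor_mat_carrier[OF car] by simp
  moreover have "pair_op (tensor_mat \<sigma> \<tau>) = tens (bit_op \<sigma>) (bit_op \<tau>)"
    using car by (auto simp: pair_op_def tens_def bit_op_def tensor_mat_def index_defs fun_eq_iff)
  ultimately show ?thesis
    using contractive_product_bound[OF maximally_entangled_contractive[OF \<psi>] pos_bit_op[OF assms(2)] pos_bit_op[OF assms(3)]]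
      maximally_entangled_carrier[OF \<psi>] car
    by (simp add: scalar_prod_pair tr)
qed

lemma maximally_entangled_bell: "maximally_entangled bell_vec"
proof -
  have "mat_adjoint (1\<^sub>m 2) = (1\<^sub>m 2 :: complex mat)"
    using mat_adjoint_carrier[of "1\<^sub>m 2" 2] by (intro eq_matI) (auto simp: mat_adjoint_index[of "1\<^sub>m 2" 2])
  then have U: "is_unitary 2 (1\<^sub>m 2)" by (simp add: is_unitary_def)
  have "tensor_mat (1\<^sub>m 2) (1\<^sub>m 2) = 1\<^sub>m 4"
    by (intro eq_matI) (auto simp: tensor_mat_def dest!: nat_less_4_cases)
  then have "tensor_mat (1\<^sub>m 2) (1\<^sub>m 2) *\<^sub>v bell_vec = bell_vec"
    by (simp add: bell_vec_index)
  then show ?thesis using U by (auto simp: maximally_entangled_def intro!: exI[of _ "1\<^sub>m 2"])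
qed

section \<open>The filtering protocol\<close>

definition kraus :: "nat \<Rightarrow> nat \<Rightarrow> (nat \<Rightarrow> nat \<Rightarrow> complex) \<Rightarrow> complex mat \<Rightarrow> complex mat" where
  "kraus m n K X = mat n n (\<lambda>(i, j). \<Sum>p<m. \<Sum>q<m. K i p * X $$ (p, q) * cnj (K j q))"

lemma linear_op_kraus: "linear_op m n (kraus m n K)"
  unfolding linear_op_def
proof (intro conjI ballI allI)
  fix X Y :: "complex mat" assume "X \<in> carrier_mat m m" "Y \<in> carrier_mat m m"
  then show "kraus m n K (X + Y) = kraus m n K X + kraus m n K Y"
    by (intro eq_matI) (simp_all add: kraus_def sum.distrib distrib_left distrib_right)
next
  fix c and X :: "complex mat" assume "X \<in> carrier_mat m m"
  then show "kraus m n K (c \<cdot>\<^sub>m X) = c \<cdot>\<^sub>m kraus m n K X"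
    by (intro eq_matI) (simp_all add: kraus_def sum_distrib_left mult.left_commute mult.assoc)
qed (simp add: kraus_def)

lemma psd_kraus:
  assumes "psd m X" shows "psd n (kraus m n K X)"
  unfolding psd_iff
proof (intro conjI allI)
  fix v :: "nat \<Rightarrow> complex"
  define u where "u p = (\<Sum>i<n. cnj (K i p) * v i)" for p
  let ?t = "\<lambda>i j p q. cnj (v i) * K i p * X $$ (p, q) * (cnj (K j q) * v j)"
  have "(\<Sum>i<n. \<Sum>j<n. cnj (v i) * kraus m n K X $$ (i, j) * v j) = (\<Sum>i<n. \<Sum>j<n. \<Sum>p<m. \<Sum>q<m. ?t i j p q)"
    by (intro sum.cong refl) (simp add: kraus_def sum_distrib_left sum_distrib_right mult.assoc)
  also have "\<dots> = (\<Sum>i<n. \<Sum>p<m. \<Sum>j<n. \<Sum>q<m. ?t i j p q)"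
    by (intro sum.cong refl sum.swap)
  also have "\<dots> = (\<Sum>p<m. \<Sum>i<n. \<Sum>j<n. \<Sum>q<m. ?t i j p q)"
    by (rule sum.swap)
  also have "\<dots> = (\<Sum>p<m. \<Sum>i<n. \<Sum>q<m. \<Sum>j<n. ?t i j p q)"
    by (intro sum.cong refl sum.swap)
  also have "\<dots> = (\<Sum>p<m. \<Sum>q<m. \<Sum>i<n. \<Sum>j<n. ?t i j p q)"
    by (intro sum.cong refl sum.swap)
  also have "\<dots> = (\<Sum>p<m. \<Sum>q<m. cnj (u p) * X $$ (p, q) * u q)"
    by (simp add: u_def sum_distrib_left sum_distrib_right mult.commute mult.left_commute mult.assoc)
  finally show "0 \<le> (\<Sum>i<n. \<Sum>j<n. cnj (v i) * kraus m n K X $$ (i, j) * v j)"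
    using assms by (simp add: psd_iff)
qed (simp add: kraus_def)

lemma sum_mult_index:
  "(\<Sum>r<m * k. f r) = (\<Sum>i<m. \<Sum>a<k. f (i * k + a :: nat) :: 'a::comm_monoid_add)"
proof -
  have "(\<Sum>a<k. f (i * k + a)) = sum f {i * k..<i * k + k}" for i
    using sum.shift_bounds_nat_ivl[of f 0 "i * k" k] by (simp add: atLeast0LessThan add.commute)
  then show ?thesis by (simp add: sum.nat_group)
qed

text \<open>An ancilla replaces K by K tensor I, whose matrix is the one shown. The extended map is
  again of Kraus form, which reduces complete positivity to positivity.\<close>

lemma act_left_kraus:
  "act_left m n k (kraus m n K) X =
     kraus (m * k) (n * k) (\<lambda>r p. if p mod k = r mod k then K (r div k) (p div k) else 0) X"
proof (rule eq_matI)
  fix r s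
  assume "r < dim_row (kraus (m * k) (n * k) (\<lambda>r p. if p mod k = r mod k then K (r div k) (p div k) else 0) X)"
    "s < dim_col (kraus (m * k) (n * k) (\<lambda>r p. if p mod k = r mod k then K (r div k) (p div k) else 0) X)"
  then have rs: "r < n * k" "s < n * k" by (simp_all add: kraus_def)
  then have k: "k > 0" by (cases k) auto
  define L where "L r p = (if p mod k = r mod k then K (r div k) (p div k) else 0)" for r p
  have L: "L r (p * k + a) = (if a = r mod k then K (r div k) p else 0)" if "a < k" for r p a
    using that by (simp add: L_def)
  have "(\<Sum>p<m * k. \<Sum>q<m * k. L r p * X $$ (p, q) * cnj (L s q)) =
      (\<Sum>p<m. \<Sum>a<k. \<Sum>q<m. \<Sum>b<k. L r (p * k + a) * X $$ (p * k + a, q * k + b) * cnj (L s (q * k + b)))"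
    by (simp add: sum_mult_index)
  also have "\<dots> = (\<Sum>p<m. \<Sum>a<k. \<Sum>q<m. \<Sum>b<k. if a = r mod k then
      if b = s mod k then K (r div k) p * X $$ (p * k + a, q * k + b) * cnj (K (s div k) q) else 0 else 0)"
    by (intro sum.cong refl) (simp add: L)
  also have "\<dots> = (\<Sum>p<m. \<Sum>a<k. if a = r mod k then
      (\<Sum>q<m. \<Sum>b<k. if b = s mod k then K (r div k) p * X $$ (p * k + a, q * k + b) * cnj (K (s div k) q) else 0) else 0)"
    by (intro sum.cong refl) auto
  also have "\<dots> = (\<Sum>p<m. \<Sum>q<m. K (r div k) p * X $$ (p * k + r mod k, q * k + s mod k) * cnj (K (s div k) q))"
    using k by simp
  finally show "act_left m n k (kraus m n K) X $$ (r, s) =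
      kraus (m * k) (n * k) (\<lambda>r p. if p mod k = r mod k then K (r div k) (p div k) else 0) X $$ (r, s)"
    using rs unfolding L_def by (simp add: act_left_def kraus_def less_mult_imp_div_less)
qed (simp_all add: act_left_def kraus_def)

lemma completely_positive_kraus: "completely_positive m n (kraus m n K)"
  by (simp add: completely_positive_def linear_op_kraus act_left_kraus psd_kraus)

text \<open>The hypothesis is the completeness relation \<Sum> K_k^dagger K_k = I, written
  entrywise.\<close>

lemma instrument_kraus:
  assumes "\<And>p q. p < m \<Longrightarrow> q < m \<Longrightarrow> (\<Sum>k<r. \<Sum>i<n. K k i p * cnj (K k i q)) = (if p = q then 1 else 0)"
  shows "instrument m n r (\<lambda>k. kraus m n (K k))"
  unfolding instrument_def
proof (intro conjI allI impI ballI completely_positive_kraus)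
  fix X :: "complex mat" assume X: "X \<in> carrier_mat m m"
  let ?t = "\<lambda>k i p q. X $$ (p, q) * (K k i p * cnj (K k i q))"
  have "(\<Sum>k<r. mat_trace (kraus m n (K k) X)) = (\<Sum>k<r. \<Sum>i<n. \<Sum>p<m. \<Sum>q<m. ?t k i p q)"
    by (simp add: mat_trace_def kraus_def mult.commute mult.left_commute)
  also have "\<dots> = (\<Sum>k<r. \<Sum>p<m. \<Sum>i<n. \<Sum>q<m. ?t k i p q)"
    by (intro sum.cong refl sum.swap)
  also have "\<dots> = (\<Sum>p<m. \<Sum>k<r. \<Sum>i<n. \<Sum>q<m. ?t k i p q)"
    by (rule sum.swap)
  also have "\<dots> = (\<Sum>p<m. \<Sum>k<r. \<Sum>q<m. \<Sum>i<n. ?t k i p q)"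
    by (intro sum.cong refl sum.swap)
  also have "\<dots> = (\<Sum>p<m. \<Sum>q<m. \<Sum>k<r. \<Sum>i<n. ?t k i p q)"
    by (intro sum.cong refl sum.swap)
  also have "\<dots> = (\<Sum>p<m. \<Sum>q<m. X $$ (p, q) * (\<Sum>k<r. \<Sum>i<n. K k i p * cnj (K k i q)))"
    by (simp add: sum_distrib_left)
  also have "\<dots> = (\<Sum>p<m. \<Sum>q<m. if p = q then X $$ (p, q) else 0)"
    using assms by (intro sum.cong refl) simp
  also have "\<dots> = mat_trace X" using X by (simp add: mat_trace_def)
  finally show "(\<Sum>k<r. mat_trace (kraus m n (K k) X)) = mat_trace X" .
qed

lemma bell_form:
  assumes "X \<in> carrier_mat 4 4"
  shows "(X *\<^sub>v bell_vec) \<bullet>c bell_vec = (X $$ (0, 0) + X $$ (0, 3) + X $$ (3, 0) + X $$ (3, 3)) / 2"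
proof -
  have s: "complex_of_real (sqrt 2) * complex_of_real (sqrt 2) = 2"
    by (simp flip: of_real_mult)
  have "bell_vec \<in> carrier_vec 4" by (simp add: bell_vec_index)
  from scalar_prod_form[OF assms this] show ?thesis
    by (simp add: sum_lessThan_4 bell_vec_index s add_divide_distrib)
qed

text \<open>Bob measures in the computational basis and prepares 0, with Kraus operators |0><k|.
  Alice is not involved: her failing filter outcome has already left her qubit in 0.\<close>

definition reset :: "complex mat \<Rightarrow> complex mat" where
  "reset X = mat_sum (2 * 2) (\<lambda>k. act_right 2 2 2 (kraus 2 2 (\<lambda>i p. if i = 0 \<and> p = k then 1 else 0)) X) 2"

lemma locc_reset: "locc 2 2 2 2 reset"
proof -
  have "instrument 2 2 2 (\<lambda>k. kraus 2 2 (\<lambda>i p. if i = 0 \<and> p = k then 1 else 0))"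
    by (rule instrument_kraus) (auto simp: sum_lessThan_2 dest!: nat_less_2_cases)
  from locc.bob[OF this, of 2 2 2 "\<lambda>_ X. X"] locc.stop[of 2 2] show ?thesis
    unfolding reset_def[abs_def] by simp
qed

text \<open>Bob ends in 0, so of the four entries in the Bell form only the one at 00 survives; it
  collects the weight of Alice's 0 over both of Bob's inputs.\<close>

lemma bell_form_reset:
  "(reset X *\<^sub>v bell_vec) \<bullet>c bell_vec = (X $$ (0, 0) + X $$ (Suc 0, Suc 0)) / 2"
proof -
  have "reset X \<in> carrier_mat 4 4" by (simp add: reset_def mat_sum_def)
  then show ?thesis
    unfolding bell_form[OF \<open>reset X \<in> carrier_mat 4 4\<close>]
    by (simp add: reset_def mat_sum_def act_right_def kraus_def sum_lessThan_2)
qed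

text \<open>Alice filters with the contraction \<open>A\<close> determined by \<open>\<phi> = (A\<^sup>* \<otimes> I) \<psi>\<^sub>-\<close>. If the filter fails, both
  parties prepare \<open>|0\<rangle>\<close>, whose fidelity with the Bell vector is \<open>1 / 2\<close>; each rank-one part of the
  failure operator \<open>I - A\<^sup>* A\<close> is a separate outcome.\<close>

lemma filter_protocol:
  assumes \<phi>: "contractive \<phi>" and \<rho>: "\<rho> \<in> carrier_mat 4 4" "mat_trace \<rho> = 1"
  obtains \<Lambda> where "locc 2 2 2 2 \<Lambda>"
    "(\<Lambda> \<rho> *\<^sub>v bell_vec) \<bullet>c bell_vec = 1 / 2 - sesq (pt (pair_op \<rho>)) \<phi> \<phi>"
proof -
  \<comment> \<open>The factor sqrt 2 turns the bound 1/2 in \<open>contractive\<close> into the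
    bound 1 for \<open>A\<close>.\<close>
  define c where "c = complex_of_real (sqrt 2)"
  have c: "c * c = 2" "cnj c = c" "(cmod c)\<^sup>2 = 2" by (simp_all add: c_def flip: of_real_mult)
  define A where "A i p = (if i then c * cnj (\<phi> (p, False)) else - c * cnj (\<phi> (p, True)))" for i p
  define G where "G p q = (\<Sum>i\<in>UNIV. cnj (A i p) * A i q)" for p q
  have "pos (\<lambda>p q. idop p q - G p q)"
    unfolding pos_def
  proof
    fix v
    have "G = (\<lambda>p q. A False q * cnj (A False p) + A True q * cnj (A True p))"
      by (simp add: G_def sum_bool fun_eq_iff)
    then have "sesq G v v = complex_of_real ((cmod (\<Sum>q\<in>UNIV. A False q * v q))\<^sup>2 + (cmod (\<Sum>q\<in>UNIV. A True q * v q))\<^sup>2)"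
      unfolding of_real_add complex_norm_square by (simp add: sesq_def sum_bool algebra_simps)
    also have "(\<Sum>q\<in>UNIV. A False q * v q) = - c * (\<Sum>q\<in>UNIV. cnj (\<phi> (q, True)) * v q)"
      by (simp add: A_def sum_bool algebra_simps)
    also have "(\<Sum>q\<in>UNIV. A True q * v q) = c * (\<Sum>q\<in>UNIV. cnj (\<phi> (q, False)) * v q)"
      by (simp add: A_def sum_bool algebra_simps)
    also have "(cmod (- c * (\<Sum>q\<in>UNIV. cnj (\<phi> (q, True)) * v q)))\<^sup>2 + (cmod (c * (\<Sum>q\<in>UNIV. cnj (\<phi> (q, False)) * v q)))\<^sup>2
      = 2 * norm2 (\<lambda>j. \<Sum>i\<in>UNIV. cnj (\<phi> (i, j)) * v i)"
      unfolding norm_mult power_mult_distrib norm_minus_cancel c(3) norm2_def sum_bool[of "\<lambda>j. (_ j)\<^sup>2"] by simp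
    finally have "sesq G v v = complex_of_real (2 * norm2 (\<lambda>j. \<Sum>i\<in>UNIV. cnj (\<phi> (i, j)) * v i))" .
    moreover have "2 * norm2 (\<lambda>j. \<Sum>i\<in>UNIV. cnj (\<phi> (i, j)) * v i) \<le> norm2 v"
      using \<phi> by (simp add: contractive_def field_simps)
    ultimately show "0 \<le> sesq (\<lambda>p q. idop p q - G p q) v v"
      by (simp add: sesq_diff_op sesq_idop less_eq_complex_def)
  qed
  then obtain cs where cs: "\<And>p q. idop p q - G p q = (\<Sum>v\<leftarrow>cs. v p * cnj (v q))"
    using pos_decomposition by blast
  have cs_sum: "(\<Sum>k<length cs. cnj ((cs ! k) p) * (cs ! k) q) = idop q p - G q p" for p q
    unfolding cs by (simp add: sum_list_sum_nth atLeast0LessThan mult.commute)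
  \<comment> \<open>Outcome 0 is the filter. The failure outcome \<open>Suc l\<close> has the Kraus
    operator |0><v| with v = \<open>cs ! l\<close>, so Alice prepares her 0 in the same
    step.\<close>
  define K where "K k = (case k of 0 \<Rightarrow> (\<lambda>i p. A (index_bit i) (index_bit p))
    | Suc l \<Rightarrow> (\<lambda>i p. if i = 0 then cnj ((cs ! l) (index_bit p)) else 0))" for k :: nat
  define \<Psi> where "\<Psi> k = (case k of 0 \<Rightarrow> (\<lambda>X. X) | Suc l \<Rightarrow> reset)" for k :: nat
  define \<Lambda> where "\<Lambda> = (\<lambda>X. mat_sum (2 * 2) (\<lambda>k. \<Psi> k (act_left 2 2 2 (kraus 2 2 (K k)) X)) (Suc (length cs)))"
  have "instrument 2 2 (Suc (length cs)) (\<lambda>k. kraus 2 2 (K k))"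
  proof (rule instrument_kraus)
    fix p q :: nat assume pq: "p < 2" "q < 2"
    have "(\<Sum>k<Suc (length cs). \<Sum>i<2. K k i p * cnj (K k i q)) =
        G (index_bit q) (index_bit p) + (\<Sum>k<length cs. cnj ((cs ! k) (index_bit p)) * (cs ! k) (index_bit q))"
      by (simp add: sum.lessThan_Suc_shift K_def sum_lessThan_2 G_def sum_bool index_bit_def mult.commute del: sum.lessThan_Suc)
    also have "\<dots> = idop (index_bit q) (index_bit p)" by (simp add: cs_sum)
    also have "\<dots> = (if p = q then 1 else 0)"
      using pq by (auto simp: idop_def index_bit_def dest!: nat_less_2_cases)
    finally show "(\<Sum>k<Suc (length cs). \<Sum>i<2. K k i p * cnj (K k i q)) = (if p = q then 1 else 0)" .
  qed
  moreover have "locc 2 2 2 2 (\<Psi> k)" for k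
    using locc.stop[of 2 2] locc_reset by (cases k) (simp_all add: \<Psi>_def)
  ultimately have locc: "locc 2 2 2 2 \<Lambda>" unfolding \<Lambda>_def by (rule locc.alice)
  define f where "f = (\<lambda>p a q b. \<rho> $$ (pair_index (p, a), pair_index (q, b)))"
  have car: "\<Psi> k (act_left 2 2 2 (kraus 2 2 (K k)) \<rho>) \<in> carrier_mat 4 4" for k
    by (cases k) (simp_all add: \<Psi>_def act_left_def reset_def mat_sum_def)
  have bell: "bell_vec \<in> carrier_vec 4" by (simp add: bell_vec_index)
  define W where "W = (\<lambda>k. (\<Psi> k (act_left 2 2 2 (kraus 2 2 (K k)) \<rho>) *\<^sub>v bell_vec) \<bullet>c bell_vec)"
  have "(\<Lambda> \<rho> *\<^sub>v bell_vec) \<bullet>c bell_vec = (\<Sum>k<Suc (length cs). W k)"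
    unfolding \<Lambda>_def W_def using scalar_prod_mat_sum[of "Suc (length cs)" _ 4 bell_vec, OF car bell]
    by (simp del: sum.lessThan_Suc)
  also have "\<dots> = W 0 + (\<Sum>k<length cs. W (Suc k))" by (rule sum.lessThan_Suc_shift)
  also have "W (Suc k) = (\<Sum>a\<in>UNIV. \<Sum>p\<in>UNIV. \<Sum>q\<in>UNIV. cnj ((cs ! k) p) * (cs ! k) q * f p a q a) / 2" for k
    by (simp add: W_def \<Psi>_def bell_form_reset act_left_def kraus_def K_def sum_lessThan_2 sum_bool f_def index_defs
        algebra_simps)
  then have "(\<Sum>k<length cs. W (Suc k)) =
      (\<Sum>k<length cs. \<Sum>a\<in>UNIV. \<Sum>p\<in>UNIV. \<Sum>q\<in>UNIV. cnj ((cs ! k) p) * (cs ! k) q * f p a q a) / 2"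
    by (simp add: sum_divide_distrib)
  also have "(\<Sum>k<length cs. \<Sum>a\<in>UNIV. \<Sum>p\<in>UNIV. \<Sum>q\<in>UNIV. cnj ((cs ! k) p) * (cs ! k) q * f p a q a) =
      (\<Sum>a\<in>UNIV. \<Sum>p\<in>UNIV. \<Sum>q\<in>UNIV. (\<Sum>k<length cs. cnj ((cs ! k) p) * (cs ! k) q) * f p a q a)"
    by (simp add: sum_bool sum.distrib sum_distrib_right)
  also have "\<dots> = (\<Sum>a\<in>UNIV. \<Sum>p\<in>UNIV. \<Sum>q\<in>UNIV. (idop q p - G q p) * f p a q a)"
    unfolding cs_sum ..
  also have "W 0 = (\<Sum>i\<in>UNIV. \<Sum>j\<in>UNIV. \<Sum>p\<in>UNIV. \<Sum>q\<in>UNIV. A i p * f p i q j * cnj (A j q)) / 2"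
    unfolding W_def bell_form[OF car]
    by (simp add: \<Psi>_def act_left_def kraus_def K_def
        sum_lessThan_2 sum_bool f_def index_defs algebra_simps)
  finally have "(\<Lambda> \<rho> *\<^sub>v bell_vec) \<bullet>c bell_vec =
      (\<Sum>i\<in>UNIV. \<Sum>j\<in>UNIV. \<Sum>p\<in>UNIV. \<Sum>q\<in>UNIV. A i p * f p i q j * cnj (A j q)) / 2 +
      (\<Sum>a\<in>UNIV. \<Sum>p\<in>UNIV. \<Sum>q\<in>UNIV. (idop q p - G q p) * f p a q a) / 2" .
  \<comment> \<open>As the partial transpose of the Bell projector is I/2 - |psi_-><psi_-|, the
    success term is half the success probability minus the form at \<phi>. Failure contributes half
    its probability, and the halves add up to 1/2.\<close>
  also have "\<dots> = (f False False False False + f False True False True + f True False True False + f True True True True) / 2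
      - sesq (pt (pair_op \<rho>)) \<phi> \<phi>"
  proof -
    have cc: "c * (c * z) = 2 * z" for z using c(1) by (metis mult.assoc)
    have p: "pair_op \<rho> (p, a) (q, b) = f p a q b" for p a q b by (simp add: pair_op_def f_def)
    show ?thesis
      by (simp add: sesq_def sum_pair pt_def p sum_bool G_def idop_def A_def c(2))
        (simp add: field_simps c(1) cc)
  qed
  also have "f False False False False + f False True False True + f True False True False + f True True True True = 1"
    using \<rho> by (simp add: mat_trace_def sum_lessThan_4 f_def index_defs numeral_3_eq_3 numeral_2_eq_2 add.assoc)
  finally show thesis using locc by (intro that[of \<Lambda>]) simp
qed

theorem mainTheorem5:
  fixes \<rho> :: "complex mat"
  assumes "is_state 4 \<rho>"
  shows "let S = {1 / (2 * (1 - p)) | (p :: real) \<rho>\<^sub>Z. 0 \<le> p \<and> p < 1 \<and> is_state 4 \<rho>\<^sub>Z \<and>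
             separable 2 2 (complex_of_real (1 - p) \<cdot>\<^sub>m \<rho> + complex_of_real p \<cdot>\<^sub>m \<rho>\<^sub>Z)}
         in optimal_fidelity \<rho> \<in> S \<and> (\<forall>x \<in> S. optimal_fidelity \<rho> \<le> x)"
proof -
  define S where "S = {1 / (2 * (1 - p)) | (p :: real) \<rho>\<^sub>Z. 0 \<le> p \<and> p < 1 \<and> is_state 4 \<rho>\<^sub>Z \<and>
             separable 2 2 (complex_of_real (1 - p) \<cdot>\<^sub>m \<rho> + complex_of_real p \<cdot>\<^sub>m \<rho>\<^sub>Z)}"
  have psd: "psd 4 \<rho>" and tr: "mat_trace \<rho> = 1" and car: "\<rho> \<in> carrier_mat 4 4"
    using assms by (simp_all add: is_state_def psd_def)
  have upper: "Re ((\<Lambda> \<rho> *\<^sub>v \<psi>) \<bullet>c \<psi>) \<le> x" if x: "x \<in> S" and L: "locc 2 2 2 2 \<Lambda>" and \<psi>: "maximally_entangled \<psi>" for x \<Lambda> \<psi>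
  proof -
    obtain p \<rho>Z where p: "x = 1 / (2 * (1 - p))" "0 \<le> p" "p < 1" "is_state 4 \<rho>Z"
      "separable 2 2 (complex_of_real (1 - p) \<cdot>\<^sub>m \<rho> + complex_of_real p \<cdot>\<^sub>m \<rho>Z)"
      using x by (auto simp: S_def)
    show ?thesis unfolding p(1)
    proof (rule locc_mixture_bound[OF L _ _ p(2,3) _ _ p(5)])
      show "\<psi> \<in> carrier_vec (2 * 2)" using maximally_entangled_carrier[OF \<psi>] by simp
      show "\<rho> \<in> carrier_mat (2 * 2) (2 * 2)" using car by simp
      show "psd (2 * 2) \<rho>Z" using p(4) by (simp add: is_state_def)
    qed (rule maximally_entangled_product_bound[OF \<psi>])
  qed
  have fraction: "singlet_fraction (\<Lambda> \<rho>) \<le> x" if "x \<in> S" "locc 2 2 2 2 \<Lambda>" for x \<Lambda>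
    unfolding singlet_fraction_def using upper[OF that] maximally_entangled_bell
    by (intro cSUP_least) auto
  have least: "optimal_fidelity \<rho> \<le> x" if "x \<in> S" for x
    unfolding optimal_fidelity_def using fraction[OF that] locc.stop[of 2 2]
    by (intro cSUP_least) auto
  have pos: "pos (pair_op \<rho>)" by (rule pos_pair_op[OF psd])
  have rtr: "rtr (pair_op \<rho>) = 1"
  proof -
    have "complex_of_real (rtr (pair_op \<rho>)) = mat_trace (pair_mat (pair_op \<rho>))"
      unfolding mat_trace_pair_mat by (rule pos_trace_real[OF pos, symmetric])
    then show ?thesis using car tr by (simp add: pair_mat_pair_op)
  qed
  obtain \<tau> where \<tau>: "pos (\<lambda>r s. \<tau> r s - pair_op \<rho> r s)" "sepc \<tau>"
    "\<And>\<epsilon>. 0 < \<epsilon> \<Longrightarrow> \<exists>\<phi>. contractive \<phi> \<and> rtr \<tau> / 2 \<le> 1 / 2 - Re (sesq (pt (pair_op \<rho>)) \<phi> \<phi>) + \<epsilon>"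
    using optimal_majorant[OF pos rtr] by blast
  define Z where "Z = (\<lambda>r s. \<tau> r s - pair_op \<rho> r s)"
  define t where "t = rtr \<tau>"
  have Z: "pos Z" using \<tau>(1) by (simp add: Z_def)
  have tZ: "rtr Z = t - 1" by (simp add: Z_def rtr_diff rtr t_def)
  have t: "1 \<le> t" using pos_rtr_nonneg[OF Z] tZ by simp
  have mem: "t / 2 \<in> S"
  proof -
    \<comment> \<open>Dividing \<tau> = \<rho> + Z by its trace t gives \<rho> the weight 1 / t and
      the normalized Z the weight p.\<close>
    define p where "p = 1 - 1 / t"
    have p: "0 \<le> p" "p < 1" "1 - p = 1 / t" using t by (simp_all add: p_def)
    have "\<exists>\<rho>Z. is_state 4 (pair_mat \<rho>Z) \<and> (\<lambda>r s. complex_of_real p * \<rho>Z r s) = (\<lambda>r s. complex_of_real (1 / t) * Z r s)"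
    proof (cases "t = 1")
      \<comment> \<open>Then \<open>Z = 0\<close> and \<open>p = 0\<close>, so any state can be the
        second component; \<rho> itself is taken.\<close>
      case True
      then have "rtr Z = 0" using tZ by simp
      then have "Z r s = 0" for r s using pos_entry_le_rtr[OF Z, of r s] by simp
      then show ?thesis using True pos rtr by (intro exI[of _ "pair_op \<rho>"]) (simp add: p_def is_state_pair_mat)
    next
      case False
      then have t1: "1 < t" using t by simp
      have "pos (\<lambda>r s. complex_of_real (1 / (t - 1)) * Z r s)"
        using Z t1 by (intro pos_scale) (simp_all add: less_eq_complex_def)
      moreover have "rtr (\<lambda>r s. complex_of_real (1 / (t - 1)) * Z r s) = 1"
        unfolding rtr_scale tZ using t1 by simp
      moreover have "p * (1 / (t - 1)) = 1 / t" using t1 by (simp add: p_def field_simps)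
      then have "(\<lambda>r s. complex_of_real p * (complex_of_real (1 / (t - 1)) * Z r s)) = (\<lambda>r s. complex_of_real (1 / t) * Z r s)"
        by (simp only: mult.assoc[symmetric] of_real_mult[symmetric])
      ultimately show ?thesis
        by (intro exI[of _ "\<lambda>r s. complex_of_real (1 / (t - 1)) * Z r s"] conjI is_state_pair_mat)
    qed
    then obtain \<rho>Z where \<rho>Z: "is_state 4 (pair_mat \<rho>Z)"
      "(\<lambda>r s. complex_of_real p * \<rho>Z r s) = (\<lambda>r s. complex_of_real (1 / t) * Z r s)" by blast
    have "complex_of_real (1 - p) \<cdot>\<^sub>m \<rho> + complex_of_real p \<cdot>\<^sub>m pair_mat \<rho>Z =
        pair_mat (\<lambda>r s. complex_of_real (1 / t) * pair_op \<rho> r s + complex_of_real (1 / t) * Z r s)"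
      unfolding pair_mat_add pair_mat_smult[symmetric] \<rho>Z(2) p(3) unfolding pair_mat_smult pair_mat_pair_op[OF car] ..
    also have "\<dots> = pair_mat (\<lambda>r s. complex_of_real (1 / t) * \<tau> r s)"
      by (simp add: Z_def flip: add_divide_distrib)
    finally have mix: "complex_of_real (1 - p) \<cdot>\<^sub>m \<rho> + complex_of_real p \<cdot>\<^sub>m pair_mat \<rho>Z =
        pair_mat (\<lambda>r s. complex_of_real (1 / t) * \<tau> r s)" .
    have "sepc (\<lambda>r s. complex_of_real (1 / t) * \<tau> r s)" using t \<tau>(2) by (intro sepc_scale) simp_all
    from sepc_decomposition[OF this] have "separable 2 2 (pair_mat (\<lambda>r s. complex_of_real (1 / t) * \<tau> r s))"
      unfolding separable_def rtr_scale t_def[symmetric] using t by simp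
    then have "separable 2 2 (complex_of_real (1 - p) \<cdot>\<^sub>m \<rho> + complex_of_real p \<cdot>\<^sub>m pair_mat \<rho>Z)"
      unfolding mix .
    moreover have "t / 2 = 1 / (2 * (1 - p))" unfolding p(3) using t by simp
    ultimately show ?thesis unfolding S_def using p(1,2) \<rho>Z(1) by blast
  qed
  have "t / 2 \<le> optimal_fidelity \<rho> + \<epsilon>" if \<epsilon>: "0 < \<epsilon>" for \<epsilon>
  proof -
    obtain \<phi> where \<phi>: "contractive \<phi>" "t / 2 \<le> 1 / 2 - Re (sesq (pt (pair_op \<rho>)) \<phi> \<phi>) + \<epsilon>"
      using \<tau>(3)[OF \<epsilon>] by (auto simp: t_def)
    obtain \<Lambda> where \<Lambda>: "locc 2 2 2 2 \<Lambda>"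
      "(\<Lambda> \<rho> *\<^sub>v bell_vec) \<bullet>c bell_vec = 1 / 2 - sesq (pt (pair_op \<rho>)) \<phi> \<phi>"
      by (rule filter_protocol[OF \<phi>(1) car tr])
    have "1 / 2 - Re (sesq (pt (pair_op \<rho>)) \<phi> \<phi>) = Re ((\<Lambda> \<rho> *\<^sub>v bell_vec) \<bullet>c bell_vec)"
      unfolding \<Lambda>(2) by simp
    \<comment> \<open>The upper bound, now available through \<open>mem\<close>, also supplies the
      boundedness that these real suprema require.\<close>
    also have "\<dots> \<le> singlet_fraction (\<Lambda> \<rho>)"
      unfolding singlet_fraction_def using maximally_entangled_bell upper[OF mem \<Lambda>(1)]
      by (intro cSUP_upper bdd_aboveI2[of _ _ "t / 2"]) auto
    also have "\<dots> \<le> optimal_fidelity \<rho>"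
      unfolding optimal_fidelity_def using \<Lambda>(1) fraction[OF mem]
      by (intro cSUP_upper bdd_aboveI2[of _ _ "t / 2"]) auto
    finally show ?thesis using \<phi>(2) by simp
  qed
  then have "t / 2 \<le> optimal_fidelity \<rho>" by (rule field_le_epsilon)
  with least[OF mem] have eq: "optimal_fidelity \<rho> = t / 2" by (rule antisym)
  show ?thesis unfolding Let_def S_def[symmetric] using mem least unfolding eq by blast
qed

end
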